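(* Let $a<b$, $\alpha,\beta\in[0,2)$ with $0\le\alpha-\beta<1$, $\eta\in(0,1)$, $\rho\in(1-\eta,1)$, $\gamma\in[0,\eta\wedge(\rho+\eta+\beta-\alpha))$ and $x\in C^\eta([a,b])$ (real-valued). Let $\varphi\in\mathscr{C}_{-\gamma}((a,b];X_\alpha)$ be such that $\hat\delta_1\varphi\in\mathscr{C}^{\rho}_{-\gamma}((a,b]^2_<;X_\beta)$. Then the convolution integral $\mathscr{I}_{S,\varphi}(s,t)=\int_s^tS(t-r)\varphi(r)\,dx(r)$ belongs to $$\bigcap_{\varepsilon\in[0,\varepsilon_0)}\mathscr{C}^{\eta\wedge(\eta+\rho+\beta-\alpha)-\gamma-\varepsilon}([a,b]^2_<;X_{\alpha+\varepsilon}),\qquad \varepsilon_0=(1+\beta-\alpha)\wedge\big(\eta\wedge(\eta+\rho+\beta-\alpha)-\gamma\big),$$ and, for every $\varepsilon\in[0,\varepsilon_0)$, there exists a positive constant $C$, depending on $\varepsilon,b-a,\eta,\gamma,\alpha,\beta,\rho$, such that $$\sup_{a\le s<t\le b}(t-s)^{-\eta\wedge(\eta+\rho+\beta-\alpha)+\gamma+\varepsilon}\bigg\|\int_s^tS(t-r)\varphi(r)\,dx(r)\bigg\|_{X_{\alpha+\varepsilon}}\le C\|x\|_{C^\eta([a,b])}\big(\|\varphi\|_{\mathscr{C}_{-\gamma}((a,b];X_\alpha)}+\|\hat\delta_1\varphi\|_{\mathscr{C}^\rho_{-\gamma}((a,b]^2_<;X_\beta)}\big),$$ where the exponent of $(t-s)$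 is $-[\eta\wedge(\eta+\rho+\beta-\alpha)]+\gamma+\varepsilon$.
   Context: Standing assumptions. $X$ is a Banach space and $A:D(A)\subset X\to X$ is the generator of a semigroup $(S(t))_{t\ge0}$ of bounded linear operators on $X$ ($S(0)=I$, $S(t+s)=S(t)S(s)$; continuity of $t\mapsto S(t)x$ at $t=0$ is not required). For every $\lambda\in[0,3)$ there is a Banach space $X_\lambda$, with $X_0=X$ and $X_1=D(A)$, such that $X_\lambda$ is continuously embedded in $X_\beta$ whenever $\beta<\lambda$. For every $T>0$, every $\zeta,\lambda\in[0,3)$ with $\zeta\le\lambda$ and every $\mu,\nu\in[0,1]$ with $\mu>\nu$ there are constants $L_{\zeta,\lambda,T},C_{\mu,\nu,T}>0$ with $\|S(t)\|_{\mathscr{L}(X_\zeta,X_\lambda)}\le L_{\zeta,\lambda,T}t^{-\lambda+\zeta}$ and $\|S(t)-I\|_{\mathscr{L}(X_\mu,X_\nu)}\le C_{\mu,\nu,T}t^{\mu-\nu}$ for every $t\in(0,T]$. Each $S(t)$, $t\ge0$, is injective. Constants in estimates may also depend on these fixed data (the spaces $X_\lambda$, the semigroup and the constants just introduced). Notation. $[a,b]^n_<=\{a\le t_1\le\dots\le t_n\le b\}$, $(a,b]^n_<=\{a<t_1\le\dots\le t_n\le b\}$. $C^\eta([a,b])$ is the usual Hölder space. For $\beta\ge0$: $\mathscr{C}^\beta([a,b]^2_<;X_\alpha)$ is the set of continuous $f:[a,b]^2_<\to X_\alpha$ with $f(s,s)=0$ for all $s$ and $\|f\|=\sup_{a\le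 s<t\le b}\|f(s,t)\|_{X_\alpha}(t-s)^{-\beta}<\infty$. For $\beta,\gamma\ge0$: $\mathscr{C}_{-\gamma}((a,b];X_\alpha)$ is the set of continuous $f:(a,b]\to X_\alpha$ with $\|f\|=\sup_{t\in(a,b]}(t-a)^\gamma\|f(t)\|_{X_\alpha}<\infty$; $\mathscr{C}^\beta_{-\gamma}((a,b]^2_<;X_\alpha)$ is the set of continuous $f:(a,b]^2_<\to X_\alpha$ with $f(s,s)=0$ for all $s$ and $\|f\|=\sup_{a<s<t\le b}(s-a)^\gamma\|f(s,t)\|_{X_\alpha}(t-s)^{-\beta}<\infty$. $(\hat\delta_1\varphi)(s,t)=\varphi(t)-S(t-s)\varphi(s)$. Convolution integral. For $x,\varphi$ as in the claim, there is a unique function $M:(a,b]^2_<\to X$ which belongs to $\bigcap_{\varepsilon\in[0,1)}\mathscr{C}^{\eta+\rho-\varepsilon}([a+\theta,b]^2_<;X_{\beta+\varepsilon})$ for every $\theta\in(0,b-a)$ and satisfies $$M(r,t)-M(s,t)-S(t-s)M(r,s)=-(x(t)-x(s))\,S(t-s)(\hat\delta_1\varphi)(r,s),\qquad (r,s,t)\in(a,b]^3_<.$$ One sets $\int_s^tS(t-r)\varphi(r)\,dx(r)=\mathscr{I}_{S,\varphi}(s,t):=(x(t)-x(s))S(t-s)\varphi(s)-M(s,t)$ for $(s,t)\in(a,b]^2_<$, extended to $s=a$ by continuity. *)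

theory Defs
  imports "HOL-Analysis.Analysis"
begin

section \<open>Semigroups on scales of Banach spaces\<close>

text \<open>
  A family of Banach spaces indexed by a real number cannot be a family of types. Since every
  space of the scale embeds into the ambient space, each of them is a linear subspace \<open>V\<close> of
  the ambient type together with a norm \<open>N\<close> of its own; the values of \<open>N\<close> off \<open>V\<close> are irrelevant.
\<close>

definition banach_subspace :: "'x::real_vector set \<Rightarrow> ('x \<Rightarrow> real) \<Rightarrow> bool" where
  "banach_subspace V N \<longleftrightarrow>
     subspace V \<and>
     (\<forall>u\<in>V. 0 \<le> N u) \<and>
     (\<forall>u\<in>V. N u = 0 \<longleftrightarrow> u = 0) \<and>
     (\<forall>u\<in>V. \<forall>c. N (c *\<^sub>R u) = \<bar>c\<bar> * N u) \<and>
     (\<forall>u\<in>V. \<forall>v\<in>V. N (u + v) \<le> N u + N v) \<and>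
     (\<forall>f :: nat \<Rightarrow> 'x. range f \<subseteq> V \<longrightarrow>
        (\<forall>e>0. \<exists>n0. \<forall>m\<ge>n0. \<forall>n\<ge>n0. N (f m - f n) < e) \<longrightarrow>
        (\<exists>l\<in>V. (\<lambda>n. N (f n - l)) \<longlonglongrightarrow> 0))"

text \<open>
  \<open>S\<close> need not be strongly continuous at \<open>0\<close>, so the limit of the difference quotients at \<open>0\<close> is not
  the appropriate notion of generator. As usual for such semigroups, the generator is the operator
  whose resolvent is the Laplace transform of \<open>S\<close>, i.e.
  \<open>(l - A)\<^sup>-\<^sup>1 y = \<integral>\<^sub>0\<^sup>\<infinity> e\<^sup>-\<^sup>l\<^sup>t S(t) y dt\<close> for all large \<open>l\<close>. For strongly continuous semigroups this is
  the infinitesimal generator. The integral is a Henstock-Kurzweil one because the library's Bochner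
  integral is restricted to second countable spaces.
\<close>

definition generates :: "'x::banach set \<Rightarrow> ('x \<Rightarrow> 'x) \<Rightarrow> (real \<Rightarrow> 'x \<Rightarrow> 'x) \<Rightarrow> bool" where
  "generates DA A S \<longleftrightarrow>
     subspace DA \<and>
     (\<forall>u\<in>DA. \<forall>v\<in>DA. A (u + v) = A u + A v) \<and>
     (\<forall>u\<in>DA. \<forall>c. A (c *\<^sub>R u) = c *\<^sub>R A u) \<and>
     (\<exists>\<omega>. \<forall>l>\<omega>. bij_betw (\<lambda>u. l *\<^sub>R u - A u) DA UNIV \<and>
        (\<forall>u\<in>DA. ((\<lambda>t. exp (- l * t) *\<^sub>R S t (l *\<^sub>R u - A u)) has_integral u) {0..}))"

text \<open>
  In \<open>X_1\<close> only the sets are identified: both \<open>X 1\<close> with \<open>N 1\<close> and the domain of the generator with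
  the graph norm are complete and continuously embedded in the ambient space, so the two norms are
  automatically equivalent.
\<close>

locale semigroup_scale =
  fixes X :: "real \<Rightarrow> 'x::banach set"
    and N :: "real \<Rightarrow> 'x \<Rightarrow> real"
    and S :: "real \<Rightarrow> 'x \<Rightarrow> 'x"
    and DA :: "'x set"
    and A :: "'x \<Rightarrow> 'x"
  assumes bounded_linear_S: "\<And>t. 0 \<le> t \<Longrightarrow> bounded_linear (S t)"
    and S_zero: "\<And>u. S 0 u = u"
    and S_add: "\<And>s t u. 0 \<le> s \<Longrightarrow> 0 \<le> t \<Longrightarrow> S (t + s) u = S t (S s u)"
    and inj_S: "\<And>t. 0 \<le> t \<Longrightarrow> inj (S t)"
    and generator: "generates DA A S"
    and X_banach: "\<And>\<xi>. \<xi> \<in> {0..<3} \<Longrightarrow> banach_subspace (X \<xi>) (N \<xi>)"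
    and X_0: "X 0 = UNIV" "\<And>u. N 0 u = norm u"
    and X_1: "X 1 = DA"
    and X_embed: "\<And>\<beta> \<xi>. \<beta> \<in> {0..<3} \<Longrightarrow> \<xi> \<in> {0..<3} \<Longrightarrow> \<beta> < \<xi> \<Longrightarrow>
          X \<xi> \<subseteq> X \<beta> \<and> (\<exists>K. \<forall>u\<in>X \<xi>. N \<beta> u \<le> K * N \<xi> u)"
    and S_smoothing: "\<And>T \<zeta> \<xi>. 0 < T \<Longrightarrow> \<zeta> \<in> {0..<3} \<Longrightarrow> \<xi> \<in> {0..<3} \<Longrightarrow> \<zeta> \<le> \<xi> \<Longrightarrow>
          \<exists>L>0. \<forall>t\<in>{0<..T}. \<forall>u\<in>X \<zeta>. S t u \<in> X \<xi> \<and> N \<xi> (S t u) \<le> L * t powr (- \<xi> + \<zeta>) * N \<zeta> u"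
    and S_near_id: "\<And>T \<mu> \<nu>. 0 < T \<Longrightarrow> \<mu> \<in> {0..1} \<Longrightarrow> \<nu> \<in> {0..1} \<Longrightarrow> \<nu> < \<mu> \<Longrightarrow>
          \<exists>C>0. \<forall>t\<in>{0<..T}. \<forall>u\<in>X \<mu>. S t u - u \<in> X \<nu> \<and> N \<nu> (S t u - u) \<le> C * t powr (\<mu> - \<nu>) * N \<mu> u"


section \<open>Function spaces\<close>

definition tri :: "real \<Rightarrow> real \<Rightarrow> (real \<times> real) set" where
  "tri a b = {(s, t). a \<le> s \<and> s \<le> t \<and> t \<le> b}"

definition tri_left_open :: "real \<Rightarrow> real \<Rightarrow> (real \<times> real) set" where
  "tri_left_open a b = {(s, t). a < s \<and> s \<le> t \<and> t \<le> b}"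

definition continuous_into ::
    "'p::topological_space set \<Rightarrow> 'x set \<Rightarrow> ('x \<Rightarrow> real) \<Rightarrow> ('p \<Rightarrow> 'x::real_vector) \<Rightarrow> bool" where
  "continuous_into D V N f \<longleftrightarrow>
     (\<forall>p\<in>D. f p \<in> V) \<and> (\<forall>p\<in>D. ((\<lambda>q. N (f q - f p)) \<longlongrightarrow> 0) (at p within D))"

text \<open>
  All suprema are taken in the reals, where the supremum of an unbounded set carries no information;
  boundedness is therefore part of membership in each space.
\<close>

definition hoelder_quot :: "real \<Rightarrow> (real \<Rightarrow> real) \<Rightarrow> real \<times> real \<Rightarrow> real" where
  "hoelder_quot \<eta> x = (\<lambda>(s, t). \<bar>x t - x s\<bar> * (t - s) powr (- \<eta>))"

definition hoelder :: "real \<Rightarrow> real \<Rightarrow> real \<Rightarrow> (real \<Rightarrow> real) set" where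
  "hoelder \<eta> a b = {x. bdd_above (hoelder_quot \<eta> x ` {(s, t). a \<le> s \<and> s < t \<and> t \<le> b})}"

definition hoelder_norm :: "real \<Rightarrow> real \<Rightarrow> real \<Rightarrow> (real \<Rightarrow> real) \<Rightarrow> real" where
  "hoelder_norm \<eta> a b x =
     (SUP t\<in>{a..b}. \<bar>x t\<bar>) + (SUP p\<in>{(s, t). a \<le> s \<and> s < t \<and> t \<le> b}. hoelder_quot \<eta> x p)"

text \<open>\<open>\<C>\<^sup>\<beta>([a,b]\<^sup>2\<^sub><; V)\<close>\<close>

definition two_hoelder ::
    "real \<Rightarrow> real \<Rightarrow> real \<Rightarrow> 'x set \<Rightarrow> ('x \<Rightarrow> real) \<Rightarrow> (real \<times> real \<Rightarrow> 'x::real_vector) set" where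
  "two_hoelder \<beta> a b V N =
     {f. continuous_into (tri a b) V N f \<and> (\<forall>s\<in>{a..b}. f (s, s) = 0) \<and>
         bdd_above ((\<lambda>(s, t). N (f (s, t)) * (t - s) powr (- \<beta>)) ` {(s, t). a \<le> s \<and> s < t \<and> t \<le> b})}"

text \<open>\<open>\<C>\<^sub>-\<^sub>\<gamma>((a,b]; V)\<close>\<close>

definition wt_cont ::
    "real \<Rightarrow> real \<Rightarrow> real \<Rightarrow> 'x set \<Rightarrow> ('x \<Rightarrow> real) \<Rightarrow> (real \<Rightarrow> 'x::real_vector) set" where
  "wt_cont \<gamma> a b V N =
     {f. continuous_into {a<..b} V N f \<and> bdd_above ((\<lambda>t. (t - a) powr \<gamma> * N (f t)) ` {a<..b})}"

definition wt_cont_norm ::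
    "real \<Rightarrow> real \<Rightarrow> real \<Rightarrow> ('x \<Rightarrow> real) \<Rightarrow> (real \<Rightarrow> 'x) \<Rightarrow> real" where
  "wt_cont_norm \<gamma> a b N f = (SUP t\<in>{a<..b}. (t - a) powr \<gamma> * N (f t))"

text \<open>\<open>\<C>\<^sup>\<beta>\<^sub>-\<^sub>\<gamma>((a,b]\<^sup>2\<^sub><; V)\<close>\<close>

definition wt_two_quot ::
    "real \<Rightarrow> real \<Rightarrow> real \<Rightarrow> ('x \<Rightarrow> real) \<Rightarrow> (real \<times> real \<Rightarrow> 'x) \<Rightarrow> real \<times> real \<Rightarrow> real" where
  "wt_two_quot \<beta> \<gamma> a N f = (\<lambda>(s, t). (s - a) powr \<gamma> * N (f (s, t)) * (t - s) powr (- \<beta>))"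

definition wt_two_hoelder ::
    "real \<Rightarrow> real \<Rightarrow> real \<Rightarrow> real \<Rightarrow> 'x set \<Rightarrow> ('x \<Rightarrow> real) \<Rightarrow> (real \<times> real \<Rightarrow> 'x::real_vector) set" where
  "wt_two_hoelder \<beta> \<gamma> a b V N =
     {f. continuous_into (tri_left_open a b) V N f \<and> (\<forall>s\<in>{a<..b}. f (s, s) = 0) \<and>
         bdd_above (wt_two_quot \<beta> \<gamma> a N f ` {(s, t). a < s \<and> s < t \<and> t \<le> b})}"

definition wt_two_hoelder_norm ::
    "real \<Rightarrow> real \<Rightarrow> real \<Rightarrow> real \<Rightarrow> ('x \<Rightarrow> real) \<Rightarrow> (real \<times> real \<Rightarrow> 'x) \<Rightarrow> real" where
  "wt_two_hoelder_norm \<beta> \<gamma> a b N f = (SUP p\<in>{(s, t). a < s \<and> s < t \<and> t \<le> b}. wt_two_quot \<beta> \<gamma> a N f p)"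


section \<open>The convolution integral\<close>

definition delta1 :: "(real \<Rightarrow> 'x \<Rightarrow> 'x) \<Rightarrow> (real \<Rightarrow> 'x::real_vector) \<Rightarrow> real \<times> real \<Rightarrow> 'x" where
  "delta1 S \<phi> = (\<lambda>(s, t). \<phi> t - S (t - s) (\<phi> s))"

definition is_conv_remainder ::
    "(real \<Rightarrow> 'x::banach set) \<Rightarrow> (real \<Rightarrow> 'x \<Rightarrow> real) \<Rightarrow> (real \<Rightarrow> 'x \<Rightarrow> 'x) \<Rightarrow>
     real \<Rightarrow> real \<Rightarrow> real \<Rightarrow> real \<Rightarrow> real \<Rightarrow> (real \<Rightarrow> real) \<Rightarrow> (real \<Rightarrow> 'x) \<Rightarrow> (real \<times> real \<Rightarrow> 'x) \<Rightarrow> bool" where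
  "is_conv_remainder X N S \<beta> \<eta> \<rho> a b x \<phi> M \<longleftrightarrow>
     (\<forall>\<theta>\<in>{0<..<b - a}. \<forall>\<epsilon>\<in>{0..<1}. M \<in> two_hoelder (\<eta> + \<rho> - \<epsilon>) (a + \<theta>) b (X (\<beta> + \<epsilon>)) (N (\<beta> + \<epsilon>))) \<and>
     (\<forall>r s t. a < r \<and> r \<le> s \<and> s \<le> t \<and> t \<le> b \<longrightarrow>
        M (r, t) - M (s, t) - S (t - s) (M (r, s)) = - ((x t - x s) *\<^sub>R S (t - s) (delta1 S \<phi> (r, s))))"

text \<open>
  \<open>M\<close> is a function on \<open>(a,b]\<^sup>2\<^sub><\<close> only; requiring it to be \<^const>\<open>extensional\<close> fixes the irrelevant
  values off this set, so that a unique function of HOL is described.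
\<close>

definition conv_remainder ::
    "(real \<Rightarrow> 'x::banach set) \<Rightarrow> (real \<Rightarrow> 'x \<Rightarrow> real) \<Rightarrow> (real \<Rightarrow> 'x \<Rightarrow> 'x) \<Rightarrow>
     real \<Rightarrow> real \<Rightarrow> real \<Rightarrow> real \<Rightarrow> real \<Rightarrow> (real \<Rightarrow> real) \<Rightarrow> (real \<Rightarrow> 'x) \<Rightarrow> real \<times> real \<Rightarrow> 'x" where
  "conv_remainder X N S \<beta> \<eta> \<rho> a b x \<phi> =
     (THE M. M \<in> extensional (tri_left_open a b) \<and> is_conv_remainder X N S \<beta> \<eta> \<rho> a b x \<phi> M)"

definition conv_integral0 ::
    "(real \<Rightarrow> 'x::banach set) \<Rightarrow> (real \<Rightarrow> 'x \<Rightarrow> real) \<Rightarrow> (real \<Rightarrow> 'x \<Rightarrow> 'x) \<Rightarrow>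
     real \<Rightarrow> real \<Rightarrow> real \<Rightarrow> real \<Rightarrow> real \<Rightarrow> (real \<Rightarrow> real) \<Rightarrow> (real \<Rightarrow> 'x) \<Rightarrow> real \<times> real \<Rightarrow> 'x" where
  "conv_integral0 X N S \<beta> \<eta> \<rho> a b x \<phi> =
     (\<lambda>(s, t). (x t - x s) *\<^sub>R S (t - s) (\<phi> s) - conv_remainder X N S \<beta> \<eta> \<rho> a b x \<phi> (s, t))"

text \<open>
  The extension by continuity to the edge \<open>s = a\<close> (corner \<open>(a, a)\<close> included) is the limit in the
  ambient Banach space along the half-open triangle.
\<close>

definition conv_integral ::
    "(real \<Rightarrow> 'x::banach set) \<Rightarrow> (real \<Rightarrow> 'x \<Rightarrow> real) \<Rightarrow> (real \<Rightarrow> 'x \<Rightarrow> 'x) \<Rightarrow>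
     real \<Rightarrow> real \<Rightarrow> real \<Rightarrow> real \<Rightarrow> real \<Rightarrow> (real \<Rightarrow> real) \<Rightarrow> (real \<Rightarrow> 'x) \<Rightarrow> real \<times> real \<Rightarrow> 'x" where
  "conv_integral X N S \<beta> \<eta> \<rho> a b x \<phi> =
     (\<lambda>(s, t). if s = a
        then Lim (at (a, t) within tri_left_open a b) (conv_integral0 X N S \<beta> \<eta> \<rho> a b x \<phi>)
        else conv_integral0 X N S \<beta> \<eta> \<rho> a b x \<phi> (s, t))"

end

theory Submission
  imports Defs
begin

text \<open>
  The remainder is the sum over \<open>k\<close> of the corrections which one dyadic refinement of the partition of
  \<open>[s, t]\<close> brings to the Riemann sum of the germ \<open>(x(t) - x(s)) S(t - s) \<phi>(s)\<close>. The points at which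
  \<open>\<delta>\<phi>\<close> enters the correction stay at distance at least \<open>(j + 1) h / 2\<close> from \<open>t\<close>, for the
  \<open>j\<close>-th interval from the right of length \<open>h\<close>; since \<open>\<Sum> (j + 1)\<^sup>-\<^sup>\<epsilon>\<close> behaves like \<open>n\<^sup>1\<^sup>-\<^sup>\<epsilon>\<close>
  for \<open>\<epsilon> < 1\<close>, the series converges geometrically in every \<open>X\<^sub>\<beta>\<^sub>+\<^sub>\<epsilon>\<close>. The integral
  is therefore reproduced by bisection. A function reproduced by bisection which is \<open>O(|t - s|\<^sup>\<mu>)\<close> with
  \<open>\<mu> > 1\<close> vanishes; applied to the difference of the integral and its sum over \<open>n\<close> equal
  pieces, this gives additivity at rational points, hence everywhere, and it also gives uniqueness.

  Germ and remainder yield an estimate of the integral with the weight \<open>(s - a)\<^sup>-\<^sup>\<gamma>\<close>. Splitting at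
  dyadic points that accumulate at \<open>s\<close> trades the weight for \<open>(t - s)\<^sup>-\<^sup>\<gamma>\<close>, and additivity turns the
  unweighted estimate into a Cauchy estimate as \<open>s\<close> tends to \<open>a\<close>.
\<close>

section \<open>The scale of spaces\<close>

text \<open>Two smoothing losses fix the exponents. In \<open>X (\<alpha> + \<epsilon>)\<close> the
  germ loses \<open>\<epsilon>\<close>, since \<open>\<phi>\<close> lives in
  \<open>X \<alpha>\<close>, but the remainder is built from \<open>delta1 S \<phi>\<close> in
  \<open>X \<beta>\<close> and has to climb by \<open>\<alpha> - \<beta> + \<epsilon>\<close>; hence
  the minimum in \<open>\<kappa>\<close>. The climb must stay below 1 for the singularity at the
  right endpoint to be summable, which gives the first bound in \<open>\<epsilon>0\<close>. The
  second one keeps \<open>\<kappa> - \<gamma> - \<epsilon>\<close> positive, so that the splitting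
  towards \<open>s\<close> converges and the integral is continuous on the diagonal.

  Two obstacles shape the rest. Cutting \<open>2 ^ k\<close> equal pieces at an interior node leaves
  blocks with arbitrary numbers of pieces, so bisection alone does not yield additivity there. And
  \<open>S\<close> need not be continuous at time 0, so continuity is proved off the diagonal, at
  positive semigroup times, and a power bound covers the diagonal.\<close>

lemma continuous_into_iff_eps:
  fixes f :: "'p::metric_space \<Rightarrow> 'x::real_vector"
  assumes V: "banach_subspace V N"
  shows "continuous_into D V N f \<longleftrightarrow>
    (\<forall>p\<in>D. f p \<in> V) \<and> (\<forall>p\<in>D. \<forall>e>0. \<exists>d>0. \<forall>q\<in>D. dist q p < d \<longrightarrow> N (f q - f p) < e)"
proof -
  have diff: "u - v \<in> V" if "u \<in> V" "v \<in> V" for u v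
    using V that subspace_diff[of V] unfolding banach_subspace_def by simp
  have nn: "0 \<le> N u" if "u \<in> V" for u using V that unfolding banach_subspace_def by simp
  have z: "N 0 = 0" using V subspace_0[of V] unfolding banach_subspace_def by simp
  have "((\<lambda>q. N (f q - f p)) \<longlongrightarrow> 0) (at p within D) \<longleftrightarrow>
      (\<forall>e>0. \<exists>d>0. \<forall>q\<in>D. dist q p < d \<longrightarrow> N (f q - f p) < e)" if "p \<in> D" "\<forall>p\<in>D. f p \<in> V" for p
  proof -
    have "((\<lambda>q. N (f q - f p)) \<longlongrightarrow> 0) (at p within D) \<longleftrightarrow>
      (\<forall>e>0. \<exists>d>0. \<forall>q\<in>D. q \<noteq> p \<and> dist q p < d \<longrightarrow> \<bar>N (f q - f p)\<bar> < e)"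
      by (simp add: tendsto_iff eventually_at dist_real_def)
    also have "\<dots> \<longleftrightarrow> (\<forall>e>0. \<exists>d>0. \<forall>q\<in>D. dist q p < d \<longrightarrow> N (f q - f p) < e)"
    proof (intro all_cong ex_cong1 conj_cong ball_cong refl)
      fix e d :: real and q assume "0 < e" "q \<in> D"
      then show "(q \<noteq> p \<and> dist q p < d \<longrightarrow> \<bar>N (f q - f p)\<bar> < e) \<longleftrightarrow> (dist q p < d \<longrightarrow> N (f q - f p) < e)"
        using nn[OF diff[of "f q" "f p"]] that z by (cases "q = p") auto
    qed
    finally show ?thesis .
  qed
  then show ?thesis unfolding continuous_into_def by blast
qed

section \<open>Norm calculus and completeness in one space of the scale\<close>

context semigroup_scale
begin

context
  fixes \<xi> :: real
  assumes \<xi>: "0 \<le> \<xi>" "\<xi> < 3"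
begin

lemma banach_subspace_X: "banach_subspace (X \<xi>) (N \<xi>)" using X_banach \<xi> by simp

lemma X_subspace: "subspace (X \<xi>)" using banach_subspace_X unfolding banach_subspace_def by simp

lemma X_zero: "0 \<in> X \<xi>" using X_subspace by (rule subspace_0)
lemma X_add: "u \<in> X \<xi> \<Longrightarrow> v \<in> X \<xi> \<Longrightarrow> u + v \<in> X \<xi>" using X_subspace by (rule subspace_add)
lemma X_diff: "u \<in> X \<xi> \<Longrightarrow> v \<in> X \<xi> \<Longrightarrow> u - v \<in> X \<xi>" using X_subspace by (rule subspace_diff)
lemma X_scale: "u \<in> X \<xi> \<Longrightarrow> c *\<^sub>R u \<in> X \<xi>" using X_subspace by (rule subspace_scale)
lemma X_sum: "(\<And>i. i \<in> B \<Longrightarrow> f i \<in> X \<xi>) \<Longrightarrow> sum f B \<in> X \<xi>"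
  using X_subspace by (rule subspace_sum)

lemma N_nonneg: "u \<in> X \<xi> \<Longrightarrow> 0 \<le> N \<xi> u" using banach_subspace_X unfolding banach_subspace_def by simp
lemma N_eq_0: "u \<in> X \<xi> \<Longrightarrow> N \<xi> u = 0 \<longleftrightarrow> u = 0" using banach_subspace_X unfolding banach_subspace_def by simp
lemma N_zero: "N \<xi> 0 = 0" using N_eq_0 X_zero by blast
lemma N_scale: "u \<in> X \<xi> \<Longrightarrow> N \<xi> (c *\<^sub>R u) = \<bar>c\<bar> * N \<xi> u"
  using banach_subspace_X unfolding banach_subspace_def by simp
lemma N_triangle: "u \<in> X \<xi> \<Longrightarrow> v \<in> X \<xi> \<Longrightarrow> N \<xi> (u + v) \<le> N \<xi> u + N \<xi> v"
  using banach_subspace_X unfolding banach_subspace_def by simp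
lemma N_minus: "u \<in> X \<xi> \<Longrightarrow> N \<xi> (- u) = N \<xi> u"
  using N_scale[of u "-1"] by simp
lemma N_minus_commute: "u \<in> X \<xi> \<Longrightarrow> v \<in> X \<xi> \<Longrightarrow> N \<xi> (u - v) = N \<xi> (v - u)"
  using N_minus[OF X_diff, of u v] by simp
lemma N_triangle_diff: "u \<in> X \<xi> \<Longrightarrow> v \<in> X \<xi> \<Longrightarrow> N \<xi> (u - v) \<le> N \<xi> u + N \<xi> v"
  using N_triangle[of u "-v"] N_minus[of v] X_scale[of v "-1"] by simp
lemma N_sum: "finite B \<Longrightarrow> (\<And>i. i \<in> B \<Longrightarrow> f i \<in> X \<xi>) \<Longrightarrow> N \<xi> (sum f B) \<le> (\<Sum>i\<in>B. N \<xi> (f i))"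
proof (induction B rule: finite_induct)
  case (insert y B)
  then show ?case using N_triangle[of "f y" "sum f B"] X_sum[of B f] by fastforce
qed (simp add: N_zero)

lemma N_complete:
  fixes f :: "nat \<Rightarrow> 'x"
  assumes "range f \<subseteq> X \<xi>" "\<And>e. e > 0 \<Longrightarrow> \<exists>n0. \<forall>m\<ge>n0. \<forall>n\<ge>n0. N \<xi> (f m - f n) < e"
  shows "\<exists>l\<in>X \<xi>. (\<lambda>n. N \<xi> (f n - l)) \<longlonglongrightarrow> 0"
proof -
  have "\<forall>f :: nat \<Rightarrow> 'x. range f \<subseteq> X \<xi> \<longrightarrow>
        (\<forall>e>0. \<exists>n0. \<forall>m\<ge>n0. \<forall>n\<ge>n0. N \<xi> (f m - f n) < e) \<longrightarrow>
        (\<exists>l\<in>X \<xi>. (\<lambda>n. N \<xi> (f n - l)) \<longlonglongrightarrow> 0)"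
    using banach_subspace_X unfolding banach_subspace_def by simp
  with assms show ?thesis by blast
qed

text \<open>The ambient space is the common reference: a limit found in some \<open>X \<xi>\<close>
  is the same vector as the ambient limit, so statements for different exponents concern one
  object.\<close>

lemma embed_norm: "\<exists>K>0. \<forall>u\<in>X \<xi>. norm u \<le> K * N \<xi> u"
proof (cases "\<xi> = 0")
  case True
  then show ?thesis using X_0 by (intro exI[of _ 1]) auto
next
  case False
  then obtain K where K: "\<forall>u\<in>X \<xi>. N 0 u \<le> K * N \<xi> u" using X_embed[of 0 \<xi>] \<xi> by auto
  show ?thesis
  proof (intro exI[of _ "max K 1"] conjI ballI)
    fix u assume u: "u \<in> X \<xi>"
    then have "norm u \<le> K * N \<xi> u" using K X_0 by auto
    also have "\<dots> \<le> max K 1 * N \<xi> u" using N_nonneg[OF u] by (intro mult_right_mono) auto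
    finally show "norm u \<le> max K 1 * N \<xi> u" .
  qed auto
qed

lemma N_tendsto_norm:
  assumes "\<And>n. f n \<in> X \<xi>" "l \<in> X \<xi>" "((\<lambda>n. N \<xi> (f n - l)) \<longlongrightarrow> 0) F"
  shows "(f \<longlongrightarrow> l) F"
proof -
  obtain K where K: "K > 0" "\<forall>u\<in>X \<xi>. norm u \<le> K * N \<xi> u" using embed_norm by blast
  have "((\<lambda>n. K * N \<xi> (f n - l)) \<longlongrightarrow> 0) F" using tendsto_mult_left[OF assms(3), of K] by simp
  then have "((\<lambda>n. f n - l) \<longlongrightarrow> 0) F"
    by (rule Lim_null_comparison[rotated]) (use K X_diff assms in auto)
  then show ?thesis using LIM_zero_cancel by blast
qed

text \<open>Norm bounds pass to limits because \<open>l - v\<close> and \<open>f n - v\<close>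
  differ by a null sequence. The fixed \<open>v\<close> serves the tails of series and the values on
  the edge.\<close>

lemma N_le_limit:
  assumes "\<And>n. f n \<in> X \<xi>" "l \<in> X \<xi>" "(\<lambda>n. N \<xi> (f n - l)) \<longlonglongrightarrow> 0"
    and "v \<in> X \<xi>" "\<forall>\<^sub>F n in sequentially. N \<xi> (f n - v) \<le> C"
  shows "N \<xi> (l - v) \<le> C"
proof -
  have "(\<lambda>n. N \<xi> (f n - l) + C) \<longlonglongrightarrow> 0 + C" by (intro tendsto_intros assms)
  moreover have "\<forall>\<^sub>F n in sequentially. N \<xi> (l - v) \<le> N \<xi> (f n - l) + C"
    using assms(5)
  proof eventually_elim
    case (elim n)
    have "l - v = (l - f n) + (f n - v)" by simp
    then have "N \<xi> (l - v) \<le> N \<xi> (l - f n) + N \<xi> (f n - v)"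
      using N_triangle[of "l - f n" "f n - v"] X_diff assms by metis
    then show ?case using elim N_minus_commute[of l "f n"] assms by simp
  qed
  ultimately show ?thesis by (metis add_0 tendsto_lowerbound trivial_limit_sequentially)
qed

text \<open>Completeness yields a limit in \<open>X \<xi>\<close>, and the embedding identifies it
  with the ambient \<open>suminf\<close>, which does not depend on \<open>\<xi>\<close>. Thus a
  single remainder can satisfy estimates in many spaces of the scale.\<close>

lemma N_series:
  fixes v :: "nat \<Rightarrow> 'x"
  assumes v: "\<And>k. v k \<in> X \<xi>" "\<And>k. N \<xi> (v k) \<le> C * q ^ k" and q: "0 \<le> q" "q < 1"
  shows "summable v" "suminf v \<in> X \<xi>" "N \<xi> (suminf v - (\<Sum>k<n. v k)) \<le> C * q ^ n / (1 - q)"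
proof -
  let ?P = "\<lambda>n. \<Sum>k<n. v k"
  have C: "0 \<le> C" using N_nonneg[OF v(1)[of 0]] v(2)[of 0] by simp
  have PX: "?P n \<in> X \<xi>" for n using v by (intro X_sum)
  have gp: "(\<Sum>k\<in>{n..<m}. C * q ^ k) = C * (q ^ n - q ^ m) / (1 - q)" if "n \<le> m" for m n
    using that
  proof (induction m rule: dec_induct)
    case (step m)
    show ?case unfolding sum.atLeastLessThan_Suc[OF step(1)] step(3) using q by (simp add: field_simps)
  qed simp
  have le: "N \<xi> (?P m - ?P n) \<le> C * q ^ n / (1 - q)" if "n \<le> m" for m n
  proof -
    have "?P m - ?P n = (\<Sum>k\<in>{n..<m}. v k)"
      using that by (simp add: sum_diff_nat_ivl atLeast0LessThan[symmetric])
    also have "N \<xi> \<dots> \<le> (\<Sum>k\<in>{n..<m}. C * q ^ k)"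
      using v by (intro order_trans[OF N_sum sum_mono]) auto
    also have "\<dots> = C * (q ^ n - q ^ m) / (1 - q)" using gp[OF that] by simp
    also have "\<dots> \<le> C * q ^ n / (1 - q)" using C q by (intro divide_right_mono mult_left_mono) auto
    finally show ?thesis .
  qed
  have lim0: "(\<lambda>n. C * q ^ n / (1 - q)) \<longlonglongrightarrow> C * 0 / (1 - q)"
    using q by (intro tendsto_intros LIMSEQ_power_zero) auto
  have "\<exists>n0. \<forall>m\<ge>n0. \<forall>n\<ge>n0. N \<xi> (?P m - ?P n) < e" if "e > 0" for e
  proof -
    from order_tendstoD(2)[OF lim0, of e] that
    obtain n0 where n0: "\<And>n. n \<ge> n0 \<Longrightarrow> C * q ^ n / (1 - q) < e" by (auto simp: eventually_sequentially)
    have "N \<xi> (?P m - ?P n) < e" if "m \<ge> n0" "n \<ge> n0" for m n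
      using le[of n m] le[of m n] n0 that N_minus_commute[OF PX PX, of m n] by (cases "n \<le> m") fastforce+
    then show ?thesis by blast
  qed
  then obtain l where l: "l \<in> X \<xi>" "(\<lambda>n. N \<xi> (?P n - l)) \<longlonglongrightarrow> 0"
    using N_complete[of ?P] PX by blast
  have "v sums l" unfolding sums_def using N_tendsto_norm[OF PX l] .
  then have s: "summable v" "suminf v = l" by (auto simp: sums_iff)
  then show "summable v" "suminf v \<in> X \<xi>" using l by auto
  have "\<forall>\<^sub>F m in sequentially. N \<xi> (?P m - ?P n) \<le> C * q ^ n / (1 - q)"
    unfolding eventually_sequentially using le by blast
  from N_le_limit[OF PX l PX this] s show "N \<xi> (suminf v - (\<Sum>k<n. v k)) \<le> C * q ^ n / (1 - q)" by simp
qed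

section \<open>Continuous maps into a space of the scale\<close>

lemma continuous_into_add:
  fixes f g :: "'p::metric_space \<Rightarrow> 'x"
  assumes "continuous_into D (X \<xi>) (N \<xi>) f" "continuous_into D (X \<xi>) (N \<xi>) g"
  shows "continuous_into D (X \<xi>) (N \<xi>) (\<lambda>p. f p + g p)"
  unfolding continuous_into_def
proof (intro conjI ballI)
  show "f p + g p \<in> X \<xi>" if "p \<in> D" for p using assms that X_add unfolding continuous_into_def by blast
  fix p assume p: "p \<in> D"
  have fX: "f q \<in> X \<xi>" "g q \<in> X \<xi>" if "q \<in> D" for q using assms that unfolding continuous_into_def by auto
  have "((\<lambda>q. N \<xi> (f q - f p) + N \<xi> (g q - g p)) \<longlongrightarrow> 0 + 0) (at p within D)"
    using assms p unfolding continuous_into_def by (intro tendsto_add) auto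
  then have lim: "((\<lambda>q. N \<xi> (f q - f p) + N \<xi> (g q - g p)) \<longlongrightarrow> 0) (at p within D)" by simp
  show "((\<lambda>q. N \<xi> (f q + g q - (f p + g p))) \<longlongrightarrow> 0) (at p within D)"
  proof (rule Lim_null_comparison[OF _ lim])
    show "\<forall>\<^sub>F q in at p within D. norm (N \<xi> (f q + g q - (f p + g p))) \<le> N \<xi> (f q - f p) + N \<xi> (g q - g p)"
      unfolding eventually_at_filter
    proof (intro always_eventually allI impI)
      fix q assume q: "q \<in> D"
      have e: "f q + g q - (f p + g p) = (f q - f p) + (g q - g p)" by simp
      show "norm (N \<xi> (f q + g q - (f p + g p))) \<le> N \<xi> (f q - f p) + N \<xi> (g q - g p)"
        unfolding e using N_triangle[OF X_diff[OF fX(1)[OF q] fX(1)[OF p]] X_diff[OF fX(2)[OF q] fX(2)[OF p]]]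
          N_nonneg[OF X_add[OF X_diff[OF fX(1)[OF q] fX(1)[OF p]] X_diff[OF fX(2)[OF q] fX(2)[OF p]]]]
        by simp
    qed
  qed
qed

lemma continuous_into_zero: "continuous_into D (X \<xi>) (N \<xi>) (\<lambda>p::'p::metric_space. 0)"
  unfolding continuous_into_def by (simp add: X_zero N_zero)

lemma continuous_into_sum:
  fixes f :: "'i \<Rightarrow> 'p::metric_space \<Rightarrow> 'x"
  assumes "\<And>i. i \<in> B \<Longrightarrow> continuous_into D (X \<xi>) (N \<xi>) (f i)"
  shows "continuous_into D (X \<xi>) (N \<xi>) (\<lambda>p. \<Sum>i\<in>B. f i p)"
  using assms
  by (induction B rule: infinite_finite_induct) (auto simp: continuous_into_zero intro!: continuous_into_add)

lemma continuous_into_scaleR: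
  fixes f :: "'p::metric_space \<Rightarrow> 'x"
  assumes "continuous_into D (X \<xi>) (N \<xi>) f" "continuous_on D c"
  shows "continuous_into D (X \<xi>) (N \<xi>) (\<lambda>p. c p *\<^sub>R f p)"
  unfolding continuous_into_def
proof (intro conjI ballI)
  have fX: "f q \<in> X \<xi>" if "q \<in> D" for q using assms that unfolding continuous_into_def by auto
  then show "c p *\<^sub>R f p \<in> X \<xi>" if "p \<in> D" for p using X_scale that by blast
  fix p assume p: "p \<in> D"
  have c: "(c \<longlongrightarrow> c p) (at p within D)" using assms p unfolding continuous_on_def by blast
  have "((\<lambda>q. \<bar>c q\<bar> * N \<xi> (f q - f p) + \<bar>c q - c p\<bar> * N \<xi> (f p)) \<longlongrightarrow> \<bar>c p\<bar> * 0 + \<bar>c p - c p\<bar> * N \<xi> (f p)) (at p within D)"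
    using assms p unfolding continuous_into_def by (intro tendsto_intros c) auto
  then have lim: "((\<lambda>q. \<bar>c q\<bar> * N \<xi> (f q - f p) + \<bar>c q - c p\<bar> * N \<xi> (f p)) \<longlongrightarrow> 0) (at p within D)" by simp
  show "((\<lambda>q. N \<xi> (c q *\<^sub>R f q - c p *\<^sub>R f p)) \<longlongrightarrow> 0) (at p within D)"
  proof (rule Lim_null_comparison[OF _ lim])
    show "\<forall>\<^sub>F q in at p within D. norm (N \<xi> (c q *\<^sub>R f q - c p *\<^sub>R f p))
        \<le> \<bar>c q\<bar> * N \<xi> (f q - f p) + \<bar>c q - c p\<bar> * N \<xi> (f p)"
      unfolding eventually_at_filter
    proof (intro always_eventually allI impI)
      fix q assume q: "q \<in> D"
      have e: "c q *\<^sub>R f q - c p *\<^sub>R f p = c q *\<^sub>R (f q - f p) + (c q - c p) *\<^sub>R f p"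
        by (simp add: algebra_simps)
      have m: "c q *\<^sub>R (f q - f p) \<in> X \<xi>" "(c q - c p) *\<^sub>R f p \<in> X \<xi>"
        using X_scale X_diff fX p q by auto
      show "norm (N \<xi> (c q *\<^sub>R f q - c p *\<^sub>R f p)) \<le> \<bar>c q\<bar> * N \<xi> (f q - f p) + \<bar>c q - c p\<bar> * N \<xi> (f p)"
        unfolding e using N_triangle[OF m] N_nonneg[OF X_add[OF m]]
          N_scale[OF X_diff[OF fX[OF q] fX[OF p]]] N_scale[OF fX[OF p]] by simp
    qed
  qed
qed

lemma continuous_into_diff:
  fixes f g :: "'p::metric_space \<Rightarrow> 'x"
  assumes "continuous_into D (X \<xi>) (N \<xi>) f" "continuous_into D (X \<xi>) (N \<xi>) g"
  shows "continuous_into D (X \<xi>) (N \<xi>) (\<lambda>p. f p - g p)"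
  using continuous_into_add[OF assms(1) continuous_into_scaleR[OF assms(2), of "\<lambda>_. -1"]] by simp

lemma continuous_into_compose:
  fixes f :: "'q::metric_space \<Rightarrow> 'x" and g :: "'p::metric_space \<Rightarrow> 'q"
  assumes f: "continuous_into E (X \<xi>) (N \<xi>) f" and g: "continuous_on D g" "g ` D \<subseteq> E"
  shows "continuous_into D (X \<xi>) (N \<xi>) (\<lambda>p. f (g p))"
  unfolding continuous_into_iff_eps[OF banach_subspace_X]
proof (intro conjI ballI allI impI)
  note f' = f[unfolded continuous_into_iff_eps[OF banach_subspace_X]]
  show "f (g p) \<in> X \<xi>" if "p \<in> D" for p using f' g that by auto
  fix p and e :: real assume p: "p \<in> D" "e > 0"
  have "g p \<in> E" using g p by auto
  then have "\<exists>d>0. \<forall>q\<in>E. dist q (g p) < d \<longrightarrow> N \<xi> (f q - f (g p)) < e" using f' p by simp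
  then obtain d where d: "d > 0" "\<forall>q\<in>E. dist q (g p) < d \<longrightarrow> N \<xi> (f q - f (g p)) < e"
    by blast
  then obtain d' where "d' > 0" "\<forall>q\<in>D. dist q p < d' \<longrightarrow> dist (g q) (g p) < d"
    using g(1) p unfolding continuous_on_iff by blast
  then show "\<exists>d>0. \<forall>q\<in>D. dist q p < d \<longrightarrow> N \<xi> (f (g q) - f (g p)) < e"
    using d g(2) by fastforce
qed

lemma continuous_into_uniform_limit:
  fixes f :: "'p::metric_space \<Rightarrow> 'x"
  assumes f: "\<And>p. p \<in> D \<Longrightarrow> f p \<in> X \<xi>"
    and g: "\<And>e. e > 0 \<Longrightarrow> \<exists>g. continuous_into D (X \<xi>) (N \<xi>) g \<and> (\<forall>p\<in>D. N \<xi> (f p - g p) \<le> e)"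
  shows "continuous_into D (X \<xi>) (N \<xi>) f"
  unfolding continuous_into_iff_eps[OF banach_subspace_X]
proof (intro conjI ballI allI impI)
  show "f p \<in> X \<xi>" if "p \<in> D" for p using f that .
  fix p and e :: real assume p: "p \<in> D" "e > 0"
  obtain g where g: "continuous_into D (X \<xi>) (N \<xi>) g" "\<forall>p\<in>D. N \<xi> (f p - g p) \<le> e/3" using g[of "e/3"] p by auto
  note g1 = g(1)[unfolded continuous_into_iff_eps[OF banach_subspace_X]]
  have "e/3 > 0" using p by simp
  then have "\<exists>d>0. \<forall>q\<in>D. dist q p < d \<longrightarrow> N \<xi> (g q - g p) < e/3" using g1 p by blast
  then obtain d where d: "d > 0" "\<forall>q\<in>D. dist q p < d \<longrightarrow> N \<xi> (g q - g p) < e/3" by blast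
  have "N \<xi> (f q - f p) < e" if q: "q \<in> D" "dist q p < d" for q
  proof -
    have gX: "g q \<in> X \<xi>" "g p \<in> X \<xi>" using g1 q p by auto
    have 1: "f q - f p = (f q - g q) + ((g q - g p) - (f p - g p))" by simp
    have "N \<xi> (f q - f p) \<le> N \<xi> (f q - g q) + N \<xi> ((g q - g p) - (f p - g p))"
      unfolding 1 using N_triangle[of "f q - g q" "(g q - g p) - (f p - g p)"] X_diff f[OF q(1)] f[OF p(1)] gX by auto
    also have "N \<xi> ((g q - g p) - (f p - g p)) \<le> N \<xi> (g q - g p) + N \<xi> (f p - g p)"
      using X_diff f[OF p(1)] gX by (intro N_triangle_diff) auto
    also have "N \<xi> (f q - g q) + (N \<xi> (g q - g p) + N \<xi> (f p - g p)) < e/3 + (e/3 + e/3)"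
      using g(2) d q p by (smt (verit))
    finally show ?thesis by simp
  qed
  with d show "\<exists>d>0. \<forall>q\<in>D. dist q p < d \<longrightarrow> N \<xi> (f q - f p) < e" by blast
qed

end

section \<open>Embeddings and the action of the semigroup\<close>

lemma embed:
  assumes "0 \<le> \<zeta>" "\<zeta> \<le> \<xi>" "\<xi> < 3"
  shows "X \<xi> \<subseteq> X \<zeta>" "\<exists>K>0. \<forall>u\<in>X \<xi>. N \<zeta> u \<le> K * N \<xi> u"
proof -
  have "X \<xi> \<subseteq> X \<zeta> \<and> (\<exists>K>0. \<forall>u\<in>X \<xi>. N \<zeta> u \<le> K * N \<xi> u)"
  proof (cases "\<zeta> = \<xi>")
    case True
    then show ?thesis by (auto intro!: exI[of _ 1])
  next
    case False
    with assms obtain K where K: "X \<xi> \<subseteq> X \<zeta>" "\<forall>u\<in>X \<xi>. N \<zeta> u \<le> K * N \<xi> u"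
      using X_embed[of \<zeta> \<xi>] by auto
    have "N \<zeta> u \<le> max K 1 * N \<xi> u" if u: "u \<in> X \<xi>" for u
    proof -
      have "N \<zeta> u \<le> K * N \<xi> u" using K u by simp
      also have "\<dots> \<le> max K 1 * N \<xi> u" using N_nonneg[OF _ _ u] assms by (intro mult_right_mono) auto
      finally show ?thesis .
    qed
    then show ?thesis using K by (auto intro!: exI[of _ "max K 1"])
  qed
  then show "X \<xi> \<subseteq> X \<zeta>" "\<exists>K>0. \<forall>u\<in>X \<xi>. N \<zeta> u \<le> K * N \<xi> u" by auto
qed

lemma continuous_into_embed:
  fixes f :: "'p::metric_space \<Rightarrow> 'x"
  assumes "0 \<le> \<zeta>" "\<zeta> \<le> \<xi>" "\<xi> < 3" and f: "continuous_into D (X \<xi>) (N \<xi>) f"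
  shows "continuous_into D (X \<zeta>) (N \<zeta>) f"
  unfolding continuous_into_def
proof (intro conjI ballI)
  note e = embed[OF assms(1-3)]
  have fX: "f p \<in> X \<xi>" if "p \<in> D" for p using f that unfolding continuous_into_def by auto
  then show "f p \<in> X \<zeta>" if "p \<in> D" for p using e(1) that by auto
  fix p assume p: "p \<in> D"
  obtain K where K: "K > 0" "\<forall>u\<in>X \<xi>. N \<zeta> u \<le> K * N \<xi> u" using e(2) by auto
  have "((\<lambda>q. K * N \<xi> (f q - f p)) \<longlongrightarrow> K * 0) (at p within D)"
    using f p unfolding continuous_into_def by (intro tendsto_intros) auto
  then have lim: "((\<lambda>q. K * N \<xi> (f q - f p)) \<longlongrightarrow> 0) (at p within D)" by simp
  show "((\<lambda>q. N \<zeta> (f q - f p)) \<longlongrightarrow> 0) (at p within D)"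
  proof (rule Lim_null_comparison[OF _ lim])
    show "\<forall>\<^sub>F q in at p within D. norm (N \<zeta> (f q - f p)) \<le> K * N \<xi> (f q - f p)"
      unfolding eventually_at_filter
    proof (intro always_eventually allI impI)
      fix q assume q: "q \<in> D"
      have m: "f q - f p \<in> X \<xi>" using X_diff[OF _ _ fX[OF q] fX[OF p]] assms by simp
      then have "0 \<le> N \<zeta> (f q - f p)" using N_nonneg[of \<zeta> "f q - f p"] e(1) assms by auto
      then show "norm (N \<zeta> (f q - f p)) \<le> K * N \<xi> (f q - f p)" using m K by simp
    qed
  qed
qed

lemma continuous_into_subset:
  "continuous_into D V M f \<Longrightarrow> E \<subseteq> D \<Longrightarrow> continuous_into E V M f"
  unfolding continuous_into_def using tendsto_within_subset by blast

lemma continuous_into_norm: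
  fixes f :: "'p::metric_space \<Rightarrow> 'x"
  assumes "0 \<le> \<xi>" "\<xi> < 3" and f: "continuous_into D (X \<xi>) (N \<xi>) f"
  shows "continuous_on D f"
proof -
  have "continuous_into D (X 0) (N 0) f" using continuous_into_embed[of 0 \<xi>] assms by simp
  then show ?thesis unfolding continuous_into_def continuous_on_def
    using X_0 by (auto simp: tendsto_norm_zero_iff intro: LIM_zero_cancel)
qed

lemma S_linear:
  assumes "0 \<le> t"
  shows "S t (u + v) = S t u + S t v" "S t (u - v) = S t u - S t v" "S t (c *\<^sub>R u) = c *\<^sub>R S t u" "S t 0 = 0"
    "S t (- u) = - S t u" "S t (sum f B) = (\<Sum>i\<in>B. S t (f i))"
proof -
  have l: "linear (S t)" using bounded_linear_S[OF assms] by (rule bounded_linear.linear)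
  show "S t (u + v) = S t u + S t v" "S t (u - v) = S t u - S t v" "S t (c *\<^sub>R u) = c *\<^sub>R S t u" "S t 0 = 0"
    "S t (- u) = - S t u" "S t (sum f B) = (\<Sum>i\<in>B. S t (f i))"
    using linear_add[OF l] linear_diff[OF l] linear_scale[OF l] linear_0[OF l] linear_neg[OF l] linear_sum[OF l]
    by auto
qed

lemma S_bdd:
  assumes "0 \<le> \<xi>" "\<xi> < 3" "0 < T"
  shows "\<exists>L\<ge>1. \<forall>t\<in>{0..T}. \<forall>u\<in>X \<xi>. S t u \<in> X \<xi> \<and> N \<xi> (S t u) \<le> L * N \<xi> u"
proof -
  obtain L where L: "L > 0" "\<forall>t\<in>{0<..T}. \<forall>u\<in>X \<xi>. S t u \<in> X \<xi> \<and> N \<xi> (S t u) \<le> L * t powr (- \<xi> + \<xi>) * N \<xi> u"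
    using S_smoothing[of T \<xi> \<xi>] assms by auto
  have "S t u \<in> X \<xi> \<and> N \<xi> (S t u) \<le> max L 1 * N \<xi> u" if t: "t \<in> {0..T}" and u: "u \<in> X \<xi>" for t u
  proof (cases "t = 0")
    case True
    have "1 * N \<xi> u \<le> max L 1 * N \<xi> u" using N_nonneg[OF _ _ u] assms by (intro mult_right_mono) auto
    then show ?thesis using True u S_zero by simp
  next
    case False
    then have 1: "S t u \<in> X \<xi>" "N \<xi> (S t u) \<le> L * N \<xi> u" using L(2) t u by auto
    have "L * N \<xi> u \<le> max L 1 * N \<xi> u" using N_nonneg[OF _ _ u] assms by (intro mult_right_mono) auto
    then show ?thesis using 1 by simp
  qed
  then show ?thesis by (intro exI[of _ "max L 1"]) auto
qed

lemma S_in_X: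
  assumes "0 \<le> \<zeta>" "\<zeta> \<le> \<xi>" "\<xi> < 3" "0 < t" "u \<in> X \<zeta>"
  shows "S t u \<in> X \<xi>"
  using S_smoothing[of t \<zeta> \<xi>] assms by auto

text \<open>The difference of two times away from 0 factors as \<open>S m\<close> after
  \<open>S d - I\<close> after \<open>S c\<close>. The inner factor lifts \<open>u\<close> into
  \<open>X 1\<close>, from where \<open>S d - I\<close> is of order \<open>d\<close> as a map into
  \<open>X 0\<close>, and the outer factor lifts the result to \<open>X \<xi>\<close>. So the orbit
  is even locally Lipschitz.\<close>

lemma S_at_tendsto:
  assumes "0 \<le> \<xi>" "\<xi> < 3" "0 < t"
  shows "((\<lambda>r. N \<xi> (S r u - S t u)) \<longlongrightarrow> 0) (at t)"
proof -
  \<comment> \<open>For \<open>r\<close> within \<open>c\<close> of \<open>t\<close> the smaller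
    time exceeds \<open>3 * c\<close>; after \<open>c\<close> is spent on the inner factor, the
    outer time \<open>m\<close> is still at least \<open>c\<close> and its smoothing cost stays
    bounded.\<close>
  define c where "c = t / 4"
  have c: "c > 0" "t = 4 * c" using assms unfolding c_def by auto
  obtain L where L: "L > 0" "\<forall>r\<in>{0<..8*c}. \<forall>v\<in>X 0. S r v \<in> X \<xi> \<and> N \<xi> (S r v) \<le> L * r powr (- \<xi> + 0) * N 0 v"
    using S_smoothing[of "8*c" 0 \<xi>] assms c by auto
  obtain K where K: "K > 0" "\<forall>r\<in>{0<..c}. \<forall>v\<in>X 1. S r v - v \<in> X 0 \<and> N 0 (S r v - v) \<le> K * r powr (1 - 0) * N 1 v"
    using S_near_id[of c 1 0] c by auto
  define w where "w = S c u"
  have w: "w \<in> X 1" unfolding w_def using S_in_X[of 0 1 c u] X_0 c by simp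
  have wn: "0 \<le> N 1 w" using N_nonneg[OF _ _ w] by simp
  define B where "B = L * c powr (- \<xi>) * K * N 1 w"
  have B: "B \<ge> 0" unfolding B_def using L K wn by simp
  have bound: "S r u - S t u \<in> X \<xi> \<and> N \<xi> (S r u - S t u) \<le> B * \<bar>r - t\<bar>" if r: "r \<noteq> t" "\<bar>r - t\<bar> < c" for r
  proof -
    define m d where "m = min r t - c" and "d = \<bar>r - t\<bar>"
    have md: "m \<ge> c" "m \<le> 8 * c" "0 < d" "d \<le> c" using r c unfolding m_def d_def by auto
    have dec: "S (m + d + c) u - S (m + c) u = S m (S d w - w)"
    proof -
      have "S (m + d + c) u = S m (S d w)"
        using S_add[of c "m + d" u] S_add[of d m w] md c unfolding w_def by simp
      moreover have "S (m + c) u = S m w" using S_add[of c m u] md c unfolding w_def by simp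
      ultimately show ?thesis using S_linear(2)[of m] md c by simp
    qed
    have Km: "S d w - w \<in> X 0" "N 0 (S d w - w) \<le> K * d * N 1 w" using K(2) md w by auto
    have Lm: "S m (S d w - w) \<in> X \<xi>" "N \<xi> (S m (S d w - w)) \<le> L * m powr (- \<xi>) * N 0 (S d w - w)"
      using L(2) Km md c by auto
    have "m powr (- \<xi>) \<le> c powr (- \<xi>)" using md c assms by (intro powr_mono2') auto
    then have "L * m powr (- \<xi>) * N 0 (S d w - w) \<le> L * c powr (- \<xi>) * (K * d * N 1 w)"
      using L Km X_0 by (intro mult_mono) auto
    then have b: "N \<xi> (S m (S d w - w)) \<le> B * d" using Lm unfolding B_def by (simp add: mult_ac)
    show ?thesis
    proof (cases "r > t")
      case True
      then have "S r u - S t u = S m (S d w - w)" using dec unfolding m_def d_def by simp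
      then show ?thesis using Lm b unfolding d_def by simp
    next
      case False
      then have "S t u - S r u = S m (S d w - w)" using dec unfolding m_def d_def by simp
      moreover have "S r u - S t u = - 1 *\<^sub>R (S t u - S r u)" by simp
      ultimately show ?thesis using Lm b X_scale[of \<xi> _ "-1"] N_scale[of \<xi> _ "-1"] assms unfolding d_def by simp
    qed
  qed
  have "((\<lambda>r. B * \<bar>r - t\<bar>) \<longlongrightarrow> B * \<bar>t - t\<bar>) (at t)" by (intro tendsto_intros)
  then have lim: "((\<lambda>r. B * \<bar>r - t\<bar>) \<longlongrightarrow> 0) (at t)" by simp
  show ?thesis
  proof (rule Lim_null_comparison[OF _ lim])
    show "\<forall>\<^sub>F r in at t. norm (N \<xi> (S r u - S t u)) \<le> B * \<bar>r - t\<bar>"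
      unfolding eventually_at using c bound N_nonneg assms
      by (intro exI[of _ c]) (auto simp: dist_real_def)
  qed
qed

text \<open>An increment of \<open>f\<close> is controlled by smoothing at times above half of
  \<open>\<tau> p\<close>, an increment of the time by continuity of the orbit of the fixed vector
  \<open>f p\<close>. Positivity of \<open>\<tau>\<close> on all of \<open>D\<close> confines
  applications to sets off the diagonal.\<close>

lemma continuous_into_S:
  fixes f :: "'p::metric_space \<Rightarrow> 'x"
  assumes \<zeta>: "0 \<le> \<zeta>" "\<zeta> \<le> \<xi>" "\<xi> < 3"
    and f: "continuous_into D (X \<zeta>) (N \<zeta>) f" and \<tau>: "continuous_on D \<tau>" "\<And>p. p \<in> D \<Longrightarrow> 0 < \<tau> p"
  shows "continuous_into D (X \<xi>) (N \<xi>) (\<lambda>p. S (\<tau> p) (f p))"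
  unfolding continuous_into_def
proof (intro conjI ballI)
  have fX: "f p \<in> X \<zeta>" if "p \<in> D" for p using f that unfolding continuous_into_def by auto
  show SX: "S (\<tau> p) (f p) \<in> X \<xi>" if "p \<in> D" for p using S_in_X[OF \<zeta>] \<tau> that fX by auto
  fix p assume p: "p \<in> D"
  define t where "t = \<tau> p"
  have t: "t > 0" using p \<tau> unfolding t_def by auto
  obtain L where L: "L > 0" "\<forall>r\<in>{0<..2*t}. \<forall>v\<in>X \<zeta>. S r v \<in> X \<xi> \<and> N \<xi> (S r v) \<le> L * r powr (- \<xi> + \<zeta>) * N \<zeta> v"
    using S_smoothing[of "2*t" \<zeta> \<xi>] \<zeta> t by auto
  have \<tau>lim: "(\<tau> \<longlongrightarrow> t) (at p within D)" using \<tau>(1) p unfolding continuous_on_def t_def by auto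
  define B where "B = L * (t/2) powr (- \<xi> + \<zeta>)"
  let ?h = "\<lambda>r. N \<xi> (S r (f p) - S t (f p))"
  have h0: "?h t = 0" using N_zero \<zeta> by simp
  have "isCont ?h t" unfolding isCont_def h0 using S_at_tendsto[of \<xi> t "f p"] \<zeta> t by simp
  then have "((\<lambda>q. ?h (\<tau> q)) \<longlongrightarrow> ?h t) (at p within D)" using \<tau>lim by (rule isCont_tendsto_compose)
  then have "((\<lambda>q. B * N \<zeta> (f q - f p) + ?h (\<tau> q)) \<longlongrightarrow> B * 0 + ?h t) (at p within D)"
    using f p unfolding continuous_into_def by (intro tendsto_intros) auto
  then have lim: "((\<lambda>q. B * N \<zeta> (f q - f p) + ?h (\<tau> q)) \<longlongrightarrow> 0) (at p within D)" using h0 by simp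
  show "((\<lambda>q. N \<xi> (S (\<tau> q) (f q) - S (\<tau> p) (f p))) \<longlongrightarrow> 0) (at p within D)"
  proof (rule Lim_null_comparison[OF _ lim])
    have "\<forall>\<^sub>F q in at p within D. t/2 < \<tau> q" "\<forall>\<^sub>F q in at p within D. \<tau> q < 2*t"
      using order_tendstoD(1)[OF \<tau>lim, of "t/2"] order_tendstoD(2)[OF \<tau>lim, of "2*t"] t by simp_all
    moreover have "\<forall>\<^sub>F q in at p within D. q \<in> D" by (simp add: eventually_at_filter)
    ultimately show "\<forall>\<^sub>F q in at p within D. norm (N \<xi> (S (\<tau> q) (f q) - S (\<tau> p) (f p))) \<le> B * N \<zeta> (f q - f p) + ?h (\<tau> q)"
    proof eventually_elim
      case (elim q)
      have d: "f q - f p \<in> X \<zeta>" using X_diff fX p elim \<zeta> by simp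
      have 1: "S (\<tau> q) (f q - f p) \<in> X \<xi>" "N \<xi> (S (\<tau> q) (f q - f p)) \<le> L * \<tau> q powr (- \<xi> + \<zeta>) * N \<zeta> (f q - f p)"
        using L(2) d elim t by auto
      have "\<tau> q powr (- \<xi> + \<zeta>) \<le> (t/2) powr (- \<xi> + \<zeta>)" using elim t \<zeta> by (intro powr_mono2') auto
      then have "L * \<tau> q powr (- \<xi> + \<zeta>) * N \<zeta> (f q - f p) \<le> B * N \<zeta> (f q - f p)"
        unfolding B_def using L N_nonneg[OF _ _ d] \<zeta> by (intro mult_mono) auto
      moreover have e: "S (\<tau> q) (f q) - S (\<tau> p) (f p) = S (\<tau> q) (f q - f p) + (S (\<tau> q) (f p) - S t (f p))"
        using S_linear(2)[of "\<tau> q"] elim t unfolding t_def by simp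
      moreover have 2: "S (\<tau> q) (f p) - S t (f p) \<in> X \<xi>"
        using X_diff[of \<xi>] S_in_X[OF \<zeta>] fX p elim t \<zeta> by simp
      ultimately have "N \<xi> (S (\<tau> q) (f q) - S (\<tau> p) (f p)) \<le> B * N \<zeta> (f q - f p) + ?h (\<tau> q)"
        using N_triangle[of \<xi>, OF _ _ 1(1) 2] 1(2) \<zeta> by simp
      moreover have "0 \<le> N \<xi> (S (\<tau> q) (f q) - S (\<tau> p) (f p))"
        unfolding e using N_nonneg[of \<xi>] X_add[of \<xi>, OF _ _ 1(1) 2] \<zeta> by simp
      ultimately show ?case by simp
    qed
  qed
qed

end

section \<open>Convolution sums over equidistant partitions\<close>

definition node :: "nat \<Rightarrow> real \<Rightarrow> real \<Rightarrow> nat \<Rightarrow> real" where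
  "node n s t i = s + (t - s) * real i / real n"

lemma node_0 [simp]: "node n s t 0 = s" by (simp add: node_def)
lemma node_self [simp]: "n > 0 \<Longrightarrow> node n s t n = t" by (simp add: node_def)
lemma node_diff: "node n s t (Suc i) - node n s t i = (t - s) / real n"
  by (simp add: node_def algebra_simps add_divide_distrib diff_divide_distrib)
lemma node_mono: "s \<le> t \<Longrightarrow> i \<le> j \<Longrightarrow> node n s t i \<le> node n s t j"
  unfolding node_def by (intro add_left_mono divide_right_mono mult_left_mono) auto
lemma node_bounds: "s \<le> t \<Longrightarrow> i \<le> n \<Longrightarrow> s \<le> node n s t i \<and> node n s t i \<le> t"
  using node_mono[of s t 0 i n] node_mono[of s t i n n] by (cases "n = 0") auto

lemma node_nested:
  assumes "n > 0" "m > 0"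
  shows "node (n * m) s t (i * m + j) = node m (node n s t i) (node n s t (Suc i)) j"
  unfolding node_def using assms by (simp add: field_simps)

lemma node_left:
  assumes "m > 0"
  shows "node (m + k) s t i = node m s (node (m + k) s t m) i"
  unfolding node_def using assms by simp

lemma node_right:
  assumes "k > 0"
  shows "node (m + k) s t (m + i) = node k (node (m + k) s t m) t i"
proof -
  have "real m + real k > 0" using assms by simp
  then show ?thesis unfolding node_def using assms by (simp add: divide_simps) (simp add: algebra_simps)
qed

lemma sum_lessThan_add:
  fixes g :: "nat \<Rightarrow> 'b::comm_monoid_add"
  shows "(\<Sum>i<m + k. g i) = (\<Sum>i<m. g i) + (\<Sum>i<k. g (m + i))"
  by (induction k) (auto simp: add.assoc)

context semigroup_scale
begin

text \<open>For \<open>f = germ\<close> this is a Riemann sum of the convolution integral. In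
  general it composes pieces by the twisted additivity rule
  \<open>f r t = f s t + S (t - s) (f r s)\<close>; a function obeying that rule is fixed by
  \<open>psum n\<close> for every \<open>n > 0\<close>.\<close>

definition psum :: "nat \<Rightarrow> (real \<Rightarrow> real \<Rightarrow> 'x) \<Rightarrow> real \<Rightarrow> real \<Rightarrow> 'x" where
  "psum n f s t = (\<Sum>i<n. S (t - node n s t (Suc i)) (f (node n s t i) (node n s t (Suc i))))"

lemma psum_1: "psum (Suc 0) f s t = f s t"
  by (simp add: psum_def S_zero)

lemma psum_2: "psum 2 f s t = S (t - (s + t) / 2) (f s ((s + t) / 2)) + f ((s + t) / 2) t"
proof -
  have e: "node (Suc (Suc 0)) s t (Suc 0) = (s + t) / 2" "node (Suc (Suc 0)) s t (Suc (Suc 0)) = t"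
    by (auto simp: node_def field_simps)
  show ?thesis unfolding psum_def numeral_2_eq_2 sum.lessThan_Suc node_0 e by (simp add: S_zero)
qed

lemma psum_cong:
  assumes "s \<le> t" "\<And>u v. s \<le> u \<Longrightarrow> u \<le> v \<Longrightarrow> v \<le> t \<Longrightarrow> f u v = g u v"
  shows "psum n f s t = psum n g s t"
  unfolding psum_def
proof (intro sum.cong refl)
  fix i assume "i \<in> {..<n}"
  then have "f (node n s t i) (node n s t (Suc i)) = g (node n s t i) (node n s t (Suc i))"
    using node_bounds[of s t i n] node_bounds[of s t "Suc i" n] node_mono[of s t i "Suc i" n] assms by auto
  then show "S (t - node n s t (Suc i)) (f (node n s t i) (node n s t (Suc i)))
    = S (t - node n s t (Suc i)) (g (node n s t i) (node n s t (Suc i)))" by simp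
qed

lemma psum_diff:
  assumes "s \<le> t"
  shows "psum n (\<lambda>u v. f u v - g u v) s t = psum n f s t - psum n g s t"
  unfolding psum_def sum_subtractf[symmetric]
  by (intro sum.cong refl S_linear) (use node_bounds assms in auto)

text \<open>The twist of a block splits off by the semigroup law. Since
  \<open>n * m = m * n\<close>, the operators \<open>psum n\<close> and \<open>psum m\<close>
  commute, which is later used with \<open>m = 2\<close>.\<close>

lemma psum_nested:
  assumes "n > 0" "m > 0" "s \<le> t"
  shows "psum (n * m) f s t = psum n (psum m f) s t"
proof -
  let ?F = "\<lambda>l. S (t - node (n * m) s t (Suc l)) (f (node (n * m) s t l) (node (n * m) s t (Suc l)))"
  have "psum (n * m) f s t = (\<Sum>i<n. sum ?F {i * m..<i * m + m})"
    unfolding psum_def by (rule sum.nat_group[symmetric])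
  also have "\<dots> = psum n (psum m f) s t"
    unfolding psum_def
  proof (intro sum.cong refl)
    fix i assume i: "i \<in> {..<n}"
    define u v where uv: "u = node n s t i" "v = node n s t (Suc i)"
    have b: "u \<le> v" "v \<le> t" using node_bounds[of s t "Suc i" n] node_mono[of s t i "Suc i" n] i assms uv by auto
    have "sum ?F {i * m..<i * m + m} = (\<Sum>j<m. ?F (i * m + j))"
      using sum.shift_bounds_nat_ivl[of ?F 0 "i * m" m] by (simp add: add.commute atLeast0LessThan)
    also have "\<dots> = (\<Sum>j<m. S (t - v) (S (v - node m u v (Suc j)) (f (node m u v j) (node m u v (Suc j)))))"
    proof (intro sum.cong refl)
      fix j assume j: "j \<in> {..<m}"
      have "node (n * m) s t (i * m + j) = node m u v j" "node (n * m) s t (Suc (i * m + j)) = node m u v (Suc j)"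
        using node_nested[of n m s t i j] node_nested[of n m s t i "Suc j"] assms uv by auto
      moreover have "S (t - node m u v (Suc j)) w = S (t - v) (S (v - node m u v (Suc j)) w)" for w
        using S_add[of "v - node m u v (Suc j)" "t - v" w] node_bounds[of u v "Suc j" m] b j by simp
      ultimately show "?F (i * m + j) = S (t - v) (S (v - node m u v (Suc j)) (f (node m u v j) (node m u v (Suc j))))"
        by simp
    qed
    also have "\<dots> = S (t - v) (psum m f u v)" unfolding psum_def using b by (simp add: S_linear)
    finally show "sum ?F {i * m..<i * m + m} = S (t - node n s t (Suc i))
      (\<Sum>ia<m. S (node n s t (Suc i) - node m (node n s t i) (node n s t (Suc i)) (Suc ia))
              (f (node m (node n s t i) (node n s t (Suc i)) ia) (node m (node n s t i) (node n s t (Suc i)) (Suc ia))))"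
      unfolding psum_def uv .
  qed
  finally show ?thesis .
qed

text \<open>Both blocks have the mesh of the whole partition, but in general different numbers of
  pieces; only the left one carries a twist.\<close>

lemma psum_split:
  assumes "m > 0" "k > 0" "r \<le> t" and s: "s = node (m + k) r t m"
  shows "psum (m + k) f r t = S (t - s) (psum m f r s) + psum k f s t"
proof -
  have b: "r \<le> s" "s \<le> t" using node_bounds[of r t m "m + k"] assms by auto
  have L: "node (m + k) r t i = node m r s i" for i using node_left[of m k r t i] assms by simp
  have R: "node (m + k) r t (m + i) = node k s t i" for i using node_right[of k m r t i] assms by simp
  have R': "node (m + k) r t (Suc (m + i)) = node k s t (Suc i)" for i using R[of "Suc i"] by simp
  have "psum (m + k) f r t = (\<Sum>i<m. S (t - node (m+k) r t (Suc i)) (f (node (m+k) r t i) (node (m+k) r t (Suc i)))) + psum k f s t"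
    unfolding psum_def sum_lessThan_add R R' ..
  also have "(\<Sum>i<m. S (t - node (m+k) r t (Suc i)) (f (node (m+k) r t i) (node (m+k) r t (Suc i))))
    = (\<Sum>i<m. S (t - s) (S (s - node m r s (Suc i)) (f (node m r s i) (node m r s (Suc i)))))"
  proof (intro sum.cong refl)
    fix i assume "i \<in> {..<m}"
    then show "S (t - node (m+k) r t (Suc i)) (f (node (m+k) r t i) (node (m+k) r t (Suc i)))
      = S (t - s) (S (s - node m r s (Suc i)) (f (node m r s i) (node m r s (Suc i))))"
      unfolding L using S_add[of "s - node m r s (Suc i)" "t - s"] node_bounds[of r s "Suc i" m] b by simp
  qed
  also have "\<dots> = S (t - s) (psum m f r s)" unfolding psum_def using b by (simp add: S_linear)
  finally show ?thesis .
qed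

text \<open>Each of the \<open>n\<close> pieces contributes at most
  \<open>L * C * ((t - s) / n) powr \<mu>\<close>, so for \<open>\<mu> > 1\<close> refinement makes
  the sum small.\<close>

lemma norm_psum_le:
  assumes st: "s \<le> t" and n: "n > 0" and L: "L \<ge> 0" "\<And>\<tau> u. 0 \<le> \<tau> \<Longrightarrow> \<tau> \<le> t - s \<Longrightarrow> norm (S \<tau> u) \<le> L * norm u"
    and f: "\<And>u v. s \<le> u \<Longrightarrow> u \<le> v \<Longrightarrow> v \<le> t \<Longrightarrow> norm (f u v) \<le> C * (v - u) powr \<mu>"
  shows "norm (psum n f s t) \<le> L * C * (t - s) powr \<mu> * real n powr (1 - \<mu>)"
proof -
  have "norm (psum n f s t) \<le> (\<Sum>i<n. L * (C * ((t - s) / n) powr \<mu>))"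
    unfolding psum_def
  proof (rule sum_norm_le)
    fix i assume i: "i \<in> {..<n}"
    let ?u = "node n s t i" and ?v = "node n s t (Suc i)"
    have b: "s \<le> ?u" "?u \<le> ?v" "?v \<le> t"
      using node_bounds[of s t i n] node_bounds[of s t "Suc i" n] node_mono[of s t i "Suc i" n] st i by auto
    have "norm (S (t - ?v) (f ?u ?v)) \<le> L * norm (f ?u ?v)" using b by (intro L) auto
    also have "\<dots> \<le> L * (C * (?v - ?u) powr \<mu>)" using L f[OF b] by (intro mult_left_mono) auto
    finally show "norm (S (t - ?v) (f ?u ?v)) \<le> L * (C * ((t - s) / n) powr \<mu>)" by (simp add: node_diff)
  qed
  also have "\<dots> = L * C * (t - s) powr \<mu> * real n powr (1 - \<mu>)"
    using n st by (simp add: powr_divide powr_diff)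
  finally show ?thesis .
qed

text \<open>Nesting turns invariance under bisection into invariance under
  \<open>psum (2 ^ k)\<close> for every \<open>k\<close>, and the bound on these sums tends to 0.
  Both \<open>psum_integ\<close> and \<open>is_conv_remainder_unique\<close> rest on this.\<close>

lemma psum_2_fixpoint_eq_0:
  assumes st: "s \<le> t" and \<mu>: "\<mu> > 1"
    and f: "\<And>u v. s \<le> u \<Longrightarrow> u \<le> v \<Longrightarrow> v \<le> t \<Longrightarrow> norm (f u v) \<le> C * (v - u) powr \<mu>"
    and fp: "\<And>u v. s \<le> u \<Longrightarrow> u \<le> v \<Longrightarrow> v \<le> t \<Longrightarrow> psum 2 f u v = f u v"
  shows "f s t = 0"
proof -
  have "\<exists>L\<ge>1. \<forall>\<tau>\<in>{0..t - s + 1}. \<forall>u\<in>X 0. S \<tau> u \<in> X 0 \<and> N 0 (S \<tau> u) \<le> L * N 0 u"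
    using st by (intro S_bdd) auto
  then obtain L where L: "L \<ge> 1" "\<And>\<tau> u. 0 \<le> \<tau> \<Longrightarrow> \<tau> \<le> t - s \<Longrightarrow> norm (S \<tau> u) \<le> L * norm u"
    using X_0 by auto
  have eq: "psum (2 ^ k) f s t = f s t" for k
  proof (induction k)
    case (Suc k)
    have "psum (2 ^ Suc k) f s t = psum (2 ^ k) (psum 2 f) s t"
      using psum_nested[of "2 ^ k" 2 s t f] st by (simp add: mult.commute)
    also have "\<dots> = psum (2 ^ k) f s t" using st fp by (intro psum_cong)
    finally show ?case using Suc by simp
  qed (simp add: psum_1)
  have "norm (f s t) \<le> L * C * (t - s) powr \<mu> * (2 powr (1 - \<mu>)) ^ k" for k
  proof -
    have "real (2 ^ k) powr (1 - \<mu>) = (2 powr (1 - \<mu>)) ^ k"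
      by (simp add: powr_power powr_realpow[symmetric] powr_powr mult.commute)
    then show ?thesis using norm_psum_le[of s t "2 ^ k" L f C \<mu>] L st f eq[of k] by simp
  qed
  moreover have "(\<lambda>k. L * C * (t - s) powr \<mu> * (2 powr (1 - \<mu>)) ^ k) \<longlonglongrightarrow> L * C * (t - s) powr \<mu> * 0"
    using \<mu> powr_less_mono[of "1 - \<mu>" 0 2] by (intro tendsto_intros LIMSEQ_power_zero) auto
  ultimately have "norm (f s t) \<le> 0" using LIMSEQ_le_const by fastforce
  then show ?thesis by simp
qed

end

section \<open>The remainder of the convolution integral\<close>

text \<open>Discrete comparison with the integral of \<open>r powr (- \<epsilon>)\<close>: each term
  is bounded by a difference of values of the antiderivative, and these telescope.\<close>

lemma sum_powr_neg_le:
  fixes \<epsilon> :: real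
  assumes "0 \<le> \<epsilon>" "\<epsilon> < 1"
  shows "(\<Sum>j<n. real (Suc j) powr (- \<epsilon>)) \<le> real n powr (1 - \<epsilon>) / (1 - \<epsilon>)"
proof (induction n)
  case (Suc n)
  have "(1 - \<epsilon>) * real (Suc n) powr (- \<epsilon>) \<le> real (Suc n) powr (1 - \<epsilon>) - real n powr (1 - \<epsilon>)"
  proof (cases "n = 0")
    case False
    \<comment> \<open>Weighted arithmetic-geometric mean inequality with weights
      \<open>1 - \<epsilon>\<close> and \<open>\<epsilon>\<close>; division by
      \<open>real (Suc n) powr \<epsilon>\<close> leaves the telescoping difference.\<close>
    have "real n powr (1 - \<epsilon>) * real (Suc n) powr \<epsilon> \<le> (1 - \<epsilon>) * real n + \<epsilon> * real (Suc n)"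
      using False assms by (intro Youngs_inequality_0) auto
    also have "\<dots> = real (Suc n) - (1 - \<epsilon>)" by (simp add: algebra_simps)
    finally have "real n powr (1 - \<epsilon>) * real (Suc n) powr \<epsilon> * real (Suc n) powr (- \<epsilon>)
        \<le> (real (Suc n) - (1 - \<epsilon>)) * real (Suc n) powr (- \<epsilon>)" by (intro mult_right_mono) auto
    moreover have "real n powr (1 - \<epsilon>) * real (Suc n) powr \<epsilon> * real (Suc n) powr (- \<epsilon>) = real n powr (1 - \<epsilon>)"
      unfolding mult.assoc powr_add[symmetric] by simp
    moreover have "real (Suc n) * real (Suc n) powr (- \<epsilon>) = real (Suc n) powr (1 - \<epsilon>)"
      using powr_mult_base[of "real (Suc n)" "- \<epsilon>"] by simp
    ultimately show ?thesis by (simp only: left_diff_distrib)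
  qed (use assms in simp)
  then have "real (Suc n) powr (- \<epsilon>) \<le> (real (Suc n) powr (1 - \<epsilon>) - real n powr (1 - \<epsilon>)) / (1 - \<epsilon>)"
    using assms by (simp add: pos_le_divide_eq mult.commute)
  then show ?case using Suc unfolding sum.lessThan_Suc diff_divide_distrib by linarith
qed simp

lemma continuous_into_cong:
  assumes "\<And>p. p \<in> D \<Longrightarrow> f p = g p"
  shows "continuous_into D V M f \<longleftrightarrow> continuous_into D V M g"
proof -
  have "((\<lambda>q. M (f q - f p)) \<longlongrightarrow> 0) (at p within D) \<longleftrightarrow> ((\<lambda>q. M (g q - g p)) \<longlongrightarrow> 0) (at p within D)"
    if "p \<in> D" for p
    by (rule filterlim_cong) (use that assms in \<open>auto simp: eventually_at_filter\<close>)
  then show ?thesis unfolding continuous_into_def using assms by simp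
qed

context semigroup_scale
begin

text \<open>On the diagonal \<open>f\<close> vanishes and the power bound alone gives continuity;
  off it, a neighbourhood that avoids the diagonal reduces the claim to \<open>off\<close>. No
  continuity of \<open>S\<close> at time 0 enters.\<close>

lemma continuous_into_tri:
  assumes \<xi>: "0 \<le> \<xi>" "\<xi> < 3" and p: "p > 0"
    and off: "continuous_into {(s, t). c \<le> s \<and> s < t \<and> t \<le> b} (X \<xi>) (N \<xi>) f"
    and diag: "\<And>s. c \<le> s \<Longrightarrow> s \<le> b \<Longrightarrow> f (s, s) = 0"
    and bound: "\<And>s t. c \<le> s \<Longrightarrow> s < t \<Longrightarrow> t \<le> b \<Longrightarrow> N \<xi> (f (s, t)) \<le> K * (t - s) powr p"
  shows "continuous_into (tri c b) (X \<xi>) (N \<xi>) f"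
  unfolding continuous_into_iff_eps[OF banach_subspace_X[OF \<xi>]]
proof (intro conjI ballI allI impI)
  note off' = off[unfolded continuous_into_iff_eps[OF banach_subspace_X[OF \<xi>]]]
  show fX: "f z \<in> X \<xi>" if z: "z \<in> tri c b" for z
  proof -
    obtain s t where st: "z = (s, t)" "c \<le> s" "s \<le> t" "t \<le> b" using z unfolding tri_def by auto
    show ?thesis using off' st diag X_zero[OF \<xi>] by (cases "s = t") auto
  qed
  fix z and e :: real assume z: "z \<in> tri c b" and e: "e > 0"
  obtain s t where st: "z = (s, t)" "c \<le> s" "s \<le> t" "t \<le> b" using z unfolding tri_def by auto
  show "\<exists>d>0. \<forall>q\<in>tri c b. dist q z < d \<longrightarrow> N \<xi> (f q - f z) < e"
  proof (cases "s = t")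
    case True
    \<comment> \<open>Points within \<open>d\<close> of \<open>(s, s)\<close> have coordinates less
      than \<open>2 * d\<close> apart, and \<open>(2 * d) powr p\<close> equals
      \<open>e / (\<bar>K\<bar> + 1)\<close>.\<close>
    define d where "d = (e / (\<bar>K\<bar> + 1)) powr (1 / p) / 2"
    have d: "d > 0" unfolding d_def using e by auto
    have "N \<xi> (f q - f z) < e" if q: "q \<in> tri c b" "dist q z < d" for q
    proof -
      obtain s' t' where q': "q = (s', t')" "c \<le> s'" "s' \<le> t'" "t' \<le> b" using q unfolding tri_def by auto
      have "dist s' s < d" "dist t' t < d"
        using dist_fst_le[of q z] dist_snd_le[of q z] q q' st by auto
      then have l: "t' - s' < 2 * d" using True by (auto simp: dist_real_def)
      have fz: "f q - f z = f q" using True st diag by simp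
      show ?thesis
      proof (cases "s' = t'")
        case True
        then show ?thesis unfolding fz using q' diag e N_zero[OF \<xi>] by simp
      next
        case False
        have "N \<xi> (f q) \<le> K * (t' - s') powr p" using bound[of s' t'] q' False by simp
        also have "\<dots> \<le> \<bar>K\<bar> * (t' - s') powr p" by (intro mult_right_mono) auto
        also have "\<dots> \<le> \<bar>K\<bar> * (2 * d) powr p" using l p q' False by (intro mult_left_mono powr_mono2) auto
        also have "(2 * d) powr p = e / (\<bar>K\<bar> + 1)"
          unfolding d_def using e p by (simp add: powr_powr)
        also have "\<bar>K\<bar> * (e / (\<bar>K\<bar> + 1)) < e" using e by (simp add: field_simps)
        finally show ?thesis unfolding fz .
      qed
    qed
    then show ?thesis using d by blast
  next
    case False
    have zD: "z \<in> {(s, t). c \<le> s \<and> s < t \<and> t \<le> b}" using st False by simp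
    have "\<exists>d>0. \<forall>q\<in>{(s, t). c \<le> s \<and> s < t \<and> t \<le> b}. dist q z < d \<longrightarrow> N \<xi> (f q - f z) < e"
      by (rule bspec[OF conjunct2[OF off'] zD, rule_format, OF e])
    then obtain d where d: "d > 0" "\<And>q. q \<in> {(s, t). c \<le> s \<and> s < t \<and> t \<le> b} \<Longrightarrow> dist q z < d \<Longrightarrow> N \<xi> (f q - f z) < e"
      by blast
    have "N \<xi> (f q - f z) < e" if q: "q \<in> tri c b" "dist q z < min d ((t - s) / 2)" for q
    proof -
      obtain s' t' where q': "q = (s', t')" "c \<le> s'" "s' \<le> t'" "t' \<le> b" using q unfolding tri_def by auto
      have "dist s' s < (t - s) / 2" "dist t' t < (t - s) / 2"
        using dist_fst_le[of q z] dist_snd_le[of q z] q q' st by auto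
      then have "s' - s < (t - s) / 2" "s - s' < (t - s) / 2" "t' - t < (t - s) / 2" "t - t' < (t - s) / 2"
        unfolding dist_real_def abs_less_iff by auto
      then have "s' < t'" by (simp add: field_simps)
      then show ?thesis using q q' by (intro d) auto
    qed
    then show ?thesis using d(1) False st by (intro exI[of _ "min d ((t - s) / 2)"]) auto
  qed
qed

end

text \<open>\<open>H\<close>, \<open>P\<close> and \<open>Q\<close> are any admissible bounds rather
  than norms, which keeps suprema out of the argument; \<open>convolution_data_norms\<close> inserts
  the norms at the end.\<close>

locale convolution_data = semigroup_scale X N S DA A
  for X :: "real \<Rightarrow> 'x::banach set" and N S DA A +
  fixes a b \<alpha> \<beta> \<eta> \<rho> \<gamma> H P Q :: real and x :: "real \<Rightarrow> real" and \<phi> :: "real \<Rightarrow> 'x"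
  assumes ab: "a < b"
    and exps: "0 \<le> \<beta>" "\<beta> \<le> \<alpha>" "\<alpha> < 2" "\<alpha> - \<beta> < 1" "0 < \<eta>" "\<eta> < 1" "1 - \<eta> < \<rho>" "0 \<le> \<gamma>" "\<gamma> < \<eta>" "\<gamma> < \<eta> + \<rho> + \<beta> - \<alpha>"
    and H: "0 \<le> H" and P: "0 \<le> P" and Q: "0 \<le> Q"
    and x_bound: "\<And>s t. a \<le> s \<Longrightarrow> s \<le> t \<Longrightarrow> t \<le> b \<Longrightarrow> \<bar>x t - x s\<bar> \<le> H * (t - s) powr \<eta>"
    and \<phi>_cont: "continuous_into {a<..b} (X \<alpha>) (N \<alpha>) \<phi>"
    and \<phi>_bound: "\<And>t. a < t \<Longrightarrow> t \<le> b \<Longrightarrow> N \<alpha> (\<phi> t) \<le> P * (t - a) powr (- \<gamma>)"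
    and \<delta>\<phi>_cont: "continuous_into (tri_left_open a b) (X \<beta>) (N \<beta>) (delta1 S \<phi>)"
    and \<delta>\<phi>_bound: "\<And>s t. a < s \<Longrightarrow> s \<le> t \<Longrightarrow> t \<le> b \<Longrightarrow>
      N \<beta> (delta1 S \<phi> (s, t)) \<le> Q * (s - a) powr (- \<gamma>) * (t - s) powr \<rho>"
begin

definition germ :: "real \<Rightarrow> real \<Rightarrow> 'x" where
  "germ s t = (x t - x s) *\<^sub>R S (t - s) (\<phi> s)"

text \<open>The right-hand side of the equation that characterises \<open>M\<close>. The germ
  satisfies the same equation by \<open>germ_defect\<close>, so germ minus remainder obeys twisted
  additivity as soon as the remainder solves it.\<close>

definition defect :: "real \<Rightarrow> real \<Rightarrow> real \<Rightarrow> 'x" where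
  "defect r s t = - ((x t - x s) *\<^sub>R S (t - s) (delta1 S \<phi> (r, s)))"

text \<open>By \<open>sum_level\<close> this is the Riemann sum over \<open>2 ^ k\<close> pieces
  minus the one over \<open>2 ^ Suc k\<close> pieces.\<close>

definition level :: "nat \<Rightarrow> real \<Rightarrow> real \<Rightarrow> 'x" where
  "level k = psum (2 ^ k) (\<lambda>u v. defect u ((u + v) / 2) v)"

definition remainder :: "real \<Rightarrow> real \<Rightarrow> 'x" where
  "remainder s t = (\<Sum>k. level k s t)"

text \<open>Gain per refinement: twice as many terms, each smaller by the factor
  \<open>2 powr (- (\<eta> + \<rho>))\<close>.\<close>

definition q where "q = 2 powr (1 - (\<eta> + \<rho>))"

lemma q: "0 < q" "q < 1"
  unfolding q_def using exps powr_less_mono[of "1 - (\<eta> + \<rho>)" 0 2] by auto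

lemma \<delta>\<phi>_in: "a < s \<Longrightarrow> s \<le> t \<Longrightarrow> t \<le> b \<Longrightarrow> delta1 S \<phi> (s, t) \<in> X \<beta>"
  using \<delta>\<phi>_cont unfolding continuous_into_def tri_left_open_def by auto

lemma x_continuous: "continuous_on {a..b} x"
  unfolding continuous_on_iff
proof (intro ballI allI impI)
  fix s and e :: real assume s: "s \<in> {a..b}" and e: "e > 0"
  define d where "d = (e / (H + 1)) powr (1 / \<eta>)"
  have d: "d > 0" unfolding d_def using e H by simp
  have "dist (x t) (x s) < e" if t: "t \<in> {a..b}" "dist t s < d" for t
  proof -
    have "\<bar>x t - x s\<bar> \<le> H * \<bar>t - s\<bar> powr \<eta>"
      using x_bound[of s t] x_bound[of t s] s t by (cases "s \<le> t") (auto simp: abs_minus_commute)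
    also have "\<dots> \<le> H * d powr \<eta>" using t H exps by (intro mult_left_mono powr_mono2) (auto simp: dist_real_def)
    also have "d powr \<eta> = e / (H + 1)" unfolding d_def using e H exps by (simp add: powr_powr)
    also have "H * (e / (H + 1)) < e" using e H by (simp add: field_simps)
    finally show ?thesis by (simp add: dist_real_def)
  qed
  then show "\<exists>d>0. \<forall>t\<in>{a..b}. dist t s < d \<longrightarrow> dist (x t) (x s) < e" using d by blast
qed

lemma germ_defect:
  assumes "r \<le> s" "s \<le> t"
  shows "germ r t - germ s t - S (t - s) (germ r s) = defect r s t"
proof -
  have "S (t - s) (S (s - r) (\<phi> r)) = S (t - r) (\<phi> r)" using S_add[of "s - r" "t - s"] assms by simp
  then show ?thesis
    unfolding germ_def defect_def delta1_def using assms by (simp add: S_linear algebra_simps)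
qed

text \<open>The twist \<open>S (t - v)\<close> merges with the factor \<open>S (v - s)\<close>
  inside the defect, so that the smoothing time is \<open>t - s\<close>. It stays positive for the
  last piece, where \<open>v = t\<close> and the twist itself smooths nothing.\<close>

lemma S_defect:
  assumes "s \<le> v" "v \<le> t"
  shows "S (t - v) (defect r s v) = (x s - x v) *\<^sub>R S (t - s) (delta1 S \<phi> (r, s))"
proof -
  have "S (t - v) (S (v - s) w) = S (t - s) w" for w using S_add[of "v - s" "t - v"] assms by simp
  then show ?thesis unfolding defect_def using assms by (simp add: S_linear algebra_simps)
qed

text \<open>Bound of level 0, from which the later ones decay like \<open>q ^ k\<close>. Smoothing
  takes \<open>\<epsilon>\<close> off the exponent, and \<open>1 / (1 - \<epsilon>)\<close> comes
  from summing the singularities.\<close>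

definition level_const :: "real \<Rightarrow> real \<Rightarrow> real \<Rightarrow> real \<Rightarrow> real" where
  "level_const \<epsilon> L s t = H * L * Q * (s - a) powr (- \<gamma>) * (t - s) powr (\<eta> + \<rho> - \<epsilon>) / (1 - \<epsilon>)"

context
  fixes \<epsilon> L :: real
  assumes \<epsilon>: "0 \<le> \<epsilon>" "\<epsilon> < 1"
    and L: "0 < L" "\<And>\<tau> u. 0 < \<tau> \<Longrightarrow> \<tau> \<le> b - a \<Longrightarrow> u \<in> X \<beta> \<Longrightarrow>
      S \<tau> u \<in> X (\<beta> + \<epsilon>) \<and> N (\<beta> + \<epsilon>) (S \<tau> u) \<le> L * \<tau> powr (- \<epsilon>) * N \<beta> u"
begin

lemma \<beta>_plus_bounds: "0 \<le> \<beta> + \<epsilon>" "\<beta> + \<epsilon> < 3" using exps \<epsilon> by auto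

lemma level_bound:
  assumes st: "a < s" "s < t" "t \<le> b"
  shows "level k s t \<in> X (\<beta> + \<epsilon>)" "N (\<beta> + \<epsilon>) (level k s t) \<le> level_const \<epsilon> L s t * q ^ k"
proof -
  define n :: nat where "n = 2 ^ k"
  define h where "h = (t - s) / n"
  define f where "f i = S (t - node n s t (Suc i)) (defect (node n s t i)
    ((node n s t i + node n s t (Suc i)) / 2) (node n s t (Suc i)))" for i
  \<comment> \<open>The part of the bound common to all pieces; the dependence on the distance to
    \<open>t\<close>, through \<open>real (n - i) powr (- \<epsilon>)\<close>, is summed
    separately.\<close>
  define B where "B = H * L * Q * (s - a) powr (- \<gamma>) * (h / 2) powr (\<eta> + \<rho> - \<epsilon>)"
  have n: "n > 0" unfolding n_def by simp
  then have h: "h > 0" unfolding h_def using st by simp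
  have f: "f i \<in> X (\<beta> + \<epsilon>) \<and> N (\<beta> + \<epsilon>) (f i) \<le> B * real (n - i) powr (- \<epsilon>)" if i: "i < n" for i
  proof -
    define u v m where "u = node n s t i" and "v = node n s t (Suc i)" and "m = (u + v) / 2"
    have b: "s \<le> u" "v \<le> t" unfolding u_def v_def using node_bounds[of s t i n] node_bounds[of s t "Suc i" n] st i by auto
    have d: "v - u = h" unfolding u_def v_def h_def using node_diff .
    have m: "m - u = h / 2" "v - m = h / 2" unfolding m_def using d by (simp_all add: field_simps)
    \<comment> \<open>\<open>t - m\<close> is \<open>real (n - i) * h - h / 2\<close> and
      \<open>n - i\<close> is at least 1, so half of \<open>real (n - i) * h\<close>
      remains.\<close>
    have tm: "t - m \<ge> real (n - i) * (h / 2)"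
    proof -
      have "t - u = real (n - i) * h"
        unfolding u_def node_def h_def using n i by (simp add: field_simps of_nat_diff)
      moreover have "real (n - i) \<ge> 1" using i by simp
      then have "1 * h \<le> real (n - i) * h" using h by (intro mult_right_mono) auto
      moreover have "real (n - i) * (h / 2) = real (n - i) * h / 2" by simp
      ultimately show ?thesis using m by linarith
    qed
    have tm0: "real (n - i) * (h / 2) > 0" using i h by simp
    have dX: "delta1 S \<phi> (u, m) \<in> X \<beta>" using \<delta>\<phi>_in[of u m] b m h st by simp
    have dN: "N \<beta> (delta1 S \<phi> (u, m)) \<le> Q * (u - a) powr (- \<gamma>) * (h / 2) powr \<rho>"
      using \<delta>\<phi>_bound[of u m] b m h st by simp
    have fi: "f i = (x m - x v) *\<^sub>R S (t - m) (delta1 S \<phi> (u, m))"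
      unfolding f_def u_def[symmetric] v_def[symmetric] m_def[symmetric] using S_defect[of m v t u] b m h by simp
    have Sm: "S (t - m) (delta1 S \<phi> (u, m)) \<in> X (\<beta> + \<epsilon>)"
      "N (\<beta> + \<epsilon>) (S (t - m) (delta1 S \<phi> (u, m))) \<le> L * (t - m) powr (- \<epsilon>) * N \<beta> (delta1 S \<phi> (u, m))"
      using L(2)[of "t - m" "delta1 S \<phi> (u, m)"] dX tm tm0 b m h st by auto
    have "N (\<beta> + \<epsilon>) (f i) = \<bar>x v - x m\<bar> * N (\<beta> + \<epsilon>) (S (t - m) (delta1 S \<phi> (u, m)))"
      unfolding fi using N_scale[OF \<beta>_plus_bounds Sm(1)] by (simp add: abs_minus_commute)
    also have "\<dots> \<le> (H * (h / 2) powr \<eta>) * (L * (real (n - i) * (h / 2)) powr (- \<epsilon>) * (Q * (s - a) powr (- \<gamma>) * (h / 2) powr \<rho>))"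
    proof (intro mult_mono)
      show "\<bar>x v - x m\<bar> \<le> H * (h / 2) powr \<eta>" using x_bound[of m v] b m h st by simp
      have "N \<beta> (delta1 S \<phi> (u, m)) \<le> Q * (s - a) powr (- \<gamma>) * (h / 2) powr \<rho>"
      proof -
        have "(u - a) powr (- \<gamma>) \<le> (s - a) powr (- \<gamma>)" using b st exps by (intro powr_mono2') auto
        then have "Q * (u - a) powr (- \<gamma>) * (h / 2) powr \<rho> \<le> Q * (s - a) powr (- \<gamma>) * (h / 2) powr \<rho>"
          using Q by (intro mult_right_mono mult_left_mono) auto
        then show ?thesis using dN by simp
      qed
      moreover have "(t - m) powr (- \<epsilon>) \<le> (real (n - i) * (h / 2)) powr (- \<epsilon>)"
        by (intro powr_mono2' tm tm0) (use \<epsilon> in simp)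
      ultimately have "L * (t - m) powr (- \<epsilon>) * N \<beta> (delta1 S \<phi> (u, m)) \<le>
          L * (real (n - i) * (h / 2)) powr (- \<epsilon>) * (Q * (s - a) powr (- \<gamma>) * (h / 2) powr \<rho>)"
        using L(1) N_nonneg[OF _ _ dX] exps by (intro mult_mono) auto
      then show "N (\<beta> + \<epsilon>) (S (t - m) (delta1 S \<phi> (u, m))) \<le>
          L * (real (n - i) * (h / 2)) powr (- \<epsilon>) * (Q * (s - a) powr (- \<gamma>) * (h / 2) powr \<rho>)"
        using Sm(2) by simp
      show "0 \<le> N (\<beta> + \<epsilon>) (S (t - m) (delta1 S \<phi> (u, m)))" using N_nonneg[OF \<beta>_plus_bounds Sm(1)] .
    qed (use H in auto)
    also have "\<dots> = B * real (n - i) powr (- \<epsilon>)"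
    proof -
      have "(h / 2) powr (\<eta> + \<rho> - \<epsilon>) = (h / 2) powr \<eta> * (h / 2) powr \<rho> * (h / 2) powr (- \<epsilon>)"
        by (simp add: powr_add[symmetric])
      moreover have "(real (n - i) * (h / 2)) powr (- \<epsilon>) = real (n - i) powr (- \<epsilon>) * (h / 2) powr (- \<epsilon>)"
        using h by (intro powr_mult)
      ultimately show ?thesis unfolding B_def by (simp only: mult_ac)
    qed
    finally show ?thesis using X_scale[OF \<beta>_plus_bounds Sm(1)] fi by simp
  qed
  have lev: "level k s t = (\<Sum>i<n. f i)" unfolding level_def psum_def f_def n_def ..
  show "level k s t \<in> X (\<beta> + \<epsilon>)" unfolding lev using f by (intro X_sum[OF \<beta>_plus_bounds]) auto
  have B0: "0 \<le> B" unfolding B_def using H L Q by simp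
  have "N (\<beta> + \<epsilon>) (level k s t) \<le> (\<Sum>i<n. N (\<beta> + \<epsilon>) (f i))"
    unfolding lev using f by (intro N_sum[OF \<beta>_plus_bounds]) auto
  also have "\<dots> \<le> (\<Sum>i<n. B * real (n - i) powr (- \<epsilon>))" using f by (intro sum_mono) auto
  also have "\<dots> = B * (\<Sum>i<n. real (n - i) powr (- \<epsilon>))" by (simp add: sum_distrib_left)
  also have "(\<Sum>i<n. real (n - i) powr (- \<epsilon>)) = (\<Sum>j<n. real (Suc j) powr (- \<epsilon>))"
    by (rule sum.reindex_bij_witness[of _ "\<lambda>j. n - Suc j" "\<lambda>i. n - Suc i"]) auto
  also have "B * \<dots> \<le> B * (real n powr (1 - \<epsilon>) / (1 - \<epsilon>))"
    using B0 sum_powr_neg_le[OF \<epsilon>, of n] by (intro mult_left_mono) auto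
  \<comment> \<open>The powers of \<open>n\<close> combine to the exponent
    \<open>1 - \<epsilon> - (\<eta> + \<rho> - \<epsilon>)\<close>, from which
    \<open>\<epsilon>\<close> cancels: the same ratio \<open>q\<close> serves every space.\<close>
  also have "\<dots> \<le> level_const \<epsilon> L s t * q ^ k"
  proof -
    let ?\<mu> = "\<eta> + \<rho> - \<epsilon>"
    have "(h / 2) powr ?\<mu> * real n powr (1 - \<epsilon>) \<le> h powr ?\<mu> * real n powr (1 - \<epsilon>)"
      using h exps \<epsilon> by (intro mult_right_mono powr_mono2) auto
    also have "\<dots> = (t - s) powr ?\<mu> * real n powr (1 - (\<eta> + \<rho>))"
      unfolding h_def using n st by (simp add: powr_divide powr_diff powr_add mult_ac)
    also have "real n powr (1 - (\<eta> + \<rho>)) = q ^ k"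
      unfolding n_def q_def by (simp add: powr_power powr_realpow[symmetric] powr_powr mult.commute)
    finally have "(H * L * Q * (s - a) powr (- \<gamma>) / (1 - \<epsilon>)) * ((h / 2) powr ?\<mu> * real n powr (1 - \<epsilon>))
      \<le> (H * L * Q * (s - a) powr (- \<gamma>) / (1 - \<epsilon>)) * ((t - s) powr ?\<mu> * q ^ k)"
      using H L Q \<epsilon> by (intro mult_left_mono) auto
    then show ?thesis unfolding B_def level_const_def by (simp add: mult_ac)
  qed
  finally show "N (\<beta> + \<epsilon>) (level k s t) \<le> level_const \<epsilon> L s t * q ^ k" .
qed

lemma remainder_bound:
  assumes st: "a < s" "s < t" "t \<le> b"
  shows "(\<lambda>k. level k s t) sums remainder s t" "remainder s t \<in> X (\<beta> + \<epsilon>)"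
    "N (\<beta> + \<epsilon>) (remainder s t - (\<Sum>k<n. level k s t)) \<le> level_const \<epsilon> L s t * q ^ n / (1 - q)"
    "N (\<beta> + \<epsilon>) (remainder s t) \<le> level_const \<epsilon> L s t / (1 - q)"
proof -
  note ser = N_series[OF \<beta>_plus_bounds level_bound[OF st] less_imp_le[OF q(1)] q(2)]
  show "(\<lambda>k. level k s t) sums remainder s t" unfolding remainder_def using ser(1) by (rule summable_sums)
  show "remainder s t \<in> X (\<beta> + \<epsilon>)"
    "N (\<beta> + \<epsilon>) (remainder s t - (\<Sum>k<n. level k s t)) \<le> level_const \<epsilon> L s t * q ^ n / (1 - q)"
    unfolding remainder_def using ser(2,3) by auto
  show "N (\<beta> + \<epsilon>) (remainder s t) \<le> level_const \<epsilon> L s t / (1 - q)"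
    using ser(3)[of 0] unfolding remainder_def by simp
qed

text \<open>After \<open>S_defect\<close> every summand contains \<open>S\<close> at the positive
  time \<open>snd z - m i z\<close>, also for the last piece, and so
  \<open>continuous_into_S\<close> applies.\<close>

lemma level_continuous:
  assumes "a < c"
  shows "continuous_into {(s, t). c \<le> s \<and> s < t \<and> t \<le> b} (X (\<beta> + \<epsilon>)) (N (\<beta> + \<epsilon>)) (\<lambda>(s, t). level k s t)"
    (is "continuous_into ?D _ _ _")
proof -
  define n :: nat where "n = 2 ^ k"
  have n: "n > 0" unfolding n_def by simp
  define u v m where "u i z = node n (fst z) (snd z) i" and "v i z = node n (fst z) (snd z) (Suc i)"
    and "m i z = (u i z + v i z) / 2" for i and z :: "real \<times> real"
  have cont: "continuous_on ?D (u i)" "continuous_on ?D (v i)" "continuous_on ?D (m i)" for i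
    unfolding m_def u_def v_def node_def by (intro continuous_intros; use n in simp)+
  have b: "a < u i z" "u i z < m i z" "m i z < v i z" "v i z \<le> snd z" "snd z \<le> b" if "z \<in> ?D" "i < n" for i z
  proof -
    have zz: "c \<le> fst z" "fst z < snd z" "snd z \<le> b" using that by auto
    have "v i z - u i z > 0" unfolding u_def v_def node_diff using zz n by simp
    moreover have "fst z \<le> u i z" "v i z \<le> snd z"
      unfolding u_def v_def using node_bounds[of "fst z" "snd z" i n] node_bounds[of "fst z" "snd z" "Suc i" n] zz that by auto
    ultimately show "a < u i z" "u i z < m i z" "m i z < v i z" "v i z \<le> snd z" "snd z \<le> b"
      unfolding m_def using zz assms by auto
  qed
  have "continuous_into ?D (X (\<beta> + \<epsilon>)) (N (\<beta> + \<epsilon>))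
    (\<lambda>z. \<Sum>i<n. (x (m i z) - x (v i z)) *\<^sub>R S (snd z - m i z) (delta1 S \<phi> (u i z, m i z)))"
  proof (rule continuous_into_sum[OF \<beta>_plus_bounds], rule continuous_into_scaleR[OF \<beta>_plus_bounds])
    fix i assume "i \<in> {..<n}"
    then have i: "i < n" by simp
    show "continuous_into ?D (X (\<beta> + \<epsilon>)) (N (\<beta> + \<epsilon>)) (\<lambda>z. S (snd z - m i z) (delta1 S \<phi> (u i z, m i z)))"
    proof (rule continuous_into_S[of \<beta>])
      show "continuous_into ?D (X \<beta>) (N \<beta>) (\<lambda>z. delta1 S \<phi> (u i z, m i z))"
      proof (rule continuous_into_compose[OF _ _ \<delta>\<phi>_cont])
        show "continuous_on ?D (\<lambda>z. (u i z, m i z))" by (intro continuous_intros cont)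
        show "(\<lambda>z. (u i z, m i z)) ` ?D \<subseteq> tri_left_open a b"
        proof (rule image_subsetI)
          fix z assume "z \<in> ?D"
          from b[OF this i] show "(u i z, m i z) \<in> tri_left_open a b" unfolding tri_left_open_def by simp
        qed
      qed (use exps in auto)
      show "continuous_on ?D (\<lambda>z. snd z - m i z)" by (intro continuous_intros cont)
      show "0 < snd z - m i z" if "z \<in> ?D" for z using b[OF that i] by simp
    qed (use exps \<epsilon> in auto)
    have "continuous_on ?D (\<lambda>z. x (m i z))" "continuous_on ?D (\<lambda>z. x (v i z))"
    proof -
      have "m i z \<in> {a..b} \<and> v i z \<in> {a..b}" if "z \<in> ?D" for z using b[OF that i] by simp
      then have "m i ` ?D \<subseteq> {a..b}" "v i ` ?D \<subseteq> {a..b}" by (simp_all only: image_subset_iff) simp_all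
      then show "continuous_on ?D (\<lambda>z. x (m i z))" "continuous_on ?D (\<lambda>z. x (v i z))"
        using continuous_on_compose2[OF x_continuous cont(3)] continuous_on_compose2[OF x_continuous cont(2)] by simp_all
    qed
    then show "continuous_on ?D (\<lambda>z. x (m i z) - x (v i z))" by (intro continuous_intros)
  qed
  moreover have "(case z of (s, t) \<Rightarrow> level k s t) =
      (\<Sum>i<n. (x (m i z) - x (v i z)) *\<^sub>R S (snd z - m i z) (delta1 S \<phi> (u i z, m i z)))" if "z \<in> ?D" for z
  proof -
    have "level k (fst z) (snd z) = (\<Sum>i<n. S (snd z - v i z) (defect (u i z) (m i z) (v i z)))"
      unfolding level_def psum_def n_def[symmetric] m_def u_def v_def ..
    also have "\<dots> = (\<Sum>i<n. (x (m i z) - x (v i z)) *\<^sub>R S (snd z - m i z) (delta1 S \<phi> (u i z, m i z)))"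
      using b[OF that] by (intro sum.cong refl S_defect) (auto intro: less_imp_le)
    finally show ?thesis by (simp add: case_prod_beta)
  qed
  ultimately show ?thesis using continuous_into_cong[of ?D "\<lambda>(s, t). level k s t"] by simp
qed

end

lemma level_refl: "level k s s = 0"
  by (simp add: level_def psum_def node_def defect_def S_linear)

lemma remainder_refl: "remainder s s = 0"
  by (simp add: remainder_def level_refl)

section \<open>Regularity of the remainder away from \<open>a\<close>\<close>

context
  fixes \<epsilon> L c :: real
  assumes \<epsilon>: "0 \<le> \<epsilon>" "\<epsilon> < 1"
    and L: "0 < L" "\<And>\<tau> u. 0 < \<tau> \<Longrightarrow> \<tau> \<le> b - a \<Longrightarrow> u \<in> X \<beta> \<Longrightarrow>
      S \<tau> u \<in> X (\<beta> + \<epsilon>) \<and> N (\<beta> + \<epsilon>) (S \<tau> u) \<le> L * \<tau> powr (- \<epsilon>) * N \<beta> u"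
    and c: "a < c"
begin

lemma level_const_le:
  assumes "c \<le> s" "s \<le> t"
  shows "level_const \<epsilon> L s t \<le> H * L * Q * (c - a) powr (- \<gamma>) / (1 - \<epsilon>) * (t - s) powr (\<eta> + \<rho> - \<epsilon>)"
proof -
  have "(s - a) powr (- \<gamma>) \<le> (c - a) powr (- \<gamma>)" using assms c exps by (intro powr_mono2') auto
  then have "H * L * Q * (s - a) powr (- \<gamma>) * ((t - s) powr (\<eta> + \<rho> - \<epsilon>) / (1 - \<epsilon>))
      \<le> H * L * Q * (c - a) powr (- \<gamma>) * ((t - s) powr (\<eta> + \<rho> - \<epsilon>) / (1 - \<epsilon>))"
    using H L Q \<epsilon> by (intro mult_right_mono mult_left_mono) auto
  then show ?thesis unfolding level_const_def by simp
qed

text \<open>For \<open>s \<ge> c > a\<close> the weight is bounded, hence the levels sum uniformly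
  off the diagonal. The diagonal is left to the power bound, whose exponent is positive because
  \<open>\<eta> + \<rho> > 1 > \<epsilon>\<close>.\<close>

lemma remainder_continuous_tri:
  "continuous_into (tri c b) (X (\<beta> + \<epsilon>)) (N (\<beta> + \<epsilon>)) (\<lambda>(s, t). remainder s t)"
proof (rule continuous_into_tri[OF \<beta>_plus_bounds[OF \<epsilon> L], of "\<eta> + \<rho> - \<epsilon>"])
  define K where "K = H * L * Q * (c - a) powr (- \<gamma>) / (1 - \<epsilon>)"
  define K' where "K' = K * (b - a) powr (\<eta> + \<rho> - \<epsilon>)"
  have K0: "0 \<le> K" unfolding K_def using H L Q \<epsilon> by simp
  show "0 < \<eta> + \<rho> - \<epsilon>" using exps \<epsilon> by simp
  show "(case (s, s) of (s, t) \<Rightarrow> remainder s t) = 0" for s using remainder_refl by simp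
  show "N (\<beta> + \<epsilon>) (case (s, t) of (s, t) \<Rightarrow> remainder s t) \<le> K / (1 - q) * (t - s) powr (\<eta> + \<rho> - \<epsilon>)"
    if "c \<le> s" "s < t" "t \<le> b" for s t
  proof -
    have "N (\<beta> + \<epsilon>) (remainder s t) \<le> level_const \<epsilon> L s t / (1 - q)"
      using remainder_bound(4)[OF \<epsilon> L, of s t] that c by simp
    also have "\<dots> \<le> K * (t - s) powr (\<eta> + \<rho> - \<epsilon>) / (1 - q)"
      unfolding K_def using level_const_le that q by (intro divide_right_mono) auto
    finally show ?thesis by simp
  qed
  let ?D = "{(s, t). c \<le> s \<and> s < t \<and> t \<le> b}"
  show "continuous_into ?D (X (\<beta> + \<epsilon>)) (N (\<beta> + \<epsilon>)) (\<lambda>(s, t). remainder s t)"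
  proof (rule continuous_into_uniform_limit[OF \<beta>_plus_bounds[OF \<epsilon> L]])
    show "(case z of (s, t) \<Rightarrow> remainder s t) \<in> X (\<beta> + \<epsilon>)" if "z \<in> ?D" for z
      using remainder_bound(2)[OF \<epsilon> L, of "fst z" "snd z"] that c by (auto simp: case_prod_beta)
    fix e :: real assume e: "e > 0"
    have "(\<lambda>n. K' * q ^ n / (1 - q)) \<longlonglongrightarrow> K' * 0 / (1 - q)"
      using q by (intro tendsto_intros LIMSEQ_power_zero) auto
    then have "\<forall>\<^sub>F n in sequentially. K' * q ^ n / (1 - q) < e" using e by (intro order_tendstoD(2)) auto
    then obtain n where n: "K' * q ^ n / (1 - q) < e" by (auto simp: eventually_sequentially)
    have "N (\<beta> + \<epsilon>) (remainder s t - (\<Sum>k<n. level k s t)) \<le> e" if st: "c \<le> s" "s < t" "t \<le> b" for s t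
    proof -
      have "level_const \<epsilon> L s t \<le> K * (t - s) powr (\<eta> + \<rho> - \<epsilon>)"
        unfolding K_def using level_const_le st by simp
      also have "\<dots> \<le> K'" unfolding K'_def using K0 st c exps \<epsilon> by (intro mult_left_mono powr_mono2) auto
      finally have "level_const \<epsilon> L s t * q ^ n / (1 - q) \<le> K' * q ^ n / (1 - q)"
        using q by (intro divide_right_mono mult_right_mono) auto
      then show ?thesis using remainder_bound(3)[OF \<epsilon> L, of s t n] st c n by simp
    qed
    then have "\<forall>z\<in>?D. N (\<beta> + \<epsilon>) ((case z of (s, t) \<Rightarrow> remainder s t) - (\<Sum>k<n. case z of (s, t) \<Rightarrow> level k s t)) \<le> e"
      by (auto simp: case_prod_beta)
    moreover have "continuous_into ?D (X (\<beta> + \<epsilon>)) (N (\<beta> + \<epsilon>)) (\<lambda>z. \<Sum>k<n. case z of (s, t) \<Rightarrow> level k s t)"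
      using level_continuous[OF \<epsilon> L c]
      by (intro continuous_into_sum[OF \<beta>_plus_bounds[OF \<epsilon> L]])
    ultimately show "\<exists>g. continuous_into ?D (X (\<beta> + \<epsilon>)) (N (\<beta> + \<epsilon>)) g \<and>
        (\<forall>p\<in>?D. N (\<beta> + \<epsilon>) ((case p of (s, t) \<Rightarrow> remainder s t) - g p) \<le> e)" by blast
  qed
qed

lemma remainder_two_hoelder:
  "(\<lambda>(s, t). remainder s t) \<in> two_hoelder (\<eta> + \<rho> - \<epsilon>) c b (X (\<beta> + \<epsilon>)) (N (\<beta> + \<epsilon>))"
proof -
  define K where "K = H * L * Q * (c - a) powr (- \<gamma>) / (1 - \<epsilon>) / (1 - q)"
  have "N (\<beta> + \<epsilon>) (remainder s t) * (t - s) powr (- (\<eta> + \<rho> - \<epsilon>)) \<le> K" if st: "c \<le> s" "s < t" "t \<le> b" for s t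
  proof -
    have "N (\<beta> + \<epsilon>) (remainder s t) \<le> level_const \<epsilon> L s t / (1 - q)"
      using remainder_bound(4)[OF \<epsilon> L, of s t] st c by simp
    also have "\<dots> \<le> H * L * Q * (c - a) powr (- \<gamma>) / (1 - \<epsilon>) * (t - s) powr (\<eta> + \<rho> - \<epsilon>) / (1 - q)"
      using level_const_le st q by (intro divide_right_mono) auto
    also have "\<dots> = K * (t - s) powr (\<eta> + \<rho> - \<epsilon>)" unfolding K_def by simp
    finally have "N (\<beta> + \<epsilon>) (remainder s t) * (t - s) powr (- (\<eta> + \<rho> - \<epsilon>))
        \<le> K * (t - s) powr (\<eta> + \<rho> - \<epsilon>) * (t - s) powr (- (\<eta> + \<rho> - \<epsilon>))" by (rule mult_right_mono) simp
    also have "\<dots> = K" unfolding mult.assoc powr_add[symmetric] using st by simp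
    finally show ?thesis .
  qed
  then have "bdd_above ((\<lambda>(s, t). N (\<beta> + \<epsilon>) (remainder s t) * (t - s) powr (- (\<eta> + \<rho> - \<epsilon>))) ` {(s, t). c \<le> s \<and> s < t \<and> t \<le> b})"
    by (intro bdd_aboveI[of _ K]) (auto simp: case_prod_beta)
  then show ?thesis unfolding two_hoelder_def using remainder_continuous_tri remainder_refl by (simp add: case_prod_beta)
qed

end

lemma smoothing_\<beta>:
  assumes "0 \<le> \<epsilon>" "\<epsilon> < 1"
  obtains L where "0 < L" "\<And>\<tau> u. 0 < \<tau> \<Longrightarrow> \<tau> \<le> b - a \<Longrightarrow> u \<in> X \<beta> \<Longrightarrow>
      S \<tau> u \<in> X (\<beta> + \<epsilon>) \<and> N (\<beta> + \<epsilon>) (S \<tau> u) \<le> L * \<tau> powr (- \<epsilon>) * N \<beta> u"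
  using S_smoothing[of "b - a" \<beta> "\<beta> + \<epsilon>"] assms exps ab by auto

section \<open>The integral as a limit of Riemann sums\<close>

definition integ :: "real \<Rightarrow> real \<Rightarrow> 'x" where
  "integ s t = germ s t - remainder s t"

lemma integ_refl: "integ s s = 0"
  by (simp add: integ_def germ_def remainder_refl)

lemma germ_continuous:
  assumes "a < c" "\<alpha> \<le> \<xi>" "\<xi> < 3"
  shows "continuous_into {(s, t). c \<le> s \<and> s < t \<and> t \<le> b} (X \<xi>) (N \<xi>) (\<lambda>(s, t). germ s t)"
    (is "continuous_into ?D _ _ _")
proof -
  have \<xi>: "0 \<le> \<xi>" "\<xi> < 3" using assms exps by auto
  have sub: "fst ` ?D \<subseteq> {a<..b}" "fst ` ?D \<subseteq> {a..b}" "snd ` ?D \<subseteq> {a..b}" using assms(1) by auto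
  have "continuous_into ?D (X \<xi>) (N \<xi>) (\<lambda>z. (x (snd z) - x (fst z)) *\<^sub>R S (snd z - fst z) (\<phi> (fst z)))"
  proof (rule continuous_into_scaleR[OF \<xi>], rule continuous_into_S[of \<alpha>])
    show "continuous_into ?D (X \<alpha>) (N \<alpha>) (\<lambda>z. \<phi> (fst z))"
      by (rule continuous_into_compose[OF _ _ \<phi>_cont _ sub(1)]) (use exps in \<open>auto intro: continuous_intros\<close>)
    show "continuous_on ?D (\<lambda>z. snd z - fst z)" by (intro continuous_intros)
    show "0 < snd z - fst z" if "z \<in> ?D" for z using that by auto
    show "continuous_on ?D (\<lambda>z. x (snd z) - x (fst z))"
      by (intro continuous_on_diff continuous_on_compose2[OF x_continuous _ sub(2)]
        continuous_on_compose2[OF x_continuous _ sub(3)] continuous_on_fst continuous_on_snd continuous_on_id)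
  qed (use assms exps in auto)
  then show ?thesis by (simp add: germ_def case_prod_unfold)
qed

lemma germ_minus_psum_2:
  assumes "s \<le> t"
  shows "germ s t - psum 2 germ s t = defect s ((s + t) / 2) t"
  using germ_defect[of s "(s + t) / 2" t] assms by (simp add: psum_2 algebra_simps)

text \<open>\<open>psum_nested\<close> presents the finer sum as the coarser one with every germ
  bisected, so a level is a difference of consecutive Riemann sums and the series
  telescopes.\<close>

lemma sum_level:
  assumes "s \<le> t"
  shows "(\<Sum>j<k. level j s t) = germ s t - psum (2 ^ k) germ s t"
proof (induction k)
  case (Suc k)
  have "level k s t = psum (2 ^ k) (\<lambda>u v. germ u v - psum 2 germ u v) s t"
    unfolding level_def using assms germ_minus_psum_2 by (intro psum_cong) auto
  also have "\<dots> = psum (2 ^ k) germ s t - psum (2 ^ Suc k) germ s t"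
    using psum_nested[of "2 ^ k" 2 s t germ] assms by (simp add: psum_diff mult.commute)
  finally show ?case using Suc by simp
qed (simp add: psum_1)

lemma integ_limit:
  assumes "a < s" "s \<le> t" "t \<le> b"
  shows "(\<lambda>k. psum (2 ^ k) germ s t) \<longlonglongrightarrow> integ s t"
proof -
  obtain L where L: "0 < L" "\<And>\<tau> u. 0 < \<tau> \<Longrightarrow> \<tau> \<le> b - a \<Longrightarrow> u \<in> X \<beta> \<Longrightarrow>
      S \<tau> u \<in> X (\<beta> + 0) \<and> N (\<beta> + 0) (S \<tau> u) \<le> L * \<tau> powr (- 0) * N \<beta> u"
    using smoothing_\<beta>[of 0] by auto
  have "(\<lambda>k. level k s t) sums remainder s t"
  proof (cases "s = t")
    case True
    then show ?thesis by (simp add: level_refl remainder_refl)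
  next
    case False
    then show ?thesis using remainder_bound(1)[of 0 L s t] L assms by simp
  qed
  then have "(\<lambda>k. germ s t - psum (2 ^ k) germ s t) \<longlonglongrightarrow> remainder s t"
    unfolding sums_def sum_level[OF assms(2)] .
  from tendsto_diff[OF tendsto_const[of "germ s t"] this] show ?thesis unfolding integ_def by simp
qed

text \<open>At the midpoint a sum over \<open>2 ^ Suc k\<close> pieces falls into two sums over
  \<open>2 ^ k\<close> pieces, so all three sums converge along the same sequence of
  refinements.\<close>

lemma psum_2_integ:
  assumes "a < s" "s \<le> t" "t \<le> b"
  shows "psum 2 integ s t = integ s t"
proof -
  let ?m = "(s + t) / 2"
  have "(\<lambda>k. S (t - ?m) (psum (2 ^ k) germ s ?m) + psum (2 ^ k) germ ?m t)
      \<longlonglongrightarrow> S (t - ?m) (integ s ?m) + integ ?m t"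
    using assms by (intro tendsto_add bounded_linear.tendsto[OF bounded_linear_S] integ_limit) auto
  moreover have "S (t - ?m) (psum (2 ^ k) germ s ?m) + psum (2 ^ k) germ ?m t = psum (2 ^ Suc k) germ s t" for k
    using psum_nested[of 2 "2 ^ k" s t germ] assms by (simp add: psum_2)
  moreover have "(\<lambda>k. psum (2 ^ Suc k) germ s t) \<longlonglongrightarrow> integ s t"
    using integ_limit[OF assms] by (rule LIMSEQ_Suc)
  ultimately show ?thesis unfolding psum_2 using LIMSEQ_unique by simp
qed

end

section \<open>Additivity of the convolution integral\<close>

context convolution_data
begin

text \<open>The vanishing argument takes place in the ambient norm and needs only the order
  \<open>\<eta> + \<rho> > 1\<close>; starting at \<open>c > a\<close> turns the weight into a
  constant.\<close>

lemma norm_defect_le: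
  assumes c: "a < c"
  obtains K where "0 \<le> K" "\<And>r s t. c \<le> r \<Longrightarrow> r \<le> s \<Longrightarrow> s \<le> t \<Longrightarrow> t \<le> b \<Longrightarrow> norm (defect r s t) \<le> K * (t - r) powr (\<eta> + \<rho>)"
proof -
  have "\<exists>L\<ge>1. \<forall>\<tau>\<in>{0..b - a}. \<forall>u\<in>X 0. S \<tau> u \<in> X 0 \<and> N 0 (S \<tau> u) \<le> L * N 0 u"
    using ab by (intro S_bdd) auto
  then obtain L where L: "L \<ge> 1" "\<And>\<tau> u. 0 \<le> \<tau> \<Longrightarrow> \<tau> \<le> b - a \<Longrightarrow> norm (S \<tau> u) \<le> L * norm u"
    using X_0 by auto
  have "\<exists>E>0. \<forall>u\<in>X \<beta>. norm u \<le> E * N \<beta> u" using exps by (intro embed_norm) auto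
  then obtain E where E: "E > 0" "\<And>u. u \<in> X \<beta> \<Longrightarrow> norm u \<le> E * N \<beta> u" by blast
  define K where "K = H * (L * (E * (Q * (c - a) powr (- \<gamma>))))"
  have "norm (defect r s t) \<le> K * (t - r) powr (\<eta> + \<rho>)" if b: "c \<le> r" "r \<le> s" "s \<le> t" "t \<le> b" for r s t
  proof -
    let ?d = "delta1 S \<phi> (r, s)"
    have "norm ?d \<le> E * N \<beta> ?d" using \<delta>\<phi>_in[of r s] b c by (intro E) auto
    also have "\<dots> \<le> E * (Q * (c - a) powr (- \<gamma>) * (s - r) powr \<rho>)"
    proof (intro mult_left_mono)
      have "N \<beta> ?d \<le> Q * (r - a) powr (- \<gamma>) * (s - r) powr \<rho>" using \<delta>\<phi>_bound[of r s] b c by simp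
      also have "\<dots> \<le> Q * (c - a) powr (- \<gamma>) * (s - r) powr \<rho>"
        using b c Q exps by (intro mult_right_mono mult_left_mono powr_mono2') auto
      finally show "N \<beta> ?d \<le> Q * (c - a) powr (- \<gamma>) * (s - r) powr \<rho>" .
    qed (use E in simp)
    also have "\<dots> \<le> E * (Q * (c - a) powr (- \<gamma>) * (t - r) powr \<rho>)"
      using E Q b exps by (intro mult_left_mono powr_mono2) auto
    finally have d: "norm ?d \<le> E * (Q * (c - a) powr (- \<gamma>) * (t - r) powr \<rho>)" .
    have "norm (S (t - s) ?d) \<le> L * norm ?d" using b c by (intro L) auto
    also have "\<dots> \<le> L * (E * (Q * (c - a) powr (- \<gamma>) * (t - r) powr \<rho>))" using d L by (intro mult_left_mono) auto
    finally have Sd: "norm (S (t - s) ?d) \<le> L * (E * (Q * (c - a) powr (- \<gamma>) * (t - r) powr \<rho>))" .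
    have "\<bar>x t - x s\<bar> \<le> H * (t - s) powr \<eta>" using x_bound[of s t] b c by simp
    also have "\<dots> \<le> H * (t - r) powr \<eta>" using H b exps by (intro mult_left_mono powr_mono2) auto
    finally have "\<bar>x t - x s\<bar> * norm (S (t - s) ?d)
        \<le> H * (t - r) powr \<eta> * (L * (E * (Q * (c - a) powr (- \<gamma>) * (t - r) powr \<rho>)))"
      using Sd H by (intro mult_mono) auto
    then show ?thesis unfolding defect_def K_def by (simp add: powr_add mult_ac)
  qed
  moreover have "0 \<le> K" unfolding K_def using H L E Q by simp
  ultimately show ?thesis using that by blast
qed

lemma norm_remainder_le:
  assumes c: "a < c"
  obtains K where "0 \<le> K" "\<And>s t. c \<le> s \<Longrightarrow> s \<le> t \<Longrightarrow> t \<le> b \<Longrightarrow> norm (remainder s t) \<le> K * (t - s) powr (\<eta> + \<rho>)"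
proof -
  obtain L where L: "0 < L" "\<And>\<tau> u. 0 < \<tau> \<Longrightarrow> \<tau> \<le> b - a \<Longrightarrow> u \<in> X \<beta> \<Longrightarrow>
      S \<tau> u \<in> X (\<beta> + 0) \<and> N (\<beta> + 0) (S \<tau> u) \<le> L * \<tau> powr (- 0) * N \<beta> u"
    using smoothing_\<beta>[of 0] by auto
  have "\<exists>E>0. \<forall>u\<in>X \<beta>. norm u \<le> E * N \<beta> u" using exps by (intro embed_norm) auto
  then obtain E where E: "E > 0" "\<And>u. u \<in> X \<beta> \<Longrightarrow> norm u \<le> E * N \<beta> u" by blast
  define K where "K = E * (H * L * Q * (c - a) powr (- \<gamma>) / (1 - q))"
  have "norm (remainder s t) \<le> K * (t - s) powr (\<eta> + \<rho>)" if b: "c \<le> s" "s \<le> t" "t \<le> b" for s t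
  proof (cases "s = t")
    case False
    have 1: "remainder s t \<in> X \<beta>" "N \<beta> (remainder s t) \<le> level_const 0 L s t / (1 - q)"
      using remainder_bound(2,4)[of 0 L s t] L False b c by simp_all
    have "norm (remainder s t) \<le> E * N \<beta> (remainder s t)" using 1 E by simp
    also have "\<dots> \<le> E * (level_const 0 L s t / (1 - q))" using 1 E by (intro mult_left_mono) auto
    also have "\<dots> \<le> E * (H * L * Q * (c - a) powr (- \<gamma>) * (t - s) powr (\<eta> + \<rho>) / (1 - q))"
      using level_const_le[of 0 L c s t] L b c E q by (intro mult_left_mono divide_right_mono) auto
    finally show ?thesis unfolding K_def by simp
  qed (simp add: remainder_refl)
  moreover have "0 \<le> K" unfolding K_def using E H L Q q by simp
  ultimately show ?thesis using that by blast
qed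

text \<open>Merging the pieces one after another costs one defect each. The constant grows with
  \<open>n\<close>, which is harmless: \<open>n\<close> is fixed where this is applied, and only the
  exponent matters there.\<close>

lemma norm_germ_minus_psum_le:
  assumes c: "a < c" and n: "n > 0"
  obtains K where "\<And>s t. c \<le> s \<Longrightarrow> s \<le> t \<Longrightarrow> t \<le> b \<Longrightarrow>
    norm (germ s t - psum n germ s t) \<le> K * (t - s) powr (\<eta> + \<rho>)"
proof -
  obtain K where K: "0 \<le> K" "\<And>r s t. c \<le> r \<Longrightarrow> r \<le> s \<Longrightarrow> s \<le> t \<Longrightarrow> t \<le> b \<Longrightarrow> norm (defect r s t) \<le> K * (t - r) powr (\<eta> + \<rho>)"
    using norm_defect_le[OF c] by blast
  have "\<exists>L\<ge>1. \<forall>\<tau>\<in>{0..b - a}. \<forall>u\<in>X 0. S \<tau> u \<in> X 0 \<and> N 0 (S \<tau> u) \<le> L * N 0 u"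
    using ab by (intro S_bdd) auto
  then obtain L where L: "L \<ge> 1" "\<And>\<tau> u. 0 \<le> \<tau> \<Longrightarrow> \<tau> \<le> b - a \<Longrightarrow> norm (S \<tau> u) \<le> L * norm u"
    using X_0 by auto
  have "norm (germ s t - psum n germ s t) \<le> (real n * (L * K)) * (t - s) powr (\<eta> + \<rho>)"
    if st: "c \<le> s" "s \<le> t" "t \<le> b" for s t
  proof -
    let ?p = "node n s t"
    \<comment> \<open>The germ on the first \<open>j\<close> pieces taken together, transported to
      \<open>t\<close>, is compared with their sum. One more piece changes the difference by exactly
      the transported defect of \<open>s\<close>, \<open>?p j\<close> and
      \<open>?p (Suc j)\<close>.\<close>
    have "norm (S (t - ?p j) (germ s (?p j)) - (\<Sum>i<j. S (t - ?p (Suc i)) (germ (?p i) (?p (Suc i)))))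
      \<le> real j * (L * (K * (t - s) powr (\<eta> + \<rho>)))" if "j \<le> n" for j
      using that
    proof (induction j)
      case 0
      then show ?case using st by (simp add: germ_def S_linear)
    next
      case (Suc j)
      have b: "s \<le> ?p j" "?p j \<le> ?p (Suc j)" "?p (Suc j) \<le> t"
        using node_bounds[of s t j n] node_bounds[of s t "Suc j" n] node_mono[of s t j "Suc j" n] st Suc.prems by auto
      let ?w = "defect s (?p j) (?p (Suc j))"
      have "S (t - ?p (Suc j)) (S (?p (Suc j) - ?p j) v) = S (t - ?p j) v" for v
        using S_add[of "?p (Suc j) - ?p j" "t - ?p (Suc j)" v] b by simp
      then have w: "S (t - ?p (Suc j)) ?w = S (t - ?p (Suc j)) (germ s (?p (Suc j)))
          - S (t - ?p (Suc j)) (germ (?p j) (?p (Suc j))) - S (t - ?p j) (germ s (?p j))"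
        using germ_defect[OF b(1,2), symmetric] b by (simp add: S_linear)
      have "norm (S (t - ?p (Suc j)) ?w) \<le> L * norm ?w" using b st c by (intro L) auto
      also have "\<dots> \<le> L * (K * (?p (Suc j) - s) powr (\<eta> + \<rho>))"
        using L K(2)[of s "?p j" "?p (Suc j)"] b st by (intro mult_left_mono) auto
      also have "\<dots> \<le> L * (K * (t - s) powr (\<eta> + \<rho>))"
        using L K b exps by (intro mult_left_mono powr_mono2) auto
      finally have "norm (S (t - ?p (Suc j)) ?w) \<le> L * (K * (t - s) powr (\<eta> + \<rho>))" .
      then have "norm (S (t - ?p j) (germ s (?p j)) - (\<Sum>i<j. S (t - ?p (Suc i)) (germ (?p i) (?p (Suc i)))) + S (t - ?p (Suc j)) ?w)
        \<le> real j * (L * (K * (t - s) powr (\<eta> + \<rho>))) + L * (K * (t - s) powr (\<eta> + \<rho>))"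
        using Suc by (intro norm_triangle_mono) auto
      then show ?case unfolding w by (simp add: algebra_simps)
    qed
    from this[of n] show ?thesis unfolding psum_def using n by (simp add: S_zero mult_ac)
  qed
  then show ?thesis using that by blast
qed

lemma psum_integ:
  assumes n: "n > 0" and st: "a < s" "s \<le> t" "t \<le> b"
  shows "psum n integ s t = integ s t"
proof -
  define D where "D u v = integ u v - psum n integ u v" for u v
  obtain K1 where K1: "\<And>u v. s \<le> u \<Longrightarrow> u \<le> v \<Longrightarrow> v \<le> b \<Longrightarrow>
    norm (germ u v - psum n germ u v) \<le> K1 * (v - u) powr (\<eta> + \<rho>)"
    using norm_germ_minus_psum_le[OF st(1) n] by blast
  obtain K2 where K2: "0 \<le> K2" "\<And>u v. s \<le> u \<Longrightarrow> u \<le> v \<Longrightarrow> v \<le> b \<Longrightarrow> norm (remainder u v) \<le> K2 * (v - u) powr (\<eta> + \<rho>)"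
    using norm_remainder_le[OF st(1)] by blast
  have "\<exists>L\<ge>1. \<forall>\<tau>\<in>{0..b - a}. \<forall>u\<in>X 0. S \<tau> u \<in> X 0 \<and> N 0 (S \<tau> u) \<le> L * N 0 u"
    using ab by (intro S_bdd) auto
  then obtain L where L: "L \<ge> 1" "\<And>\<tau> u. 0 \<le> \<tau> \<Longrightarrow> \<tau> \<le> b - a \<Longrightarrow> norm (S \<tau> u) \<le> L * norm u"
    using X_0 by auto
  define K where "K = K1 + K2 + L * K2 * real n powr (1 - (\<eta> + \<rho>))"
  have "D s t = 0"
  proof (rule psum_2_fixpoint_eq_0[OF st(2)])
    show "1 < \<eta> + \<rho>" using exps by simp
    fix u v assume uv: "s \<le> u" "u \<le> v" "v \<le> t"
    \<comment> \<open>The germ alone is only known to be of order \<open>\<eta> < 1\<close>. Grouped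
      with its own sum it reaches the order \<open>\<eta> + \<rho>\<close>, as do the remainder and
      the sum of remainders.\<close>
    have Deq: "D u v = (germ u v - psum n germ u v) - remainder u v + psum n remainder u v"
      unfolding D_def integ_def using uv by (simp add: psum_diff)
    have "norm ((germ u v - psum n germ u v) - remainder u v + psum n remainder u v)
      \<le> K1 * (v - u) powr (\<eta> + \<rho>) + K2 * (v - u) powr (\<eta> + \<rho>) + L * K2 * (v - u) powr (\<eta> + \<rho>) * real n powr (1 - (\<eta> + \<rho>))"
    proof -
      have 1: "norm (germ u v - psum n germ u v) \<le> K1 * (v - u) powr (\<eta> + \<rho>)"
        "norm (remainder u v) \<le> K2 * (v - u) powr (\<eta> + \<rho>)" using K1 K2 uv st by auto
      have 2: "norm (psum n remainder u v) \<le> L * K2 * (v - u) powr (\<eta> + \<rho>) * real n powr (1 - (\<eta> + \<rho>))"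
        using uv st n L K2 by (intro norm_psum_le) auto
      show ?thesis
        using norm_triangle_mono[OF order_trans[OF norm_triangle_ineq4 add_mono[OF 1]] 2] .
    qed
    then show "norm (D u v) \<le> K * (v - u) powr (\<eta> + \<rho>)"
      unfolding K_def Deq[symmetric] by (simp add: algebra_simps)
    have "psum 2 D u v = psum 2 integ u v - psum 2 (psum n integ) u v"
      unfolding D_def using uv by (simp add: psum_diff)
    \<comment> \<open>Both nestings equal the sum over \<open>2 * n\<close> pieces, so bisection can
      be moved inside, where it fixes \<open>integ\<close>.\<close>
    also have "psum 2 (psum n integ) u v = psum n (psum 2 integ) u v"
      using psum_nested[of 2 n u v integ] psum_nested[of n 2 u v integ] n uv by (simp add: mult.commute)
    also have "\<dots> = psum n integ u v" using psum_2_integ uv st by (intro psum_cong) auto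
    also have "psum 2 integ u v = integ u v" using psum_2_integ uv st by simp
    finally show "psum 2 D u v = D u v" unfolding D_def .
  qed
  then show ?thesis unfolding D_def by simp
qed

lemma integ_continuous_0:
  assumes "a < c"
  shows "continuous_into {(s, t). c \<le> s \<and> s < t \<and> t \<le> b} (X 0) (N 0) (\<lambda>(s, t). integ s t)"
    (is "continuous_into ?D _ _ _")
proof -
  obtain L where L: "0 < L" "\<And>\<tau> u. 0 < \<tau> \<Longrightarrow> \<tau> \<le> b - a \<Longrightarrow> u \<in> X \<beta> \<Longrightarrow>
      S \<tau> u \<in> X (\<beta> + 0) \<and> N (\<beta> + 0) (S \<tau> u) \<le> L * \<tau> powr (- 0) * N \<beta> u"
    using smoothing_\<beta>[of 0] by auto
  have "continuous_into ?D (X \<alpha>) (N \<alpha>) (\<lambda>(s, t). germ s t)" using germ_continuous[of c \<alpha>] assms exps by simp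
  then have g: "continuous_into ?D (X 0) (N 0) (\<lambda>(s, t). germ s t)" using continuous_into_embed[of 0 \<alpha>] exps by simp
  have "continuous_into (tri c b) (X (\<beta> + 0)) (N (\<beta> + 0)) (\<lambda>(s, t). remainder s t)"
    using remainder_continuous_tri[of 0 L c] L assms by simp
  then have "continuous_into ?D (X \<beta>) (N \<beta>) (\<lambda>(s, t). remainder s t)"
    using continuous_into_subset[of "tri c b" "X \<beta>" "N \<beta>" _ ?D] by (simp add: tri_def Collect_mono_iff)
  then have "continuous_into ?D (X 0) (N 0) (\<lambda>(s, t). remainder s t)" using continuous_into_embed[of 0 \<beta>] exps by simp
  from continuous_into_diff[OF _ _ g this] show ?thesis by (simp add: integ_def case_prod_unfold)
qed

lemma integ_add:
  assumes rst: "a < r" "r \<le> s" "s \<le> t" "t \<le> b"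
  shows "integ r t = integ s t + S (t - s) (integ r s)"
proof -
  consider "r = s" | "s = t" | "r < s" "s < t" using rst by linarith
  then show ?thesis
  proof cases
    case 1
    then show ?thesis using rst by (simp add: integ_refl S_linear)
  next
    case 2
    then show ?thesis by (simp add: integ_refl S_zero)
  next
    case 3
    \<comment> \<open>The claim is \<open>f s = integ r t\<close>. At a node of an equidistant
      partition of \<open>[r, t]\<close> it follows from \<open>psum_split\<close>, with
      \<open>psum_integ\<close> applied to \<open>[r, t]\<close> and to both blocks.\<close>
    define f where "f u = integ u t + S (t - u) (integ r u)" for u
    define \<theta> where "\<theta> = (s - r) / (t - r)"
    \<comment> \<open>Rounding down makes \<open>m n / n\<close> differ from \<open>\<theta>\<close>
      by at most \<open>1 / n\<close>, so the nodes \<open>u n\<close> tend to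
      \<open>s\<close>.\<close>
    define m where "m n = nat \<lfloor>\<theta> * real n\<rfloor>" for n :: nat
    define u where "u n = node n r t (m n)" for n
    have \<theta>: "0 < \<theta>" "\<theta> < 1" "r + (t - r) * \<theta> = s" unfolding \<theta>_def using 3 by auto
    have quot: "(\<lambda>n. real (m n) / real n) \<longlonglongrightarrow> \<theta>"
    proof (rule tendsto_sandwich[of "\<lambda>n. \<theta> - 1 / real n" _ _ "\<lambda>n. \<theta>"])
      have b: "\<theta> * real n - 1 \<le> real (m n)" "real (m n) \<le> \<theta> * real n" for n
        unfolding m_def using \<theta> by (auto simp: le_floor_iff)
      show "\<forall>\<^sub>F n in sequentially. \<theta> - 1 / real n \<le> real (m n) / real n"
        using b by (auto intro!: eventually_sequentiallyI[of 1] simp: field_simps)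
      show "\<forall>\<^sub>F n in sequentially. real (m n) / real n \<le> \<theta>"
        using b by (auto intro!: eventually_sequentiallyI[of 1] simp: field_simps)
      have "(\<lambda>n. \<theta> - 1 / real n) \<longlonglongrightarrow> \<theta> - 0" by (intro tendsto_intros lim_1_over_n)
      then show "(\<lambda>n. \<theta> - 1 / real n) \<longlonglongrightarrow> \<theta>" by simp
    qed simp
    then have "(\<lambda>n. r + (t - r) * (real (m n) / real n)) \<longlonglongrightarrow> r + (t - r) * \<theta>" by (intro tendsto_intros)
    then have us: "u \<longlonglongrightarrow> s" unfolding u_def node_def \<theta>(3) by simp
    have ev: "\<forall>\<^sub>F n in sequentially. r < u n \<and> u n < t"
      using order_tendstoD[OF us] 3 by (auto intro: eventually_conj)
    have "\<forall>\<^sub>F n in sequentially. f (u n) = integ r t"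
      using ev eventually_gt_at_top[of 0]
    proof eventually_elim
      case (elim n)
      have "m n > 0" using elim unfolding u_def by (cases "m n") auto
      moreover have "m n < n"
      proof (rule ccontr)
        assume "\<not> m n < n"
        then have "t \<le> u n" unfolding u_def using node_mono[of r t n "m n" n] elim 3 by simp
        then show False using elim by simp
      qed
      ultimately have k: "m n > 0" "n - m n > 0" "m n + (n - m n) = n" by auto
      have "psum n integ r t = S (t - u n) (psum (m n) integ r (u n)) + psum (n - m n) integ (u n) t"
        using psum_split[of "m n" "n - m n" r t "u n" integ] k rst unfolding u_def by simp
      then show ?case unfolding f_def using psum_integ k elim rst by simp
    qed
    then have lim1: "(\<lambda>n. f (u n)) \<longlonglongrightarrow> integ r t" by (rule tendsto_eventually)
    \<comment> \<open>The open interval keeps both the semigroup time \<open>t - u\<close> and the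
      lengths of the two integrals positive.\<close>
    have "continuous_on {r<..<t} f"
    proof -
      let ?D = "{(s, t). r \<le> s \<and> s < t \<and> t \<le> b}"
      note cont = integ_continuous_0[OF rst(1)]
      have "continuous_into {r<..<t} (X 0) (N 0) (\<lambda>u. case (u, t) of (s, t) \<Rightarrow> integ s t)"
        using rst by (intro continuous_into_compose[OF _ _ cont]) (auto intro!: continuous_intros)
      moreover have "continuous_into {r<..<t} (X 0) (N 0) (\<lambda>u. case (r, u) of (s, t) \<Rightarrow> integ s t)"
        using rst by (intro continuous_into_compose[OF _ _ cont]) (auto intro!: continuous_intros)
      then have "continuous_into {r<..<t} (X 0) (N 0) (\<lambda>u. S (t - u) (integ r u))"
        by (intro continuous_into_S[of 0]) (auto intro!: continuous_intros)
      ultimately have "continuous_into {r<..<t} (X 0) (N 0) f"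
        unfolding f_def using continuous_into_add[of 0] by simp
      then show ?thesis using continuous_into_norm[of 0] by simp
    qed
    then have "isCont f s" using 3 by (simp add: continuous_on_eq_continuous_at)
    then have "(\<lambda>n. f (u n)) \<longlonglongrightarrow> f s" using us by (rule isCont_tendsto_compose)
    with lim1 show ?thesis unfolding f_def using LIMSEQ_unique by blast
  qed
qed

lemma remainder_add:
  assumes "a < r" "r \<le> s" "s \<le> t" "t \<le> b"
  shows "remainder r t - remainder s t - S (t - s) (remainder r s) = defect r s t"
  using integ_add[OF assms] germ_defect[OF assms(2,3)] assms
  unfolding integ_def by (simp add: S_linear algebra_simps)

lemma is_conv_remainder_restrict:
  "is_conv_remainder X N S \<beta> \<eta> \<rho> a b x \<phi> (restrict (\<lambda>(s, t). remainder s t) (tri_left_open a b))"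
    (is "is_conv_remainder _ _ _ _ _ _ _ _ _ _ ?M")
  unfolding is_conv_remainder_def
proof (intro conjI ballI allI impI)
  fix \<theta> \<epsilon> :: real assume \<theta>: "\<theta> \<in> {0<..<b - a}" and \<epsilon>: "\<epsilon> \<in> {0..<1}"
  have \<epsilon>': "0 \<le> \<epsilon>" "\<epsilon> < 1" using \<epsilon> by auto
  obtain L where L: "0 < L" "\<And>\<tau> u. 0 < \<tau> \<Longrightarrow> \<tau> \<le> b - a \<Longrightarrow> u \<in> X \<beta> \<Longrightarrow>
      S \<tau> u \<in> X (\<beta> + \<epsilon>) \<and> N (\<beta> + \<epsilon>) (S \<tau> u) \<le> L * \<tau> powr (- \<epsilon>) * N \<beta> u"
    using smoothing_\<beta>[OF \<epsilon>'] by blast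
  have "a < a + \<theta>" using \<theta> by simp
  note rh = remainder_two_hoelder[OF \<epsilon>' L this]
  have eq: "?M z = (case z of (s, t) \<Rightarrow> remainder s t)" if "z \<in> tri (a + \<theta>) b" for z
    using that \<theta> by (auto simp: tri_def tri_left_open_def)
  have "continuous_into (tri (a + \<theta>) b) (X (\<beta> + \<epsilon>)) (N (\<beta> + \<epsilon>)) ?M"
    using rh unfolding two_hoelder_def by (subst continuous_into_cong[OF eq]) auto
  moreover have "\<forall>s\<in>{a + \<theta>..b}. ?M (s, s) = 0" using eq remainder_refl by (simp add: tri_def)
  moreover have "(\<lambda>(s, t). N (\<beta> + \<epsilon>) (?M (s, t)) * (t - s) powr - (\<eta> + \<rho> - \<epsilon>)) ` {(s, t). a + \<theta> \<le> s \<and> s < t \<and> t \<le> b}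
    = (\<lambda>(s, t). N (\<beta> + \<epsilon>) (remainder s t) * (t - s) powr - (\<eta> + \<rho> - \<epsilon>)) ` {(s, t). a + \<theta> \<le> s \<and> s < t \<and> t \<le> b}"
    using eq by (intro image_cong refl) (auto simp: tri_def)
  ultimately show "?M \<in> two_hoelder (\<eta> + \<rho> - \<epsilon>) (a + \<theta>) b (X (\<beta> + \<epsilon>)) (N (\<beta> + \<epsilon>))"
    using rh unfolding two_hoelder_def by simp
next
  fix r s t assume "a < r \<and> r \<le> s \<and> s \<le> t \<and> t \<le> b"
  then show "?M (r, t) - ?M (s, t) - S (t - s) (?M (r, s)) = - ((x t - x s) *\<^sub>R S (t - s) (delta1 S \<phi> (r, s)))"
    using remainder_add[of r s t] by (simp add: tri_left_open_def defect_def)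
qed

text \<open>The defect cancels in the difference of two solutions, which is therefore fixed by
  \<open>psum 2\<close>.\<close>

lemma is_conv_remainder_unique:
  assumes M: "is_conv_remainder X N S \<beta> \<eta> \<rho> a b x \<phi> M" and st: "a < s" "s \<le> t" "t \<le> b"
  shows "M (s, t) = remainder s t"
proof (cases "s = b")
  \<comment> \<open>For \<open>s = b\<close> the choice \<open>\<theta> = s - a\<close> made in the
    other case is not below \<open>b - a\<close>; the midpoint gives another triangle that contains
    \<open>(b, b)\<close>, where \<open>M\<close> has to vanish.\<close>
  case True
  define \<theta> where "\<theta> = (b - a) / 2"
  have \<theta>: "\<theta> \<in> {0<..<b - a}" "a + \<theta> \<le> b" unfolding \<theta>_def using ab by (auto simp: field_simps)
  have "(0::real) \<in> {0..<1}" by simp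
  then have "M \<in> two_hoelder (\<eta> + \<rho> - 0) (a + \<theta>) b (X (\<beta> + 0)) (N (\<beta> + 0))"
    using M \<theta>(1) unfolding is_conv_remainder_def by blast
  then have "M (b, b) = 0" using \<theta>(2) unfolding two_hoelder_def by simp
  then show ?thesis using True st by (simp add: remainder_refl)
next
  case False
  then have sb: "s < b" using st by simp
  define D where "D u v = M (u, v) - remainder u v" for u v
  obtain K2 where K2: "0 \<le> K2" "\<And>u v. s \<le> u \<Longrightarrow> u \<le> v \<Longrightarrow> v \<le> b \<Longrightarrow> norm (remainder u v) \<le> K2 * (v - u) powr (\<eta> + \<rho>)"
    using norm_remainder_le[OF st(1)] by blast
  have "\<exists>E>0. \<forall>u\<in>X \<beta>. norm u \<le> E * N \<beta> u" using exps by (intro embed_norm) auto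
  then obtain E where E: "E > 0" "\<And>u. u \<in> X \<beta> \<Longrightarrow> norm u \<le> E * N \<beta> u" by blast
  \<comment> \<open>With \<open>\<theta> = s - a\<close> the triangle starts exactly at
    \<open>s\<close>, and the loss 0 preserves the order \<open>\<eta> + \<rho> > 1\<close>.\<close>
  have "(0::real) \<in> {0..<1}" "s - a \<in> {0<..<b - a}" using st sb by auto
  then have "M \<in> two_hoelder (\<eta> + \<rho> - 0) (a + (s - a)) b (X (\<beta> + 0)) (N (\<beta> + 0))"
    using M unfolding is_conv_remainder_def by blast
  then have th: "M \<in> two_hoelder (\<eta> + \<rho>) s b (X \<beta>) (N \<beta>)" by simp
  then have MX: "M (u, v) \<in> X \<beta>" if "s \<le> u" "u \<le> v" "v \<le> b" for u v
    using that unfolding two_hoelder_def continuous_into_def tri_def by simp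
  have M0: "M (u, u) = 0" if "s \<le> u" "u \<le> b" for u using th that unfolding two_hoelder_def by simp
  obtain K1 where K1: "\<And>u v. s \<le> u \<Longrightarrow> u < v \<Longrightarrow> v \<le> b \<Longrightarrow> N \<beta> (M (u, v)) * (v - u) powr (- (\<eta> + \<rho>)) \<le> K1"
    using th unfolding two_hoelder_def bdd_above_def by auto
  have normM: "norm (M (u, v)) \<le> E * K1 * (v - u) powr (\<eta> + \<rho>)" if uv: "s \<le> u" "u \<le> v" "v \<le> b" for u v
  proof (cases "u = v")
    case False
    have "N \<beta> (M (u, v)) = N \<beta> (M (u, v)) * (v - u) powr (- (\<eta> + \<rho>)) * (v - u) powr (\<eta> + \<rho>)"
      unfolding mult.assoc powr_add[symmetric] using uv False by simp
    also have "\<dots> \<le> K1 * (v - u) powr (\<eta> + \<rho>)" using K1 uv False by (intro mult_right_mono) auto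
    finally have "E * N \<beta> (M (u, v)) \<le> E * (K1 * (v - u) powr (\<eta> + \<rho>))" using E by (intro mult_left_mono) auto
    then show ?thesis using E(2)[OF MX[OF uv]] by (simp add: mult_ac)
  qed (use M0 uv in simp)
  have "D s t = 0"
  proof (rule psum_2_fixpoint_eq_0[OF st(2)])
    show "1 < \<eta> + \<rho>" using exps by simp
    fix u v assume uv: "s \<le> u" "u \<le> v" "v \<le> t"
    have "norm (D u v) \<le> E * K1 * (v - u) powr (\<eta> + \<rho>) + K2 * (v - u) powr (\<eta> + \<rho>)"
      unfolding D_def using normM[of u v] K2(2)[of u v] uv st
      by (intro order_trans[OF norm_triangle_ineq4] add_mono) auto
    then show "norm (D u v) \<le> (E * K1 + K2) * (v - u) powr (\<eta> + \<rho>)" by (simp add: algebra_simps)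
    let ?m = "(u + v) / 2"
    have b: "a < u" "u \<le> ?m" "?m \<le> v" "v \<le> b" using uv st by auto
    have "M (u, v) - M (?m, v) - S (v - ?m) (M (u, ?m)) = defect u ?m v"
      using M b unfolding is_conv_remainder_def defect_def by blast
    moreover note remainder_add[OF b]
    ultimately have eq: "M (u, v) - M (?m, v) - S (v - ?m) (M (u, ?m)) = remainder u v - remainder ?m v - S (v - ?m) (remainder u ?m)"
      by simp
    have SD: "S (v - ?m) (D u ?m) = S (v - ?m) (M (u, ?m)) - S (v - ?m) (remainder u ?m)"
      unfolding D_def using b by (intro S_linear) simp
    show "psum 2 D u v = D u v" unfolding psum_2 SD unfolding D_def using eq by (simp add: algebra_simps)
  qed
  then show ?thesis unfolding D_def by simp
qed

text \<open>Existence and uniqueness resolve the definite description here, once and for all; being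
  extensional, a solution is determined by its values on the triangle.\<close>

lemma conv_integral0_eq:
  assumes "a < s" "s \<le> t" "t \<le> b"
  shows "conv_integral0 X N S \<beta> \<eta> \<rho> a b x \<phi> (s, t) = integ s t"
proof -
  let ?M = "restrict (\<lambda>(s, t). remainder s t) (tri_left_open a b)"
  have "conv_remainder X N S \<beta> \<eta> \<rho> a b x \<phi> = ?M"
    unfolding conv_remainder_def
  proof (rule the_equality)
    show "?M \<in> extensional (tri_left_open a b) \<and> is_conv_remainder X N S \<beta> \<eta> \<rho> a b x \<phi> ?M"
      using is_conv_remainder_restrict by simp
    fix M assume M: "M \<in> extensional (tri_left_open a b) \<and> is_conv_remainder X N S \<beta> \<eta> \<rho> a b x \<phi> M"
    show "M = ?M"
    proof (rule extensionalityI[of _ "tri_left_open a b"])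
      fix z assume z: "z \<in> tri_left_open a b"
      then show "M z = ?M z" using M is_conv_remainder_unique by (auto simp: tri_left_open_def)
    qed (use M in auto)
  qed
  then show ?thesis unfolding conv_integral0_def integ_def germ_def using assms by (simp add: tri_left_open_def)
qed

end

section \<open>Estimates up to the edge\<close>

context convolution_data
begin

definition \<kappa> where "\<kappa> = min \<eta> (\<eta> + \<rho> + \<beta> - \<alpha>)"

lemma integ_weighted:
  assumes \<epsilon>: "0 \<le> \<epsilon>" "\<epsilon> < 1 + \<beta> - \<alpha>"
    and L: "0 < L" "\<And>\<tau> u. 0 < \<tau> \<Longrightarrow> \<tau> \<le> b - a \<Longrightarrow> u \<in> X \<alpha> \<Longrightarrow>
      S \<tau> u \<in> X (\<alpha> + \<epsilon>) \<and> N (\<alpha> + \<epsilon>) (S \<tau> u) \<le> L * \<tau> powr (- \<epsilon>) * N \<alpha> u"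
    and L': "0 < L'" "\<And>\<tau> u. 0 < \<tau> \<Longrightarrow> \<tau> \<le> b - a \<Longrightarrow> u \<in> X \<beta> \<Longrightarrow>
      S \<tau> u \<in> X (\<alpha> + \<epsilon>) \<and> N (\<alpha> + \<epsilon>) (S \<tau> u) \<le> L' * \<tau> powr (- (\<alpha> - \<beta> + \<epsilon>)) * N \<beta> u"
    and st: "a < s" "s < t" "t \<le> b"
  shows "integ s t \<in> X (\<alpha> + \<epsilon>)"
    and "N (\<alpha> + \<epsilon>) (integ s t) \<le>
      (L * (b - a) powr (\<eta> - \<kappa>) + L' / ((1 - (\<alpha> - \<beta> + \<epsilon>)) * (1 - q)) * (b - a) powr (\<eta> + \<rho> + \<beta> - \<alpha> - \<kappa>))
        * (H * (P + Q)) * (s - a) powr (- \<gamma>) * (t - s) powr (\<kappa> - \<epsilon>)"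
proof -
  \<comment> \<open>The climb that the remainder needs to get from \<open>X \<beta>\<close> into
    \<open>X (\<alpha> + \<epsilon>)\<close>; the bound on \<open>\<epsilon>\<close> says that it is
    below 1.\<close>
  define \<epsilon>' where "\<epsilon>' = \<alpha> - \<beta> + \<epsilon>"
  have \<epsilon>': "0 \<le> \<epsilon>'" "\<epsilon>' < 1" "\<beta> + \<epsilon>' = \<alpha> + \<epsilon>" unfolding \<epsilon>'_def using \<epsilon> exps by auto
  have \<xi>: "0 \<le> \<alpha> + \<epsilon>" "\<alpha> + \<epsilon> < 3" using \<epsilon> exps by auto
  define D where "D = H * (P + Q) * (s - a) powr (- \<gamma>)"
  have D0: "0 \<le> D" unfolding D_def using H P Q by simp
  define T where "T = (t - s) powr (\<kappa> - \<epsilon>)"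
  have T0: "0 \<le> T" unfolding T_def by simp
  \<comment> \<open>Brings the exponents of germ (\<open>e = \<eta>\<close>) and remainder
    (\<open>e = \<eta> + \<rho> + \<beta> - \<alpha>\<close>) to the common value
    \<open>\<kappa> - \<epsilon>\<close>. The price is a power of the length of the interval, which
    enters the constant.\<close>
  have pow: "(t - s) powr (e - \<epsilon>) \<le> (b - a) powr (e - \<kappa>) * T" if "\<kappa> \<le> e" for e
  proof -
    have "(t - s) powr (e - \<epsilon>) = (t - s) powr (e - \<kappa>) * T"
      unfolding T_def powr_add[symmetric] by simp
    also have "\<dots> \<le> (b - a) powr (e - \<kappa>) * T"
      using that st T0 by (intro mult_right_mono powr_mono2) auto
    finally show ?thesis .
  qed
  have \<phi>X: "\<phi> s \<in> X \<alpha>" using \<phi>_cont st unfolding continuous_into_def by auto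
  have Sg: "S (t - s) (\<phi> s) \<in> X (\<alpha> + \<epsilon>)"
    "N (\<alpha> + \<epsilon>) (S (t - s) (\<phi> s)) \<le> L * (t - s) powr (- \<epsilon>) * N \<alpha> (\<phi> s)"
    using L(2)[of "t - s" "\<phi> s"] \<phi>X st by auto
  have gX: "germ s t \<in> X (\<alpha> + \<epsilon>)" unfolding germ_def using X_scale[OF \<xi> Sg(1)] .
  have "N (\<alpha> + \<epsilon>) (germ s t) = \<bar>x t - x s\<bar> * N (\<alpha> + \<epsilon>) (S (t - s) (\<phi> s))"
    unfolding germ_def using N_scale[OF \<xi> Sg(1)] .
  also have "\<dots> \<le> H * (t - s) powr \<eta> * (L * (t - s) powr (- \<epsilon>) * (P * (s - a) powr (- \<gamma>)))"
  proof (intro mult_mono)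
    show "\<bar>x t - x s\<bar> \<le> H * (t - s) powr \<eta>" using x_bound[of s t] st by simp
    have "L * (t - s) powr (- \<epsilon>) * N \<alpha> (\<phi> s) \<le> L * (t - s) powr (- \<epsilon>) * (P * (s - a) powr (- \<gamma>))"
      using \<phi>_bound[of s] st L by (intro mult_left_mono) auto
    then show "N (\<alpha> + \<epsilon>) (S (t - s) (\<phi> s)) \<le> L * (t - s) powr (- \<epsilon>) * (P * (s - a) powr (- \<gamma>))"
      using Sg(2) by simp
    show "0 \<le> N (\<alpha> + \<epsilon>) (S (t - s) (\<phi> s))" using N_nonneg[OF \<xi> Sg(1)] .
  qed (use H in auto)
  also have "\<dots> = L * (H * P * (s - a) powr (- \<gamma>)) * (t - s) powr (\<eta> - \<epsilon>)"
    by (simp add: powr_diff powr_minus field_simps)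
  also have "\<dots> \<le> L * D * ((b - a) powr (\<eta> - \<kappa>) * T)"
  proof (intro mult_mono pow)
    show "\<kappa> \<le> \<eta>" unfolding \<kappa>_def by simp
    show "H * P * (s - a) powr (- \<gamma>) \<le> D"
      unfolding D_def using H P Q by (intro mult_right_mono mult_left_mono) auto
  qed (use L D0 H P in auto)
  finally have gN: "N (\<alpha> + \<epsilon>) (germ s t) \<le> L * (b - a) powr (\<eta> - \<kappa>) * (D * T)" by (simp add: mult_ac)
  note rb = remainder_bound[of \<epsilon>' L' s t, unfolded \<epsilon>'(3), OF \<epsilon>'(1,2) L'(1)]
  have rX: "remainder s t \<in> X (\<alpha> + \<epsilon>)"
    and rN: "N (\<alpha> + \<epsilon>) (remainder s t) \<le> level_const \<epsilon>' L' s t / (1 - q)"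
    using rb(2,4) L'(2) st unfolding \<epsilon>'_def by auto
  define R where "R = L' / ((1 - \<epsilon>') * (1 - q))"
  have R0: "0 \<le> R" unfolding R_def using L' \<epsilon>' q by simp
  have "level_const \<epsilon>' L' s t / (1 - q) = R * (H * Q * (s - a) powr (- \<gamma>)) * (t - s) powr (\<eta> + \<rho> + \<beta> - \<alpha> - \<epsilon>)"
  proof -
    have eq: "\<eta> + \<rho> - \<epsilon>' = \<eta> + \<rho> + \<beta> - \<alpha> - \<epsilon>" unfolding \<epsilon>'_def by simp
    show ?thesis unfolding level_const_def R_def eq by (simp add: mult_ac)
  qed
  also have "\<dots> \<le> R * D * ((b - a) powr (\<eta> + \<rho> + \<beta> - \<alpha> - \<kappa>) * T)"
  proof (intro mult_mono pow)
    show "\<kappa> \<le> \<eta> + \<rho> + \<beta> - \<alpha>" unfolding \<kappa>_def by simp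
    show "H * Q * (s - a) powr (- \<gamma>) \<le> D"
      unfolding D_def using H P Q by (intro mult_right_mono mult_left_mono) auto
  qed (use R0 D0 H Q in auto)
  finally have rN': "N (\<alpha> + \<epsilon>) (remainder s t) \<le> R * (b - a) powr (\<eta> + \<rho> + \<beta> - \<alpha> - \<kappa>) * (D * T)"
    using rN by (simp add: mult_ac)
  show "integ s t \<in> X (\<alpha> + \<epsilon>)" unfolding integ_def using X_diff[OF \<xi> gX rX] .
  have "N (\<alpha> + \<epsilon>) (integ s t) \<le> N (\<alpha> + \<epsilon>) (germ s t) + N (\<alpha> + \<epsilon>) (remainder s t)"
    unfolding integ_def using N_triangle_diff[OF \<xi> gX rX] .
  also have "\<dots> \<le> (L * (b - a) powr (\<eta> - \<kappa>) + R * (b - a) powr (\<eta> + \<rho> + \<beta> - \<alpha> - \<kappa>)) * (D * T)"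
    using gN rN' by (simp add: distrib_right)
  finally show "N (\<alpha> + \<epsilon>) (integ s t) \<le>
      (L * (b - a) powr (\<eta> - \<kappa>) + L' / ((1 - (\<alpha> - \<beta> + \<epsilon>)) * (1 - q)) * (b - a) powr (\<eta> + \<rho> + \<beta> - \<alpha> - \<kappa>))
        * (H * (P + Q)) * (s - a) powr (- \<gamma>) * (t - s) powr (\<kappa> - \<epsilon>)"
    unfolding D_def T_def R_def \<epsilon>'_def by (simp only: mult.assoc)
qed

lemma integ_continuous:
  assumes \<epsilon>: "0 \<le> \<epsilon>" "\<epsilon> < 1 + \<beta> - \<alpha>" and c: "a < c"
  shows "continuous_into {(s, t). c \<le> s \<and> s < t \<and> t \<le> b} (X (\<alpha> + \<epsilon>)) (N (\<alpha> + \<epsilon>)) (\<lambda>(s, t). integ s t)"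
    (is "continuous_into ?D _ _ _")
proof -
  have \<epsilon>': "0 \<le> \<alpha> - \<beta> + \<epsilon>" "\<alpha> - \<beta> + \<epsilon> < 1" using \<epsilon> exps by auto
  have e: "\<beta> + (\<alpha> - \<beta> + \<epsilon>) = \<alpha> + \<epsilon>" by simp
  obtain L where L: "0 < L" "\<And>\<tau> u. 0 < \<tau> \<Longrightarrow> \<tau> \<le> b - a \<Longrightarrow> u \<in> X \<beta> \<Longrightarrow>
      S \<tau> u \<in> X (\<beta> + (\<alpha> - \<beta> + \<epsilon>)) \<and> N (\<beta> + (\<alpha> - \<beta> + \<epsilon>)) (S \<tau> u) \<le> L * \<tau> powr (- (\<alpha> - \<beta> + \<epsilon>)) * N \<beta> u"
    using smoothing_\<beta>[OF \<epsilon>'] by blast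
  have g: "continuous_into ?D (X (\<alpha> + \<epsilon>)) (N (\<alpha> + \<epsilon>)) (\<lambda>(s, t). germ s t)"
    using germ_continuous[OF c, of "\<alpha> + \<epsilon>"] \<epsilon> exps by simp
  have "continuous_into (tri c b) (X (\<alpha> + \<epsilon>)) (N (\<alpha> + \<epsilon>)) (\<lambda>(s, t). remainder s t)"
    using remainder_continuous_tri[OF \<epsilon>' L c] unfolding e .
  then have r: "continuous_into ?D (X (\<alpha> + \<epsilon>)) (N (\<alpha> + \<epsilon>)) (\<lambda>(s, t). remainder s t)"
    using continuous_into_subset[of "tri c b" "X (\<alpha> + \<epsilon>)" "N (\<alpha> + \<epsilon>)" _ ?D] by (simp add: tri_def Collect_mono_iff)
  show ?thesis using continuous_into_diff[OF _ _ g r] \<epsilon> exps by (simp add: integ_def case_prod_unfold)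
qed

text \<open>
  Halving \<open>[s, t]\<close> moves the right half away from \<open>a\<close> by at least its own length, where the weight
  costs only a factor \<open>(t - s)\<^sup>-\<^sup>\<gamma>\<close>. The operator \<open>S \<tau>\<close> in front of the integral makes the
  induction stable: it absorbs the semigroup applied to the left half, so that constants do not multiply up.
\<close>

lemma integ_unweighted:
  assumes \<epsilon>: "0 \<le> \<epsilon>" "\<epsilon> < 1 + \<beta> - \<alpha>" "\<epsilon> < \<kappa> - \<gamma>"
    and C: "0 \<le> C" "\<And>s t. a < s \<Longrightarrow> s < t \<Longrightarrow> t \<le> b \<Longrightarrow> integ s t \<in> X (\<alpha> + \<epsilon>) \<and>
      N (\<alpha> + \<epsilon>) (integ s t) \<le> C * (s - a) powr (- \<gamma>) * (t - s) powr (\<kappa> - \<epsilon>)"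
    and L: "0 \<le> L" "\<And>\<tau> u. 0 \<le> \<tau> \<Longrightarrow> \<tau> \<le> b - a \<Longrightarrow> u \<in> X (\<alpha> + \<epsilon>) \<Longrightarrow>
      S \<tau> u \<in> X (\<alpha> + \<epsilon>) \<and> N (\<alpha> + \<epsilon>) (S \<tau> u) \<le> L * N (\<alpha> + \<epsilon>) u"
    and st: "a < s" "s < t" "t \<le> b" "0 \<le> \<tau>" "\<tau> + (t - s) \<le> b - a"
  shows "N (\<alpha> + \<epsilon>) (S \<tau> (integ s t)) \<le> L * C / (1 - 2 powr (- (\<kappa> - \<gamma> - \<epsilon>))) * (t - s) powr (\<kappa> - \<gamma> - \<epsilon>)"
proof -
  define p where "p = \<kappa> - \<gamma> - \<epsilon>"
  \<comment> \<open>Solution of \<open>K = K * 2 powr (- p) + L * C\<close>: the left half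
    contributes the same bound at half the length, the right half a fixed amount.\<close>
  define K where "K = L * C / (1 - 2 powr (- p))"
  have p: "0 < p" unfolding p_def using \<epsilon> by simp
  have two: "0 < 2 powr (- p)" "2 powr (- p) < 1" using p powr_less_mono[of "- p" 0 2] by auto
  have K: "L * C \<le> K" "K * 2 powr (- p) + L * C * 2 powr (- p) \<le> K"
  proof -
    have Ke: "K * (1 - 2 powr (- p)) = L * C" unfolding K_def using two p by simp
    have K0: "0 \<le> K" unfolding K_def using L C two by simp
    then show "L * C \<le> K" using Ke two mult_left_le[of "1 - 2 powr (- p)" K] by simp
    then have "L * C * 2 powr (- p) \<le> L * C * 1" using L C two by (intro mult_left_mono) auto
    then show "K * 2 powr (- p) + L * C * 2 powr (- p) \<le> K" using Ke by (simp add: right_diff_distrib)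
  qed
  have \<xi>: "0 \<le> \<alpha> + \<epsilon>" "\<alpha> + \<epsilon> < 3" using \<epsilon> exps by auto
  \<comment> \<open>An interval no longer than its distance to \<open>a\<close> has weight at most
    \<open>(t - s) powr (- \<gamma>)\<close>.\<close>
  have far: "N (\<alpha> + \<epsilon>) (S \<tau> (integ s t)) \<le> L * C * (t - s) powr p"
    if b: "a < s" "s < t" "t \<le> b" "t - s \<le> s - a" "0 \<le> \<tau>" "\<tau> \<le> b - a" for s t \<tau>
  proof -
    have "N (\<alpha> + \<epsilon>) (S \<tau> (integ s t)) \<le> L * N (\<alpha> + \<epsilon>) (integ s t)"
      using L(2)[of \<tau>] C(2)[of s t] b by auto
    also have "\<dots> \<le> L * (C * (s - a) powr (- \<gamma>) * (t - s) powr (\<kappa> - \<epsilon>))"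
      using L C(2)[of s t] b by (intro mult_left_mono) auto
    also have "\<dots> \<le> L * (C * (t - s) powr (- \<gamma>) * (t - s) powr (\<kappa> - \<epsilon>))"
      using L C b exps by (intro mult_left_mono mult_right_mono powr_mono2') auto
    also have "\<dots> = L * C * (t - s) powr p"
      unfolding p_def by (simp add: powr_add[symmetric] algebra_simps)
    finally show ?thesis .
  qed
  \<comment> \<open>\<open>k\<close> halvings of the left part bring its length down to the distance
    of \<open>s\<close> from \<open>a\<close>. The bound is the same for all \<open>k\<close>, so it
    holds for every \<open>s > a\<close>.\<close>
  have near: "N (\<alpha> + \<epsilon>) (S \<tau> (integ s t)) \<le> K * (t - s) powr p"
    if "a < s" "s < t" "t \<le> b" "t - s \<le> 2 ^ k * (s - a)" "0 \<le> \<tau>" "\<tau> + (t - s) \<le> b - a" for k s t \<tau>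
    using that
  proof (induction k arbitrary: s t \<tau>)
    case 0
    then have "N (\<alpha> + \<epsilon>) (S \<tau> (integ s t)) \<le> L * C * (t - s) powr p" by (intro far) auto
    also have "\<dots> \<le> K * (t - s) powr p" using K(1) by (intro mult_right_mono) auto
    finally show ?case .
  next
    case (Suc k)
    define m where "m = (s + t) / 2"
    have m: "s < m" "m < t" "m - s = (t - s) / 2" "t - m = (t - s) / 2" unfolding m_def using Suc.prems by (auto simp: field_simps)
    have X1: "S \<tau> (integ m t) \<in> X (\<alpha> + \<epsilon>)" "S (\<tau> + (t - m)) (integ s m) \<in> X (\<alpha> + \<epsilon>)"
      using L(2) C(2) m Suc.prems by auto
    \<comment> \<open>The twist of the left half is added to \<open>\<tau>\<close>; the sum of time
      and length stays \<open>\<tau> + (t - s)\<close>, so the induction hypothesis is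
      applicable.\<close>
    have "S \<tau> (integ s t) = S \<tau> (integ m t) + S (\<tau> + (t - m)) (integ s m)"
    proof -
      have "S (\<tau> + (t - m)) (integ s m) = S \<tau> (S (t - m) (integ s m))"
        using m Suc.prems by (intro S_add) auto
      moreover have "integ s t = integ m t + S (t - m) (integ s m)"
        using m Suc.prems by (intro integ_add) auto
      ultimately show ?thesis using Suc.prems by (simp only: S_linear)
    qed
    then have "N (\<alpha> + \<epsilon>) (S \<tau> (integ s t)) \<le> N (\<alpha> + \<epsilon>) (S \<tau> (integ m t)) + N (\<alpha> + \<epsilon>) (S (\<tau> + (t - m)) (integ s m))"
      using N_triangle[OF \<xi> X1] by simp
    also have "N (\<alpha> + \<epsilon>) (S \<tau> (integ m t)) \<le> L * C * (t - m) powr p"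
      using m Suc.prems by (intro far) auto
    also have "N (\<alpha> + \<epsilon>) (S (\<tau> + (t - m)) (integ s m)) \<le> K * (m - s) powr p"
      using m Suc.prems by (intro Suc.IH) auto
    also have "L * C * (t - m) powr p + K * (m - s) powr p = (K * 2 powr (- p) + L * C * 2 powr (- p)) * (t - s) powr p"
      unfolding m using Suc.prems by (simp add: powr_divide powr_minus field_simps)
    also have "\<dots> \<le> K * (t - s) powr p" using K(2) by (intro mult_right_mono) auto
    finally show ?case by simp
  qed
  obtain k where "(t - s) / (s - a) < 2 ^ k" using real_arch_pow[of 2] by auto
  then have "t - s \<le> 2 ^ k * (s - a)" using st by (simp add: field_simps)
  then show ?thesis using near[of s t k \<tau>] st unfolding K_def p_def by simp
qed

end

text \<open>\<open>Lim\<close> picks out a limit only along a nontrivial filter.\<close>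

lemma at_within_tri_left_open_neq_bot:
  assumes "a < b" "a \<le> t" "t \<le> b"
  shows "at (a, t) within tri_left_open a b \<noteq> bot"
  unfolding trivial_limit_within islimpt_approachable not_not
proof (intro allI impI)
  fix e :: real assume e: "e > 0"
  define h where "h = min (e / 3) (b - a)"
  have h: "0 < h" "h \<le> e / 3" "h \<le> b - a" unfolding h_def using e assms min.cobounded1[of "e / 3" "b - a"] by simp_all
  \<comment> \<open>The maximum keeps the point in the triangle when \<open>t\<close> is closer to
    \<open>a\<close> than \<open>h\<close>, in particular at the corner.\<close>
  let ?z = "(a + h, max t (a + h))"
  have "?z \<in> tri_left_open a b" using h assms unfolding tri_left_open_def by auto
  moreover have "dist ?z (a, t) \<le> \<bar>h\<bar> + \<bar>max t (a + h) - t\<bar>"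
    unfolding dist_Pair_Pair dist_real_def using sqrt_sum_squares_le_sum_abs[of h "max t (a + h) - t"] by simp
  then have "dist ?z (a, t) < e" using h e assms by (auto simp: max_def)
  ultimately show "\<exists>x'\<in>tri_left_open a b. x' \<noteq> (a, t) \<and> dist x' (a, t) < e" using h by (intro bexI[of _ ?z]) auto
qed

section \<open>Extension of the integral to the edge\<close>

context convolution_data
begin

context
  fixes \<epsilon> K p :: real
  assumes \<epsilon>: "0 \<le> \<epsilon>" "\<epsilon> < 1 + \<beta> - \<alpha>" and p: "0 < p" and K: "0 \<le> K"
    and integ_in: "\<And>s t. a < s \<Longrightarrow> s \<le> t \<Longrightarrow> t \<le> b \<Longrightarrow> integ s t \<in> X (\<alpha> + \<epsilon>)"
    and integ_le: "\<And>s t \<tau>. a < s \<Longrightarrow> s < t \<Longrightarrow> t \<le> b \<Longrightarrow> 0 \<le> \<tau> \<Longrightarrow> \<tau> + (t - s) \<le> b - a \<Longrightarrow>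
      N (\<alpha> + \<epsilon>) (S \<tau> (integ s t)) \<le> K * (t - s) powr p"
begin

lemma \<alpha>_plus_bounds: "0 \<le> \<alpha> + \<epsilon>" "\<alpha> + \<epsilon> < 3" using exps \<epsilon> by auto

text \<open>By additivity the difference is \<open>S (t - m) (integ s m)\<close>; this is a second
  use of the operator \<open>S \<tau>\<close> in the unweighted estimate.\<close>

lemma integ_diff_le:
  assumes "a < s" "s \<le> m" "m \<le> t" "t \<le> b"
  shows "N (\<alpha> + \<epsilon>) (integ s t - integ m t) \<le> K * (m - s) powr p"
proof (cases "s = m")
  case False
  have "integ s t - integ m t = S (t - m) (integ s m)" using integ_add[of s m t] assms by simp
  then show ?thesis using integ_le[of s m "t - m"] assms False by simp
qed (simp add: N_zero[OF \<alpha>_plus_bounds])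

text \<open>The hypothesis on \<open>J\<close> pins down the value at \<open>(s, t)\<close> through
  integrals from points \<open>m > a\<close>, and so makes sense at \<open>s = a\<close> as well.
  Interior and edge can then be treated alike: two values are compared with integrals from a common
  \<open>m\<close> slightly to the right of both left endpoints, where continuity in
  \<open>t\<close> is known.\<close>

lemma approx_close:
  assumes st: "a \<le> s" "s < t" "t \<le> b" and e: "0 < e" and J: "J \<in> X (\<alpha> + \<epsilon>)"
    "\<And>m. a < m \<Longrightarrow> s \<le> m \<Longrightarrow> m \<le> t \<Longrightarrow> N (\<alpha> + \<epsilon>) (J - integ m t) \<le> K * (m - s) powr p"
  obtains d where "0 < d" "\<And>s' t' J'. a \<le> s' \<Longrightarrow> s' \<le> t' \<Longrightarrow> t' \<le> b \<Longrightarrow> \<bar>s' - s\<bar> < d \<Longrightarrow> \<bar>t' - t\<bar> < d \<Longrightarrow>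
      J' \<in> X (\<alpha> + \<epsilon>) \<Longrightarrow>
      (\<And>m. a < m \<Longrightarrow> s' \<le> m \<Longrightarrow> m \<le> t' \<Longrightarrow> N (\<alpha> + \<epsilon>) (J' - integ m t') \<le> K * (m - s') powr p) \<Longrightarrow>
      N (\<alpha> + \<epsilon>) (J' - J) < e"
proof -
  \<comment> \<open>With \<open>m = s + h\<close> and \<open>s'\<close> within \<open>h\<close> of
    \<open>s\<close>, the distance \<open>m - s'\<close> is at most \<open>2 * h\<close>, whose
    power costs less than \<open>e / 3\<close>; the first entry keeps \<open>m < t\<close>.\<close>
  define h where "h = min ((t - s) / 2) ((e / 3 / (K + 1)) powr (1 / p) / 2)"
  have h: "0 < h" "h \<le> (t - s) / 2" "2 * h \<le> (e / 3 / (K + 1)) powr (1 / p)"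
    unfolding h_def using st e K by (auto simp: min_def)
  have Kh: "K * (2 * h) powr p < e / 3"
  proof -
    have "(2 * h) powr p \<le> ((e / 3 / (K + 1)) powr (1 / p)) powr p" using h p by (intro powr_mono2) auto
    also have "\<dots> = e / 3 / (K + 1)" using e K p by (simp add: powr_powr)
    finally have "K * (2 * h) powr p \<le> K * (e / 3 / (K + 1))" using K by (rule mult_left_mono)
    also have "\<dots> < e / 3" using e K by (simp add: field_simps)
    finally show ?thesis .
  qed
  define m where "m = s + h"
  have m: "a < m" "s < m" "m < t" unfolding m_def using st h by auto
  have "continuous_into {m<..b} (X (\<alpha> + \<epsilon>)) (N (\<alpha> + \<epsilon>)) (\<lambda>r. case (m, r) of (s, t) \<Rightarrow> integ s t)"
    by (rule continuous_into_compose[OF \<alpha>_plus_bounds integ_continuous[OF \<epsilon> m(1)]]) (auto intro!: continuous_intros)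
  then have "continuous_into {m<..b} (X (\<alpha> + \<epsilon>)) (N (\<alpha> + \<epsilon>)) (integ m)" by simp
  note cont = this[unfolded continuous_into_iff_eps[OF banach_subspace_X[OF \<alpha>_plus_bounds]]]
  have tm: "t \<in> {m<..b}" using m st by simp
  have e3: "0 < e / 3" using e by simp
  have "\<exists>d>0. \<forall>q\<in>{m<..b}. dist q t < d \<longrightarrow> N (\<alpha> + \<epsilon>) (integ m q - integ m t) < e / 3"
    by (rule bspec[OF conjunct2[OF cont] tm, rule_format, OF e3])
  then obtain d where d: "0 < d" "\<And>r. r \<in> {m<..b} \<Longrightarrow> dist r t < d \<Longrightarrow> N (\<alpha> + \<epsilon>) (integ m r - integ m t) < e / 3"
    by blast
  show ?thesis
  proof (rule that[of "min d (min h (t - m))"])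
    show "0 < min d (min h (t - m))" using d h m by simp
    fix s' t' J'
    assume b: "a \<le> s'" "s' \<le> t'" "t' \<le> b" "\<bar>s' - s\<bar> < min d (min h (t - m))" "\<bar>t' - t\<bar> < min d (min h (t - m))"
      and J': "J' \<in> X (\<alpha> + \<epsilon>)"
        "\<And>m. a < m \<Longrightarrow> s' \<le> m \<Longrightarrow> m \<le> t' \<Longrightarrow> N (\<alpha> + \<epsilon>) (J' - integ m t') \<le> K * (m - s') powr p"
    have s': "s' < m" "m - s' \<le> 2 * h" "m < t'" "dist t' t < d"
      using b unfolding m_def dist_real_def by (auto simp: abs_less_iff)
    have X1: "integ m t' \<in> X (\<alpha> + \<epsilon>)" "integ m t \<in> X (\<alpha> + \<epsilon>)" using integ_in m s' b st by auto
    have 1: "N (\<alpha> + \<epsilon>) (J' - integ m t') < e / 3"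
    proof -
      have "N (\<alpha> + \<epsilon>) (J' - integ m t') \<le> K * (m - s') powr p" using J'(2) m s' by simp
      also have "\<dots> \<le> K * (2 * h) powr p" using K s' p by (intro mult_left_mono powr_mono2) auto
      finally show ?thesis using Kh by simp
    qed
    have 2: "N (\<alpha> + \<epsilon>) (integ m t' - integ m t) < e / 3" using d(2) s' b by simp
    have 3: "N (\<alpha> + \<epsilon>) (J - integ m t) < e / 3"
    proof -
      have "N (\<alpha> + \<epsilon>) (J - integ m t) \<le> K * (m - s) powr p" using J(2) m by simp
      also have "\<dots> \<le> K * (2 * h) powr p" using K m h p unfolding m_def by (intro mult_left_mono powr_mono2) auto
      finally show ?thesis using Kh by simp
    qed
    have eq: "J' - J = (J' - integ m t') + ((integ m t' - integ m t) - (J - integ m t))" by simp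
    have "N (\<alpha> + \<epsilon>) (J' - J) \<le> N (\<alpha> + \<epsilon>) (J' - integ m t') + N (\<alpha> + \<epsilon>) ((integ m t' - integ m t) - (J - integ m t))"
      unfolding eq by (intro N_triangle[OF \<alpha>_plus_bounds] X_diff[OF \<alpha>_plus_bounds] J' J X1)
    also have "\<dots> \<le> N (\<alpha> + \<epsilon>) (J' - integ m t') + (N (\<alpha> + \<epsilon>) (integ m t' - integ m t) + N (\<alpha> + \<epsilon>) (J - integ m t))"
      by (intro add_left_mono N_triangle_diff[OF \<alpha>_plus_bounds] X_diff[OF \<alpha>_plus_bounds] J X1)
    finally show "N (\<alpha> + \<epsilon>) (J' - J) < e" using 1 2 3 by simp
  qed
qed

text \<open>Along points decreasing to \<open>a\<close> the integrals form a Cauchy sequence in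
  \<open>X (\<alpha> + \<epsilon>)\<close> itself, which places the limit there; the increment bound
  survives the limit.\<close>

lemma edge_value:
  assumes t: "a < t" "t \<le> b"
  obtains J where "J \<in> X (\<alpha> + \<epsilon>)" "\<And>m. a < m \<Longrightarrow> m \<le> t \<Longrightarrow> N (\<alpha> + \<epsilon>) (J - integ m t) \<le> K * (m - a) powr p"
proof -
  define s where "s n = a + (t - a) / (real n + 1)" for n :: nat
  have s: "a < s n" "s n \<le> t" for n
    using t divide_left_mono[of 1 "real n + 1" "t - a"] unfolding s_def by auto
  have dec: "s n \<le> s m" if "m \<le> n" for m n unfolding s_def using t that by (auto intro!: divide_left_mono)
  define f where "f n = integ (s n) t" for n
  have fX: "f n \<in> X (\<alpha> + \<epsilon>)" for n unfolding f_def using s t by (intro integ_in) auto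
  have le: "N (\<alpha> + \<epsilon>) (f n - f m) \<le> K * (s m - a) powr p" if "m \<le> n" for m n
  proof -
    have "N (\<alpha> + \<epsilon>) (f n - f m) \<le> K * (s m - s n) powr p"
      unfolding f_def using s t dec[OF that] by (intro integ_diff_le) auto
    also have "\<dots> \<le> K * (s m - a) powr p" using K s[of n] dec[OF that] p by (intro mult_left_mono powr_mono2) auto
    finally show ?thesis .
  qed
  have s_lim: "s \<longlonglongrightarrow> a"
  proof -
    have "(\<lambda>n. a + (t - a) * (1 / (real n + 1))) \<longlonglongrightarrow> a + (t - a) * 0"
      using LIMSEQ_inverse_real_of_nat by (intro tendsto_intros) (simp add: inverse_eq_divide add.commute)
    then show ?thesis unfolding s_def by simp
  qed
  have "(\<lambda>n. K * (s n - a) powr p) \<longlonglongrightarrow> K * 0"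
  proof (intro tendsto_mult_left tendsto_zero_powrI[OF _ tendsto_const])
    show "(\<lambda>n. s n - a) \<longlonglongrightarrow> 0" using tendsto_diff[OF s_lim tendsto_const[of a]] by simp
    show "\<forall>\<^sub>F n in sequentially. 0 \<le> s n - a" using s by (intro always_eventually allI) (simp add: less_imp_le)
  qed (use p in simp)
  then have lim0: "(\<lambda>n. K * (s n - a) powr p) \<longlonglongrightarrow> 0" by simp
  have "\<exists>n0. \<forall>m\<ge>n0. \<forall>n\<ge>n0. N (\<alpha> + \<epsilon>) (f m - f n) < e" if "e > 0" for e
  proof -
    from order_tendstoD(2)[OF lim0 that]
    obtain n0 where n0: "\<And>n. n \<ge> n0 \<Longrightarrow> K * (s n - a) powr p < e" by (auto simp: eventually_sequentially)
    have "N (\<alpha> + \<epsilon>) (f m - f n) < e" if "m \<ge> n0" "n \<ge> n0" for m n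
    proof (cases "n \<le> m")
      case True
      then show ?thesis using le[of n m] n0[of n] that by simp
    next
      case False
      then show ?thesis using le[of m n] n0[of m] that N_minus_commute[OF \<alpha>_plus_bounds fX fX, of m n] by simp
    qed
    then show ?thesis by blast
  qed
  then have "\<exists>l\<in>X (\<alpha> + \<epsilon>). (\<lambda>n. N (\<alpha> + \<epsilon>) (f n - l)) \<longlonglongrightarrow> 0" using fX by (intro N_complete[OF \<alpha>_plus_bounds]) auto
  then obtain J where J: "J \<in> X (\<alpha> + \<epsilon>)" "(\<lambda>n. N (\<alpha> + \<epsilon>) (f n - J)) \<longlonglongrightarrow> 0" by blast
  have "N (\<alpha> + \<epsilon>) (J - integ m t) \<le> K * (m - a) powr p" if m: "a < m" "m \<le> t" for m
  proof (rule N_le_limit[OF \<alpha>_plus_bounds fX J])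
    show "integ m t \<in> X (\<alpha> + \<epsilon>)" using integ_in m t by simp
    have "\<forall>\<^sub>F n in sequentially. s n < m" using order_tendstoD(2)[OF s_lim] m by simp
    then show "\<forall>\<^sub>F n in sequentially. N (\<alpha> + \<epsilon>) (f n - integ m t) \<le> K * (m - a) powr p"
    proof eventually_elim
      case (elim n)
      have "N (\<alpha> + \<epsilon>) (f n - integ m t) \<le> K * (m - s n) powr p"
        unfolding f_def using s t elim m by (intro integ_diff_le) auto
      also have "\<dots> \<le> K * (m - a) powr p" using K s[of n] elim p by (intro mult_left_mono powr_mono2) auto
      finally show ?case .
    qed
  qed
  with J(1) show ?thesis using that by blast
qed

text \<open>The defining limit is ambient and lets both endpoints vary; \<open>approx_close\<close>,
  applied to the values \<open>integ s' t'\<close>, shows that it is \<open>J\<close>. Being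
  ambient, it is the same vector for all \<open>\<epsilon>\<close>.\<close>

lemma conv_integral_edge:
  assumes t: "a < t" "t \<le> b" and J: "J \<in> X (\<alpha> + \<epsilon>)"
    "\<And>m. a < m \<Longrightarrow> m \<le> t \<Longrightarrow> N (\<alpha> + \<epsilon>) (J - integ m t) \<le> K * (m - a) powr p"
  shows "conv_integral X N S \<beta> \<eta> \<rho> a b x \<phi> (a, t) = J"
proof -
  let ?F = "at (a, t) within tri_left_open a b"
  obtain E where E: "E > 0" "\<And>u. u \<in> X (\<alpha> + \<epsilon>) \<Longrightarrow> norm u \<le> E * N (\<alpha> + \<epsilon>) u"
    using embed_norm[OF \<alpha>_plus_bounds] by blast
  have "(conv_integral0 X N S \<beta> \<eta> \<rho> a b x \<phi> \<longlongrightarrow> J) ?F"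
  proof (rule tendstoI)
    fix e :: real assume "e > 0"
    then have e: "0 < e / E" using E by simp
    obtain d where d: "0 < d" "\<And>s' t' J'. a \<le> s' \<Longrightarrow> s' \<le> t' \<Longrightarrow> t' \<le> b \<Longrightarrow> \<bar>s' - a\<bar> < d \<Longrightarrow> \<bar>t' - t\<bar> < d \<Longrightarrow>
      J' \<in> X (\<alpha> + \<epsilon>) \<Longrightarrow>
      (\<And>m. a < m \<Longrightarrow> s' \<le> m \<Longrightarrow> m \<le> t' \<Longrightarrow> N (\<alpha> + \<epsilon>) (J' - integ m t') \<le> K * (m - s') powr p) \<Longrightarrow>
      N (\<alpha> + \<epsilon>) (J' - J) < e / E"
      using approx_close[OF order_refl t e J] by auto
    have "dist (conv_integral0 X N S \<beta> \<eta> \<rho> a b x \<phi> z) J < e"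
      if z: "z \<in> tri_left_open a b" "dist z (a, t) < d" for z
    proof -
      obtain s' t' where z': "z = (s', t')" "a < s'" "s' \<le> t'" "t' \<le> b" using z unfolding tri_left_open_def by auto
      have "\<bar>s' - a\<bar> < d" "\<bar>t' - t\<bar> < d"
        using dist_fst_le[of z "(a, t)"] dist_snd_le[of z "(a, t)"] z z' by (auto simp: dist_real_def)
      then have "N (\<alpha> + \<epsilon>) (integ s' t' - J) < e / E"
        using z' integ_in[of s' t'] integ_diff_le[of s' _ t'] by (intro d(2)) auto
      then have "E * N (\<alpha> + \<epsilon>) (integ s' t' - J) < e" using E(1) by (simp add: field_simps)
      moreover have "norm (integ s' t' - J) \<le> E * N (\<alpha> + \<epsilon>) (integ s' t' - J)"
        by (intro E X_diff[OF \<alpha>_plus_bounds] integ_in z' J)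
      ultimately show ?thesis using conv_integral0_eq[of s' t'] z' by (simp add: dist_norm)
    qed
    then show "\<forall>\<^sub>F z in ?F. dist (conv_integral0 X N S \<beta> \<eta> \<rho> a b x \<phi> z) J < e"
      unfolding eventually_at using d(1) by blast
  qed
  then have "Lim ?F (conv_integral0 X N S \<beta> \<eta> \<rho> a b x \<phi>) = J"
    using at_within_tri_left_open_neq_bot[OF ab, of t] t by (intro tendsto_Lim) auto
  then show ?thesis unfolding conv_integral_def by simp
qed

text \<open>No \<open>m\<close> with \<open>a < m \<le> t\<close> is left when \<open>t = a\<close>;
  instead the integrals tend to 0 with the length of their interval.\<close>

lemma conv_integral_corner: "conv_integral X N S \<beta> \<eta> \<rho> a b x \<phi> (a, a) = 0"
proof -
  let ?F = "at (a, a) within tri_left_open a b"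
  obtain E where E: "E > 0" "\<And>u. u \<in> X (\<alpha> + \<epsilon>) \<Longrightarrow> norm u \<le> E * N (\<alpha> + \<epsilon>) u"
    using embed_norm[OF \<alpha>_plus_bounds] by blast
  have "((\<lambda>z. E * (K * (snd z - fst z) powr p)) \<longlongrightarrow> E * (K * 0)) ?F"
  proof (intro tendsto_mult_left tendsto_zero_powrI[OF _ tendsto_const])
    have "((\<lambda>z. snd z - fst z) \<longlongrightarrow> snd (a, a) - fst (a, a)) ?F" by (intro tendsto_intros)
    then show "((\<lambda>z. snd z - fst z) \<longlongrightarrow> 0) ?F" by simp
    show "\<forall>\<^sub>F z in ?F. 0 \<le> snd z - fst z"
      by (auto simp: eventually_at_filter tri_left_open_def intro!: always_eventually)
  qed (use p in simp)
  then have lim: "((\<lambda>z. E * (K * (snd z - fst z) powr p)) \<longlongrightarrow> 0) ?F" by simp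
  have "(conv_integral0 X N S \<beta> \<eta> \<rho> a b x \<phi> \<longlongrightarrow> 0) ?F"
  proof (rule Lim_null_comparison[OF _ lim])
    have "norm (conv_integral0 X N S \<beta> \<eta> \<rho> a b x \<phi> (s, t)) \<le> E * (K * (t - s) powr p)"
      if st: "a < s" "s \<le> t" "t \<le> b" for s t
    proof -
      have "norm (integ s t) \<le> E * N (\<alpha> + \<epsilon>) (integ s t)" by (intro E integ_in st)
      also have "\<dots> \<le> E * (K * (t - s) powr p)"
        using integ_diff_le[of s t t] st E by (intro mult_left_mono) (auto simp: integ_refl)
      finally show ?thesis using conv_integral0_eq[OF st] by simp
    qed
    then show "\<forall>\<^sub>F z in ?F. norm (conv_integral0 X N S \<beta> \<eta> \<rho> a b x \<phi> z) \<le> E * (K * (snd z - fst z) powr p)"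
      by (auto simp: eventually_at_filter tri_left_open_def intro!: always_eventually)
  qed
  then have "Lim ?F (conv_integral0 X N S \<beta> \<eta> \<rho> a b x \<phi>) = 0"
    using at_within_tri_left_open_neq_bot[OF ab, of a] ab by (intro tendsto_Lim) auto
  then show ?thesis unfolding conv_integral_def by simp
qed

text \<open>Interior, edge and corner in the one form that \<open>approx_close\<close> expects. For
  \<open>m = t\<close> the subtracted integral vanishes, which yields
  \<open>conv_integral_bound\<close>.\<close>

lemma conv_integral_approx:
  assumes st: "a \<le> s" "s \<le> t" "t \<le> b"
  shows "conv_integral X N S \<beta> \<eta> \<rho> a b x \<phi> (s, t) \<in> X (\<alpha> + \<epsilon>)"
    and "a < m \<Longrightarrow> s \<le> m \<Longrightarrow> m \<le> t \<Longrightarrow>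
      N (\<alpha> + \<epsilon>) (conv_integral X N S \<beta> \<eta> \<rho> a b x \<phi> (s, t) - integ m t) \<le> K * (m - s) powr p"
proof -
  have "conv_integral X N S \<beta> \<eta> \<rho> a b x \<phi> (s, t) \<in> X (\<alpha> + \<epsilon>) \<and>
    (\<forall>m. a < m \<longrightarrow> s \<le> m \<longrightarrow> m \<le> t \<longrightarrow>
      N (\<alpha> + \<epsilon>) (conv_integral X N S \<beta> \<eta> \<rho> a b x \<phi> (s, t) - integ m t) \<le> K * (m - s) powr p)"
  proof (cases "s = a")
    case False
    then have "conv_integral X N S \<beta> \<eta> \<rho> a b x \<phi> (s, t) = integ s t"
      using conv_integral0_eq[of s t] st by (simp add: conv_integral_def)
    then show ?thesis using integ_in[of s t] integ_diff_le[of s _ t] st False by simp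
  next
    case True
    show ?thesis
    proof (cases "t = a")
      case True
      then show ?thesis using conv_integral_corner X_zero[OF \<alpha>_plus_bounds] st \<open>s = a\<close> by simp
    next
      case False
      then have t: "a < t" "t \<le> b" using st by auto
      obtain J where J: "J \<in> X (\<alpha> + \<epsilon>)" "\<And>m. a < m \<Longrightarrow> m \<le> t \<Longrightarrow> N (\<alpha> + \<epsilon>) (J - integ m t) \<le> K * (m - a) powr p"
        using edge_value[OF t] by blast
      show ?thesis using conv_integral_edge[OF t J] J True by simp
    qed
  qed
  then show "conv_integral X N S \<beta> \<eta> \<rho> a b x \<phi> (s, t) \<in> X (\<alpha> + \<epsilon>)"
    and "a < m \<Longrightarrow> s \<le> m \<Longrightarrow> m \<le> t \<Longrightarrow>
      N (\<alpha> + \<epsilon>) (conv_integral X N S \<beta> \<eta> \<rho> a b x \<phi> (s, t) - integ m t) \<le> K * (m - s) powr p" by auto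
qed

lemma conv_integral_bound:
  assumes st: "a \<le> s" "s < t" "t \<le> b"
  shows "N (\<alpha> + \<epsilon>) (conv_integral X N S \<beta> \<eta> \<rho> a b x \<phi> (s, t)) \<le> K * (t - s) powr p"
  using conv_integral_approx(2)[of s t t] st by (simp add: integ_refl)

lemma conv_integral_two_hoelder:
  "conv_integral X N S \<beta> \<eta> \<rho> a b x \<phi> \<in> two_hoelder p a b (X (\<alpha> + \<epsilon>)) (N (\<alpha> + \<epsilon>))"
    (is "?I \<in> _")
proof -
  have diag: "?I (s, s) = 0" if "a \<le> s" "s \<le> b" for s
  proof (cases "s = a")
    case False
    then show ?thesis using conv_integral0_eq[of s s] that by (simp add: conv_integral_def integ_refl)
  qed (simp add: conv_integral_corner)
  have "continuous_into (tri a b) (X (\<alpha> + \<epsilon>)) (N (\<alpha> + \<epsilon>)) ?I"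
  proof (rule continuous_into_tri[OF \<alpha>_plus_bounds p _ diag conv_integral_bound])
    show "continuous_into {(s, t). a \<le> s \<and> s < t \<and> t \<le> b} (X (\<alpha> + \<epsilon>)) (N (\<alpha> + \<epsilon>)) ?I"
      unfolding continuous_into_iff_eps[OF banach_subspace_X[OF \<alpha>_plus_bounds]]
    proof (intro conjI ballI allI impI)
      fix z assume "z \<in> {(s, t). a \<le> s \<and> s < t \<and> t \<le> b}"
      then obtain s t where z: "z = (s, t)" "a \<le> s" "s < t" "t \<le> b" by auto
      note ap = conv_integral_approx[OF z(2) less_imp_le[OF z(3)] z(4)]
      show "?I z \<in> X (\<alpha> + \<epsilon>)" using ap(1) z by simp
      fix e :: real assume e: "0 < e"
      obtain d where d: "0 < d" "\<And>s' t' J'. a \<le> s' \<Longrightarrow> s' \<le> t' \<Longrightarrow> t' \<le> b \<Longrightarrow> \<bar>s' - s\<bar> < d \<Longrightarrow> \<bar>t' - t\<bar> < d \<Longrightarrow>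
        J' \<in> X (\<alpha> + \<epsilon>) \<Longrightarrow>
        (\<And>m. a < m \<Longrightarrow> s' \<le> m \<Longrightarrow> m \<le> t' \<Longrightarrow> N (\<alpha> + \<epsilon>) (J' - integ m t') \<le> K * (m - s') powr p) \<Longrightarrow>
        N (\<alpha> + \<epsilon>) (J' - ?I (s, t)) < e"
        using approx_close[OF z(2-4) e ap] by auto
      have "N (\<alpha> + \<epsilon>) (?I w - ?I z) < e"
        if w: "w \<in> {(s, t). a \<le> s \<and> s < t \<and> t \<le> b}" "dist w z < d" for w
      proof -
        obtain s' t' where w': "w = (s', t')" "a \<le> s'" "s' < t'" "t' \<le> b" using w by auto
        have "\<bar>s' - s\<bar> < d" "\<bar>t' - t\<bar> < d"
          using dist_fst_le[of w z] dist_snd_le[of w z] w w' z by (auto simp: dist_real_def)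
        then show ?thesis unfolding w' z(1) using w' conv_integral_approx[of s' t'] by (intro d(2)) auto
      qed
      then show "\<exists>d>0. \<forall>w\<in>{(s, t). a \<le> s \<and> s < t \<and> t \<le> b}. dist w z < d \<longrightarrow> N (\<alpha> + \<epsilon>) (?I w - ?I z) < e"
        using d(1) by blast
    qed
  qed
  moreover have "N (\<alpha> + \<epsilon>) (?I (s, t)) * (t - s) powr (- p) \<le> K" if st: "a \<le> s" "s < t" "t \<le> b" for s t
  proof -
    have "N (\<alpha> + \<epsilon>) (?I (s, t)) * (t - s) powr (- p) \<le> K * (t - s) powr p * (t - s) powr (- p)"
      using conv_integral_bound[OF st] by (rule mult_right_mono) simp
    also have "\<dots> = K" unfolding mult.assoc powr_add[symmetric] using st by simp
    finally show ?thesis .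
  qed
  then have "bdd_above ((\<lambda>(s, t). N (\<alpha> + \<epsilon>) (?I (s, t)) * (t - s) powr (- p)) ` {(s, t). a \<le> s \<and> s < t \<and> t \<le> b})"
    by (intro bdd_aboveI[of _ K]) auto
  ultimately show ?thesis unfolding two_hoelder_def using diag by simp
qed

end
end

section \<open>Uniformity of the constants\<close>

text \<open>Everything that enters \<open>C\<close> is chosen from the exponents and the length
  \<open>d\<close>, before the interval, \<open>x\<close> and \<open>\<phi>\<close> appear; the
  locale is then interpreted anew for each set of data.\<close>

lemma (in semigroup_scale) conv_integral_estimate:
  fixes \<alpha> \<beta> \<eta> \<rho> \<gamma> \<epsilon> d :: real
  defines "\<kappa> \<equiv> min \<eta> (\<eta> + \<rho> + \<beta> - \<alpha>)"
  assumes exps: "0 \<le> \<beta>" "\<beta> \<le> \<alpha>" "\<alpha> < 2" "\<alpha> - \<beta> < 1" "1 - \<eta> < \<rho>"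
    and \<epsilon>: "0 \<le> \<epsilon>" "\<epsilon> < 1 + \<beta> - \<alpha>" "\<epsilon> < \<kappa> - \<gamma>" and d: "0 < d"
  obtains C where "0 < C"
    "\<And>a b x \<phi> H P Q. convolution_data X N S DA A a b \<alpha> \<beta> \<eta> \<rho> \<gamma> H P Q x \<phi> \<Longrightarrow> b - a = d \<Longrightarrow>
      conv_integral X N S \<beta> \<eta> \<rho> a b x \<phi> \<in> two_hoelder (\<kappa> - \<gamma> - \<epsilon>) a b (X (\<alpha> + \<epsilon>)) (N (\<alpha> + \<epsilon>))"
    "\<And>a b x \<phi> H P Q s t. convolution_data X N S DA A a b \<alpha> \<beta> \<eta> \<rho> \<gamma> H P Q x \<phi> \<Longrightarrow> b - a = d \<Longrightarrow>
      a \<le> s \<Longrightarrow> s < t \<Longrightarrow> t \<le> b \<Longrightarrow>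
      N (\<alpha> + \<epsilon>) (conv_integral X N S \<beta> \<eta> \<rho> a b x \<phi> (s, t)) \<le> C * (H * (P + Q)) * (t - s) powr (\<kappa> - \<gamma> - \<epsilon>)"
proof -
  have "\<exists>L>0. \<forall>\<tau>\<in>{0<..d}. \<forall>u\<in>X \<alpha>. S \<tau> u \<in> X (\<alpha> + \<epsilon>) \<and> N (\<alpha> + \<epsilon>) (S \<tau> u) \<le> L * \<tau> powr (- (\<alpha> + \<epsilon>) + \<alpha>) * N \<alpha> u"
    using exps \<epsilon> d by (intro S_smoothing) auto
  then obtain L1 where L1: "0 < L1" "\<And>\<tau> u. 0 < \<tau> \<Longrightarrow> \<tau> \<le> d \<Longrightarrow> u \<in> X \<alpha> \<Longrightarrow>
      S \<tau> u \<in> X (\<alpha> + \<epsilon>) \<and> N (\<alpha> + \<epsilon>) (S \<tau> u) \<le> L1 * \<tau> powr (- \<epsilon>) * N \<alpha> u" by auto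
  have "\<exists>L>0. \<forall>\<tau>\<in>{0<..d}. \<forall>u\<in>X \<beta>. S \<tau> u \<in> X (\<alpha> + \<epsilon>) \<and> N (\<alpha> + \<epsilon>) (S \<tau> u) \<le> L * \<tau> powr (- (\<alpha> + \<epsilon>) + \<beta>) * N \<beta> u"
    using exps \<epsilon> d by (intro S_smoothing) auto
  moreover have e: "- (\<alpha> + \<epsilon>) + \<beta> = - (\<alpha> - \<beta> + \<epsilon>)" by simp
  ultimately obtain L2 where L2: "0 < L2" "\<And>\<tau> u. 0 < \<tau> \<Longrightarrow> \<tau> \<le> d \<Longrightarrow> u \<in> X \<beta> \<Longrightarrow>
      S \<tau> u \<in> X (\<alpha> + \<epsilon>) \<and> N (\<alpha> + \<epsilon>) (S \<tau> u) \<le> L2 * \<tau> powr (- (\<alpha> - \<beta> + \<epsilon>)) * N \<beta> u" unfolding e by auto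
  have "\<exists>L\<ge>1. \<forall>\<tau>\<in>{0..d}. \<forall>u\<in>X (\<alpha> + \<epsilon>). S \<tau> u \<in> X (\<alpha> + \<epsilon>) \<and> N (\<alpha> + \<epsilon>) (S \<tau> u) \<le> L * N (\<alpha> + \<epsilon>) u"
    using exps \<epsilon> d by (intro S_bdd) auto
  then obtain L3 where L3: "1 \<le> L3" "\<And>\<tau> u. 0 \<le> \<tau> \<Longrightarrow> \<tau> \<le> d \<Longrightarrow> u \<in> X (\<alpha> + \<epsilon>) \<Longrightarrow>
      S \<tau> u \<in> X (\<alpha> + \<epsilon>) \<and> N (\<alpha> + \<epsilon>) (S \<tau> u) \<le> L3 * N (\<alpha> + \<epsilon>) u" by auto
  define p where "p = \<kappa> - \<gamma> - \<epsilon>"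
  define q0 :: real where "q0 = 2 powr (1 - (\<eta> + \<rho>))"
  \<comment> \<open>The factor of \<open>integ_weighted\<close> without \<open>H * (P + Q)\<close>;
    \<open>C\<close> is the resulting factor of \<open>integ_unweighted\<close>.\<close>
  define C1 where "C1 = L1 * d powr (\<eta> - \<kappa>) + L2 / ((1 - (\<alpha> - \<beta> + \<epsilon>)) * (1 - q0)) * d powr (\<eta> + \<rho> + \<beta> - \<alpha> - \<kappa>)"
  define C where "C = L3 * C1 / (1 - 2 powr (- p))"
  have p: "0 < p" unfolding p_def using \<epsilon> by simp
  have two: "q0 < 1" "2 powr (- p) < 1"
    unfolding q0_def using p exps powr_less_mono[of "- p" 0 2] powr_less_mono[of "1 - (\<eta> + \<rho>)" 0 2] by auto
  have C1: "0 < C1" unfolding C1_def using L1 L2 two d \<epsilon> by (intro add_pos_pos mult_pos_pos divide_pos_pos) auto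
  have C: "0 < C" unfolding C_def using L3 C1 two by (intro divide_pos_pos mult_pos_pos) auto
  have *: "conv_integral X N S \<beta> \<eta> \<rho> a b x \<phi> \<in> two_hoelder p a b (X (\<alpha> + \<epsilon>)) (N (\<alpha> + \<epsilon>)) \<and>
      (\<forall>s t. a \<le> s \<longrightarrow> s < t \<longrightarrow> t \<le> b \<longrightarrow>
        N (\<alpha> + \<epsilon>) (conv_integral X N S \<beta> \<eta> \<rho> a b x \<phi> (s, t)) \<le> C * (H * (P + Q)) * (t - s) powr p)"
    if cd: "convolution_data X N S DA A a b \<alpha> \<beta> \<eta> \<rho> \<gamma> H P Q x \<phi>" and ba: "b - a = d" for a b x \<phi> H P Q
  proof -
    interpret convolution_data X N S DA A a b \<alpha> \<beta> \<eta> \<rho> \<gamma> H P Q x \<phi> by (rule cd)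
    \<comment> \<open>The locale constants depend on the exponents only and agree with the values
      fixed in advance.\<close>
    have \<kappa>: "convolution_data.\<kappa> \<alpha> \<beta> \<eta> \<rho> = \<kappa>"
      unfolding convolution_data.\<kappa>_def[OF cd] assms(1) ..
    have q: "convolution_data.q \<eta> \<rho> = q0" unfolding convolution_data.q_def[OF cd] q0_def ..
    have w: "integ s t \<in> X (\<alpha> + \<epsilon>) \<and> N (\<alpha> + \<epsilon>) (integ s t) \<le> C1 * (H * (P + Q)) * (s - a) powr (- \<gamma>) * (t - s) powr (\<kappa> - \<epsilon>)"
      if "a < s" "s < t" "t \<le> b" for s t
      using integ_weighted[of \<epsilon> L1 L2 s t] L1 L2 \<epsilon> that unfolding ba \<kappa> q C1_def by simp
    have B0: "0 \<le> C1 * (H * (P + Q))" using C1 H P Q by simp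
    have u: "N (\<alpha> + \<epsilon>) (S \<tau> (integ s t)) \<le> C * (H * (P + Q)) * (t - s) powr p"
      if "a < s" "s < t" "t \<le> b" "0 \<le> \<tau>" "\<tau> + (t - s) \<le> b - a" for s t \<tau>
    proof -
      have "N (\<alpha> + \<epsilon>) (S \<tau> (integ s t)) \<le> L3 * (C1 * (H * (P + Q))) / (1 - 2 powr (- p)) * (t - s) powr p"
        using integ_unweighted[of \<epsilon> "C1 * (H * (P + Q))" L3 s t \<tau>] \<epsilon> B0 w L3 that unfolding ba \<kappa> p_def by simp
      then show ?thesis unfolding C_def by (simp add: mult_ac)
    qed
    have i: "integ s t \<in> X (\<alpha> + \<epsilon>)" if "a < s" "s \<le> t" "t \<le> b" for s t
      using w[of s t] that X_zero[of "\<alpha> + \<epsilon>"] integ_refl exps \<epsilon> by (cases "s = t") auto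
    have B: "0 \<le> C * (H * (P + Q))" using C H P Q by simp
    note pre = \<epsilon>(1,2) p B i u
    show ?thesis using conv_integral_two_hoelder[OF pre] conv_integral_bound[OF pre] by blast
  qed
  show ?thesis using that[OF C] * unfolding p_def by blast
qed

text \<open>Membership in the spaces supplies boundedness, so that each supremum really dominates
  its quotients; multiplying by the inverse weights gives the pointwise bounds.\<close>

lemma (in semigroup_scale) convolution_data_norms:
  fixes \<alpha> \<beta> \<eta> \<rho> \<gamma> a b :: real
  assumes exps: "0 \<le> \<beta>" "\<beta> \<le> \<alpha>" "\<alpha> < 2" "\<alpha> - \<beta> < 1" "0 < \<eta>" "\<eta> < 1" "1 - \<eta> < \<rho>" "0 \<le> \<gamma>" "\<gamma> < \<eta>" "\<gamma> < \<eta> + \<rho> + \<beta> - \<alpha>"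
    and ab: "a < b" and x: "x \<in> hoelder \<eta> a b" and \<phi>: "\<phi> \<in> wt_cont \<gamma> a b (X \<alpha>) (N \<alpha>)"
    and \<delta>: "delta1 S \<phi> \<in> wt_two_hoelder \<rho> \<gamma> a b (X \<beta>) (N \<beta>)"
  shows "convolution_data X N S DA A a b \<alpha> \<beta> \<eta> \<rho> \<gamma> (hoelder_norm \<eta> a b x) (wt_cont_norm \<gamma> a b (N \<alpha>) \<phi>)
    (wt_two_hoelder_norm \<rho> \<gamma> a b (N \<beta>) (delta1 S \<phi>)) x \<phi>"
proof -
  let ?T = "{(s, t). a \<le> s \<and> s < t \<and> t \<le> b}" and ?T' = "{(s, t). a < s \<and> s < t \<and> t \<le> b}"
  \<comment> \<open>The Hoelder seminorm. For the full norm to dominate it, the supremum of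
    \<open>\<bar>x t\<bar>\<close> must be nonnegative, and this is why \<open>x\<close> is shown to
    be bounded.\<close>
  define K where "K = (SUP p\<in>?T. hoelder_quot \<eta> x p)"
  have bdd: "bdd_above (hoelder_quot \<eta> x ` ?T)" using x unfolding hoelder_def by simp
  have K: "\<bar>x t - x s\<bar> \<le> K * (t - s) powr \<eta>" if st: "a \<le> s" "s \<le> t" "t \<le> b" for s t
  proof (cases "s = t")
    case False
    have "hoelder_quot \<eta> x (s, t) \<le> K" unfolding K_def using st False by (intro cSUP_upper bdd) auto
    then have "\<bar>x t - x s\<bar> * (t - s) powr (- \<eta>) * (t - s) powr \<eta> \<le> K * (t - s) powr \<eta>"
      unfolding hoelder_quot_def by (intro mult_right_mono) auto
    then show ?thesis unfolding mult.assoc powr_add[symmetric] using st False by simp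
  qed simp
  have "0 \<le> K * (b - a) powr \<eta>" using K[of a b] ab by simp
  then have K0: "0 \<le> K" using ab by (simp add: zero_le_mult_iff)
  have "\<bar>x t\<bar> \<le> \<bar>x a\<bar> + K * (b - a) powr \<eta>" if t: "t \<in> {a..b}" for t
  proof -
    have "\<bar>x t - x a\<bar> \<le> K * (t - a) powr \<eta>" using K[of a t] t by simp
    also have "\<dots> \<le> K * (b - a) powr \<eta>" using t K0 exps by (intro mult_left_mono powr_mono2) auto
    finally show ?thesis by linarith
  qed
  then have "bdd_above ((\<lambda>t. \<bar>x t\<bar>) ` {a..b})" by (intro bdd_aboveI2) auto
  then have "\<bar>x a\<bar> \<le> (SUP t\<in>{a..b}. \<bar>x t\<bar>)" using ab by (intro cSUP_upper) auto
  then have KH: "K \<le> hoelder_norm \<eta> a b x" unfolding hoelder_norm_def K_def by simp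
  have \<phi>c: "continuous_into {a<..b} (X \<alpha>) (N \<alpha>) \<phi>"
    and \<phi>b: "bdd_above ((\<lambda>t. (t - a) powr \<gamma> * N \<alpha> (\<phi> t)) ` {a<..b})" using \<phi> unfolding wt_cont_def by auto
  have \<phi>X: "\<phi> t \<in> X \<alpha>" if "a < t" "t \<le> b" for t using \<phi>c that unfolding continuous_into_def by simp
  have P: "(t - a) powr \<gamma> * N \<alpha> (\<phi> t) \<le> wt_cont_norm \<gamma> a b (N \<alpha>) \<phi>" if "a < t" "t \<le> b" for t
    unfolding wt_cont_norm_def using that by (intro cSUP_upper \<phi>b) auto
  have "0 \<le> (b - a) powr \<gamma> * N \<alpha> (\<phi> b)" using N_nonneg[OF _ _ \<phi>X[of b]] exps ab by simp
  then have P0: "0 \<le> wt_cont_norm \<gamma> a b (N \<alpha>) \<phi>" using P[of b] ab by simp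
  have \<delta>c: "continuous_into (tri_left_open a b) (X \<beta>) (N \<beta>) (delta1 S \<phi>)"
    and \<delta>0: "\<And>s. a < s \<Longrightarrow> s \<le> b \<Longrightarrow> delta1 S \<phi> (s, s) = 0"
    and \<delta>b: "bdd_above (wt_two_quot \<rho> \<gamma> a (N \<beta>) (delta1 S \<phi>) ` ?T')" using \<delta> unfolding wt_two_hoelder_def by auto
  let ?Q = "wt_two_hoelder_norm \<rho> \<gamma> a b (N \<beta>) (delta1 S \<phi>)"
  have Q: "wt_two_quot \<rho> \<gamma> a (N \<beta>) (delta1 S \<phi>) (s, t) \<le> ?Q" if "a < s" "s < t" "t \<le> b" for s t
    unfolding wt_two_hoelder_norm_def using that by (intro cSUP_upper \<delta>b) auto
  have Q0: "0 \<le> ?Q"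
  proof -
    define s where "s = (a + b) / 2"
    have s: "a < s" "s < b" unfolding s_def using ab by auto
    then have "delta1 S \<phi> (s, b) \<in> X \<beta>" using \<delta>c unfolding continuous_into_def tri_left_open_def by simp
    then have "0 \<le> N \<beta> (delta1 S \<phi> (s, b))" using N_nonneg[of \<beta>] exps by simp
    then have "0 \<le> wt_two_quot \<rho> \<gamma> a (N \<beta>) (delta1 S \<phi>) (s, b)" unfolding wt_two_quot_def by simp
    then show ?thesis using Q[of s b] s by simp
  qed
  show ?thesis
  proof unfold_locales
    show "\<bar>x t - x s\<bar> \<le> hoelder_norm \<eta> a b x * (t - s) powr \<eta>" if "a \<le> s" "s \<le> t" "t \<le> b" for s t
      using K[OF that] mult_right_mono[OF KH, of "(t - s) powr \<eta>"] by simp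
    show "N \<alpha> (\<phi> t) \<le> wt_cont_norm \<gamma> a b (N \<alpha>) \<phi> * (t - a) powr (- \<gamma>)" if t: "a < t" "t \<le> b" for t
    proof -
      have "(t - a) powr (- \<gamma>) * ((t - a) powr \<gamma> * N \<alpha> (\<phi> t)) \<le> (t - a) powr (- \<gamma>) * wt_cont_norm \<gamma> a b (N \<alpha>) \<phi>"
        using P[OF t] by (intro mult_left_mono) auto
      then show ?thesis unfolding mult.assoc[symmetric] powr_add[symmetric] using t by (simp add: mult.commute)
    qed
    show "N \<beta> (delta1 S \<phi> (s, t)) \<le> ?Q * (s - a) powr (- \<gamma>) * (t - s) powr \<rho>" if st: "a < s" "s \<le> t" "t \<le> b" for s t
    proof (cases "s = t")
      case True
      then show ?thesis using \<delta>0[of s] st N_zero[of \<beta>] exps by simp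
    next
      case False
      have "N \<beta> (delta1 S \<phi> (s, t)) = ((s - a) powr (- \<gamma>) * (s - a) powr \<gamma>) * N \<beta> (delta1 S \<phi> (s, t)) * ((t - s) powr (- \<rho>) * (t - s) powr \<rho>)"
        unfolding powr_add[symmetric] using st False by simp
      also have "\<dots> = wt_two_quot \<rho> \<gamma> a (N \<beta>) (delta1 S \<phi>) (s, t) * ((s - a) powr (- \<gamma>) * (t - s) powr \<rho>)"
        unfolding wt_two_quot_def by (simp add: mult_ac)
      also have "\<dots> \<le> ?Q * ((s - a) powr (- \<gamma>) * (t - s) powr \<rho>)"
        using Q[of s t] st False by (intro mult_right_mono) auto
      finally show ?thesis by (simp add: mult.assoc)
    qed
  qed (use exps ab K0 KH P0 Q0 \<phi>c \<delta>c in auto)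
qed

theorem mainTheorem3:
  fixes X :: "real \<Rightarrow> 'x::banach set"
    and N :: "real \<Rightarrow> 'x \<Rightarrow> real"
    and S :: "real \<Rightarrow> 'x \<Rightarrow> 'x"
    and DA :: "'x set"
    and A :: "'x \<Rightarrow> 'x"
    and \<alpha> \<beta> \<eta> \<rho> \<gamma> :: real
  defines "\<kappa> \<equiv> min \<eta> (\<eta> + \<rho> + \<beta> - \<alpha>)"
  defines "\<epsilon>0 \<equiv> min (1 + \<beta> - \<alpha>) (\<kappa> - \<gamma>)"
  assumes "semigroup_scale X N S DA A"
    and "\<alpha> \<in> {0..<2}" and "\<beta> \<in> {0..<2}"
    and "0 \<le> \<alpha> - \<beta>" and "\<alpha> - \<beta> < 1"
    and "\<eta> \<in> {0<..<1}" and "\<rho> \<in> {1 - \<eta><..<1}"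
    and "\<gamma> \<in> {0..<\<kappa>}"
  shows
    "(\<forall>a b x \<phi>. a < b \<and> x \<in> hoelder \<eta> a b \<and> \<phi> \<in> wt_cont \<gamma> a b (X \<alpha>) (N \<alpha>) \<and>
        delta1 S \<phi> \<in> wt_two_hoelder \<rho> \<gamma> a b (X \<beta>) (N \<beta>) \<longrightarrow>
        conv_integral X N S \<beta> \<eta> \<rho> a b x \<phi> \<in>
          (\<Inter>\<epsilon>\<in>{0..<\<epsilon>0}. two_hoelder (\<kappa> - \<gamma> - \<epsilon>) a b (X (\<alpha> + \<epsilon>)) (N (\<alpha> + \<epsilon>)))) \<and>
     (\<forall>\<epsilon>\<in>{0..<\<epsilon>0}. \<forall>d>0. \<exists>C>0. \<forall>a b x \<phi>. a < b \<and> b - a = d \<and> x \<in> hoelder \<eta> a b \<and>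
        \<phi> \<in> wt_cont \<gamma> a b (X \<alpha>) (N \<alpha>) \<and>
        delta1 S \<phi> \<in> wt_two_hoelder \<rho> \<gamma> a b (X \<beta>) (N \<beta>) \<longrightarrow>
        (SUP (s, t)\<in>{(s, t). a \<le> s \<and> s < t \<and> t \<le> b}.
           (t - s) powr (- \<kappa> + \<gamma> + \<epsilon>) * N (\<alpha> + \<epsilon>) (conv_integral X N S \<beta> \<eta> \<rho> a b x \<phi> (s, t)))
        \<le> C * hoelder_norm \<eta> a b x *
           (wt_cont_norm \<gamma> a b (N \<alpha>) \<phi> + wt_two_hoelder_norm \<rho> \<gamma> a b (N \<beta>) (delta1 S \<phi>)))"
proof -
  interpret semigroup_scale X N S DA A by (rule assms(3))
  have exps: "0 \<le> \<beta>" "\<beta> \<le> \<alpha>" "\<alpha> < 2" "\<alpha> - \<beta> < 1" "0 < \<eta>" "\<eta> < 1" "1 - \<eta> < \<rho>" "0 \<le> \<gamma>" "\<gamma> < \<eta>" "\<gamma> < \<eta> + \<rho> + \<beta> - \<alpha>"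
    using assms(4-) unfolding \<kappa>_def by auto
  note data = convolution_data_norms[OF exps]
  \<comment> \<open>One \<open>C\<close> for all data of length \<open>d\<close>. The first claim
    takes the membership part with \<open>d = b - a\<close>, the second one the estimate.\<close>
  have est: "\<exists>C>0. \<forall>a b x \<phi> H P Q. convolution_data X N S DA A a b \<alpha> \<beta> \<eta> \<rho> \<gamma> H P Q x \<phi> \<longrightarrow> b - a = d \<longrightarrow>
      conv_integral X N S \<beta> \<eta> \<rho> a b x \<phi> \<in> two_hoelder (\<kappa> - \<gamma> - \<epsilon>) a b (X (\<alpha> + \<epsilon>)) (N (\<alpha> + \<epsilon>)) \<and>
      (\<forall>s t. a \<le> s \<longrightarrow> s < t \<longrightarrow> t \<le> b \<longrightarrow>
        N (\<alpha> + \<epsilon>) (conv_integral X N S \<beta> \<eta> \<rho> a b x \<phi> (s, t)) \<le> C * (H * (P + Q)) * (t - s) powr (\<kappa> - \<gamma> - \<epsilon>))"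
    if \<epsilon>: "\<epsilon> \<in> {0..<\<epsilon>0}" and d: "0 < d" for \<epsilon> d :: real
  proof -
    have \<epsilon>': "0 \<le> \<epsilon>" "\<epsilon> < 1 + \<beta> - \<alpha>" "\<epsilon> < min \<eta> (\<eta> + \<rho> + \<beta> - \<alpha>) - \<gamma>" using \<epsilon> unfolding \<epsilon>0_def \<kappa>_def by auto
    show ?thesis
      by (rule conv_integral_estimate[OF exps(1-4,7) \<epsilon>' d, folded \<kappa>_def]) blast
  qed
  show ?thesis
  proof (rule conjI; intro allI ballI impI)
    fix a b x \<phi>
    assume h: "a < b \<and> x \<in> hoelder \<eta> a b \<and> \<phi> \<in> wt_cont \<gamma> a b (X \<alpha>) (N \<alpha>) \<and>
        delta1 S \<phi> \<in> wt_two_hoelder \<rho> \<gamma> a b (X \<beta>) (N \<beta>)"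
    show "conv_integral X N S \<beta> \<eta> \<rho> a b x \<phi> \<in>
          (\<Inter>\<epsilon>\<in>{0..<\<epsilon>0}. two_hoelder (\<kappa> - \<gamma> - \<epsilon>) a b (X (\<alpha> + \<epsilon>)) (N (\<alpha> + \<epsilon>)))"
    proof (rule INT_I)
      fix \<epsilon> assume "\<epsilon> \<in> {0..<\<epsilon>0}"
      from est[OF this, of "b - a"] h data[of a b x \<phi>]
      show "conv_integral X N S \<beta> \<eta> \<rho> a b x \<phi> \<in> two_hoelder (\<kappa> - \<gamma> - \<epsilon>) a b (X (\<alpha> + \<epsilon>)) (N (\<alpha> + \<epsilon>))"
        by auto
    qed
  next
    fix \<epsilon> d :: real assume \<epsilon>: "\<epsilon> \<in> {0..<\<epsilon>0}" and d: "0 < d"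
    obtain C where C: "0 < C" "\<And>a b x \<phi> H P Q s t. convolution_data X N S DA A a b \<alpha> \<beta> \<eta> \<rho> \<gamma> H P Q x \<phi> \<Longrightarrow> b - a = d \<Longrightarrow>
      a \<le> s \<Longrightarrow> s < t \<Longrightarrow> t \<le> b \<Longrightarrow>
        N (\<alpha> + \<epsilon>) (conv_integral X N S \<beta> \<eta> \<rho> a b x \<phi> (s, t)) \<le> C * (H * (P + Q)) * (t - s) powr (\<kappa> - \<gamma> - \<epsilon>)"
      using est[OF \<epsilon> d] by blast
    show "\<exists>C>0. \<forall>a b x \<phi>. a < b \<and> b - a = d \<and> x \<in> hoelder \<eta> a b \<and>
        \<phi> \<in> wt_cont \<gamma> a b (X \<alpha>) (N \<alpha>) \<and>
        delta1 S \<phi> \<in> wt_two_hoelder \<rho> \<gamma> a b (X \<beta>) (N \<beta>) \<longrightarrow>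
        (SUP (s, t)\<in>{(s, t). a \<le> s \<and> s < t \<and> t \<le> b}.
           (t - s) powr (- \<kappa> + \<gamma> + \<epsilon>) * N (\<alpha> + \<epsilon>) (conv_integral X N S \<beta> \<eta> \<rho> a b x \<phi> (s, t)))
        \<le> C * hoelder_norm \<eta> a b x *
           (wt_cont_norm \<gamma> a b (N \<alpha>) \<phi> + wt_two_hoelder_norm \<rho> \<gamma> a b (N \<beta>) (delta1 S \<phi>))"
    proof (intro exI[of _ C] conjI allI impI C(1))
      fix a b x \<phi>
      assume h: "a < b \<and> b - a = d \<and> x \<in> hoelder \<eta> a b \<and> \<phi> \<in> wt_cont \<gamma> a b (X \<alpha>) (N \<alpha>) \<and>
        delta1 S \<phi> \<in> wt_two_hoelder \<rho> \<gamma> a b (X \<beta>) (N \<beta>)"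
      let ?B = "C * hoelder_norm \<eta> a b x *
           (wt_cont_norm \<gamma> a b (N \<alpha>) \<phi> + wt_two_hoelder_norm \<rho> \<gamma> a b (N \<beta>) (delta1 S \<phi>))"
      have cd: "convolution_data X N S DA A a b \<alpha> \<beta> \<eta> \<rho> \<gamma> (hoelder_norm \<eta> a b x) (wt_cont_norm \<gamma> a b (N \<alpha>) \<phi>)
        (wt_two_hoelder_norm \<rho> \<gamma> a b (N \<beta>) (delta1 S \<phi>)) x \<phi>" using h by (intro data) auto
      have le: "(t - s) powr (- \<kappa> + \<gamma> + \<epsilon>) * N (\<alpha> + \<epsilon>) (conv_integral X N S \<beta> \<eta> \<rho> a b x \<phi> (s, t)) \<le> ?B"
        if st: "a \<le> s" "s < t" "t \<le> b" for s t
      proof -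
        have "(t - s) powr (- \<kappa> + \<gamma> + \<epsilon>) * N (\<alpha> + \<epsilon>) (conv_integral X N S \<beta> \<eta> \<rho> a b x \<phi> (s, t))
          \<le> (t - s) powr (- \<kappa> + \<gamma> + \<epsilon>) * (?B * (t - s) powr (\<kappa> - \<gamma> - \<epsilon>))"
          using C(2)[OF cd _ st] h by (intro mult_left_mono) (auto simp: mult.assoc)
        also have "\<dots> = ((t - s) powr (- \<kappa> + \<gamma> + \<epsilon>) * (t - s) powr (\<kappa> - \<gamma> - \<epsilon>)) * ?B" by (simp only: mult_ac)
        also have "\<dots> = ?B" unfolding powr_add[symmetric] using st by simp
        finally show ?thesis .
      qed
      show "(SUP (s, t)\<in>{(s, t). a \<le> s \<and> s < t \<and> t \<le> b}.
           (t - s) powr (- \<kappa> + \<gamma> + \<epsilon>) * N (\<alpha> + \<epsilon>) (conv_integral X N S \<beta> \<eta> \<rho> a b x \<phi> (s, t))) \<le> ?B"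
      proof (rule cSUP_least)
        have "(a, b) \<in> {(s, t). a \<le> s \<and> s < t \<and> t \<le> b}" using h by simp
        then show "{(s, t). a \<le> s \<and> s < t \<and> t \<le> b} \<noteq> {}" by blast
      qed (use le in \<open>auto simp: case_prod_beta\<close>)
    qed
  qed
qed

end
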